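(* The statement that every infinite set admits a globally homogeneous linear order is equivalent to the axiom of choice.
   Context: The equivalence is over Zermelo–Fraenkel set theory $\mathrm{ZF}$ (without choice). A linear order $\leqslant$ on a set $S$ is globally homogeneous if it is unbounded (no minimal and no maximal element) and for every pair $a<b$ in $S$ the open interval $(a,b)=\{x\in S\mid a<x<b\}$, with the induced order, is isomorphic to $(S,\leqslant)$ as a linearly ordered set. *)

theory Defs
  imports Main
begin

text \<open>
  HOL proves choice, so the set theory ZF is not identified with HOL's own sets. Instead we
  consider arbitrary first-order structures with one binary relation, the universe being a whole
  type and \<open>x \<epsilon> y\<close> the membership relation of the structure. ``Over ZF'' means: in every such
  structure satisfying the ZF axioms. (By completeness and downward Loewenheim--Skolem this is
  the same as provability in ZF.)

  The two axiom schemes must range over first-order formulas only: with arbitrary HOL predicates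
  in place of formulas, replacement would import HOL's choice into the structure. They are
  therefore stated with a syntax of formulas in named variables, and assignments supply the
  parameters. Everything else is a single sentence and is written directly as a HOL formula
  all of whose quantifiers range over the elements of the structure. In particular, orders,
  functions and isomorphisms are elements of the structure, coded as sets of Kuratowski pairs.
\<close>

datatype fm =
    Mem nat nat
  | Equal nat nat
  | Neg fm
  | Conj fm fm
  | Forall nat fm

primrec sat :: "('a \<Rightarrow> 'a \<Rightarrow> bool) \<Rightarrow> fm \<Rightarrow> (nat \<Rightarrow> 'a) \<Rightarrow> bool" where
  "sat E (Mem i j) v \<longleftrightarrow> E (v i) (v j)"
| "sat E (Equal i j) v \<longleftrightarrow> v i = v j"
| "sat E (Neg p) v \<longleftrightarrow> \<not> sat E p v"
| "sat E (Conj p q) v \<longleftrightarrow> sat E p v \<and> sat E q v"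
| "sat E (Forall i p) v \<longleftrightarrow> (\<forall>x. sat E p (v(i := x)))"

context
  fixes E :: "'a \<Rightarrow> 'a \<Rightarrow> bool"  (infix \<open>\<epsilon>\<close> 50)
begin

definition is_empty :: "'a \<Rightarrow> bool" where
  "is_empty a \<longleftrightarrow> (\<forall>x. \<not> x \<epsilon> a)"

definition is_successor :: "'a \<Rightarrow> 'a \<Rightarrow> bool" where
  "is_successor s a \<longleftrightarrow> (\<forall>x. x \<epsilon> s \<longleftrightarrow> x \<epsilon> a \<or> x = a)"

definition is_inductive :: "'a \<Rightarrow> bool" where
  "is_inductive w \<longleftrightarrow>
     (\<exists>e. is_empty e \<and> e \<epsilon> w) \<and> (\<forall>x. x \<epsilon> w \<longrightarrow> (\<exists>s. is_successor s x \<and> s \<epsilon> w))"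

definition extensionality_ax :: bool where
  "extensionality_ax \<longleftrightarrow> (\<forall>a b. (\<forall>x. x \<epsilon> a \<longleftrightarrow> x \<epsilon> b) \<longrightarrow> a = b)"

definition foundation_ax :: bool where
  "foundation_ax \<longleftrightarrow>
     (\<forall>a. (\<exists>x. x \<epsilon> a) \<longrightarrow> (\<exists>x. x \<epsilon> a \<and> \<not> (\<exists>y. y \<epsilon> x \<and> y \<epsilon> a)))"

definition pairing_ax :: bool where
  "pairing_ax \<longleftrightarrow> (\<forall>a b. \<exists>c. \<forall>x. x \<epsilon> c \<longleftrightarrow> x = a \<or> x = b)"

definition union_ax :: bool where
  "union_ax \<longleftrightarrow> (\<forall>a. \<exists>u. \<forall>x. x \<epsilon> u \<longleftrightarrow> (\<exists>y. y \<epsilon> a \<and> x \<epsilon> y))"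

definition powerset_ax :: bool where
  "powerset_ax \<longleftrightarrow> (\<forall>a. \<exists>p. \<forall>x. x \<epsilon> p \<longleftrightarrow> (\<forall>y. y \<epsilon> x \<longrightarrow> y \<epsilon> a))"

definition infinity_ax :: bool where
  "infinity_ax \<longleftrightarrow> (\<exists>w. is_inductive w)"

definition separation_scheme :: bool where
  "separation_scheme \<longleftrightarrow>
     (\<forall>p v a. \<exists>b. \<forall>x. x \<epsilon> b \<longleftrightarrow> x \<epsilon> a \<and> sat E p (v(0 := x)))"

definition replacement_scheme :: bool where
  "replacement_scheme \<longleftrightarrow>
     (\<forall>p v.
        (\<forall>x y z. sat E p (v(0 := x, 1 := y)) \<and> sat E p (v(0 := x, 1 := z)) \<longrightarrow> y = z) \<longrightarrow>
        (\<forall>a. \<exists>b. \<forall>y. y \<epsilon> b \<longleftrightarrow> (\<exists>x. x \<epsilon> a \<and> sat E p (v(0 := x, 1 := y)))))"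

definition ZF :: bool where
  "ZF \<longleftrightarrow> extensionality_ax \<and> foundation_ax \<and> pairing_ax \<and> union_ax \<and> powerset_ax \<and>
     infinity_ax \<and> separation_scheme \<and> replacement_scheme"

definition is_upair :: "'a \<Rightarrow> 'a \<Rightarrow> 'a \<Rightarrow> bool" where
  "is_upair c a b \<longleftrightarrow> (\<forall>x. x \<epsilon> c \<longleftrightarrow> x = a \<or> x = b)"

definition is_opair :: "'a \<Rightarrow> 'a \<Rightarrow> 'a \<Rightarrow> bool" where
  "is_opair p a b \<longleftrightarrow> (\<exists>c d. is_upair c a a \<and> is_upair d a b \<and> is_upair p c d)"

definition related :: "'a \<Rightarrow> 'a \<Rightarrow> 'a \<Rightarrow> bool" where
  "related r x y \<longleftrightarrow> (\<exists>p. is_opair p x y \<and> p \<epsilon> r)"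

definition is_relation :: "'a \<Rightarrow> 'a \<Rightarrow> 'a \<Rightarrow> bool" where
  "is_relation r A B \<longleftrightarrow> (\<forall>p. p \<epsilon> r \<longrightarrow> (\<exists>x y. x \<epsilon> A \<and> y \<epsilon> B \<and> is_opair p x y))"

definition is_function :: "'a \<Rightarrow> 'a \<Rightarrow> 'a \<Rightarrow> bool" where
  "is_function f A B \<longleftrightarrow> is_relation f A B \<and> (\<forall>x. x \<epsilon> A \<longrightarrow> (\<exists>!y. related f x y))"

definition is_bijection :: "'a \<Rightarrow> 'a \<Rightarrow> 'a \<Rightarrow> bool" where
  "is_bijection f A B \<longleftrightarrow> is_function f A B \<and> (\<forall>y. y \<epsilon> B \<longrightarrow> (\<exists>!x. related f x y))"

definition is_natural :: "'a \<Rightarrow> bool" where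
  "is_natural n \<longleftrightarrow> (\<forall>w. is_inductive w \<longrightarrow> n \<epsilon> w)"

definition finite_in :: "'a \<Rightarrow> bool" where
  "finite_in S \<longleftrightarrow> (\<exists>n f. is_natural n \<and> is_bijection f S n)"

definition AC :: bool where
  "AC \<longleftrightarrow>
     (\<forall>F. (\<forall>X. X \<epsilon> F \<longrightarrow> \<not> is_empty X) \<longrightarrow>
        (\<exists>f B. is_function f F B \<and> (\<forall>X y. X \<epsilon> F \<and> related f X y \<longrightarrow> y \<epsilon> X)))"

definition is_linear_order :: "'a \<Rightarrow> 'a \<Rightarrow> bool" where
  "is_linear_order S r \<longleftrightarrow>
     is_relation r S S \<and>
     (\<forall>x. x \<epsilon> S \<longrightarrow> related r x x) \<and>
     (\<forall>x y. related r x y \<and> related r y x \<longrightarrow> x = y) \<and>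
     (\<forall>x y z. related r x y \<and> related r y z \<longrightarrow> related r x z) \<and>
     (\<forall>x y. x \<epsilon> S \<and> y \<epsilon> S \<longrightarrow> related r x y \<or> related r y x)"

definition strictly_below :: "'a \<Rightarrow> 'a \<Rightarrow> 'a \<Rightarrow> bool" where
  "strictly_below r x y \<longleftrightarrow> related r x y \<and> x \<noteq> y"

definition is_unbounded :: "'a \<Rightarrow> 'a \<Rightarrow> bool" where
  "is_unbounded S r \<longleftrightarrow>
     \<not> (\<exists>m. m \<epsilon> S \<and> (\<forall>x. x \<epsilon> S \<longrightarrow> \<not> strictly_below r x m)) \<and>
     \<not> (\<exists>m. m \<epsilon> S \<and> (\<forall>x. x \<epsilon> S \<longrightarrow> \<not> strictly_below r m x))"

definition is_interval :: "'a \<Rightarrow> 'a \<Rightarrow> 'a \<Rightarrow> 'a \<Rightarrow> 'a \<Rightarrow> bool" where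
  "is_interval I S r a b \<longleftrightarrow>
     (\<forall>x. x \<epsilon> I \<longleftrightarrow> x \<epsilon> S \<and> strictly_below r a x \<and> strictly_below r x b)"

text \<open>Only the restrictions of \<open>r\<close> to \<open>A\<close> and of \<open>s\<close> to \<open>B\<close> matter here, so that a subset with the
  induced order is represented by the subset together with the ambient order.\<close>

definition order_isomorphic :: "'a \<Rightarrow> 'a \<Rightarrow> 'a \<Rightarrow> 'a \<Rightarrow> bool" where
  "order_isomorphic A r B s \<longleftrightarrow>
     (\<exists>f. is_bijection f A B \<and>
        (\<forall>x y x' y'. related f x x' \<and> related f y y' \<longrightarrow> (related r x y \<longleftrightarrow> related s x' y')))"

definition globally_homogeneous :: "'a \<Rightarrow> 'a \<Rightarrow> bool" where
  "globally_homogeneous S r \<longleftrightarrow>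
     is_linear_order S r \<and> is_unbounded S r \<and>
     (\<forall>a b. a \<epsilon> S \<and> b \<epsilon> S \<and> strictly_below r a b \<longrightarrow>
        (\<exists>I. is_interval I S r a b \<and> order_isomorphic I r S r))"

end

end

theory Submission
  imports Defs
begin

text \<open>
  \<^emph>\<open>From homogeneous orders to choice.\<close> Given a set \<open>X\<close>, take an ordinal \<open>W\<close> that does not inject into
  the power set of \<open>X\<close> (\<open>hartogs\<close>) and a homogeneous order on \<open>X \<union> W\<close>. If every interval \<open>(a,b)\<close> with
  \<open>a < b\<close> met \<open>X\<close>, then \<open>w \<mapsto> {x \<in> X. x < w}\<close> would inject \<open>W\<close> into the power set of \<open>X\<close>. So some interval is
  contained in \<open>W\<close>; being isomorphic to the whole order, it receives an injection from \<open>X\<close>. Hence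
  every set injects into an ordinal (\<open>lepoll_ordinal_of_homogeneous\<close>), and a choice function picks
  least elements. If \<open>X \<union> W\<close> is finite, it injects into a natural number, which is an ordinal.

  \<^emph>\<open>From choice to homogeneous orders.\<close> Let \<open>S\<close> be infinite, linearly ordered by choice, and let \<open>Z\<close> be the
  integers of the model. Let \<open>L\<close> be the set of functions \<open>Z \<times> S \<rightarrow> Z\<close> of finite support, compared at
  the least index at which they differ, where \<open>Z \<times> S\<close> is ordered lexicographically. Two kinds of
  automorphisms act on \<open>L\<close>: pointwise translations carry \<open>0\<close> to any element, and shifts of the first
  index coordinate fix \<open>0\<close> and bring any \<open>d > 0\<close> below any \<open>b > 0\<close>. Together they map each half-open
  interval \<open>[c,d)\<close> onto an initial segment, and also onto a final segment, of each other
  one. Lindenbaum's version of the Schroeder--Bernstein theorem for linear orders (\<open>lindenbaum\<close>) then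
  makes all half-open intervals isomorphic (\<open>half_open_isomorphic\<close>). Deleting least elements, all
  open intervals \<open>(a,b)\<close> are isomorphic, so each of them, with the induced order, is globally
  homogeneous. Choice gives \<open>S \<times> S\<close> the cardinality of \<open>S\<close> (\<open>square_lepoll\<close>), hence \<open>L\<close> and suitable
  intervals \<open>(0,b)\<close> also have this cardinality, and the order can be carried over to \<open>S\<close>
  (\<open>homogeneous_of_infinite\<close>).

  \<^emph>\<open>Reasoning inside a model.\<close> Only first-order definable classes may be separated or replaced, so every
  set that the argument forms needs a proof of definability. The predicate \<open>definable\<close> is closed
  under connectives, quantifiers and substitution of definable terms, and the rules collected in
  \<open>defin\<close> follow the syntax of a HOL formula, so that \<open>intro defin\<close> replaces writing down a
  formula. Functions of the model are mostly handled as definable HOL functions; \<open>lam\<close> and \<open>app\<close>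
  pass between them and sets of pairs. The model may be ill-founded from outside, so all
  inductions are carried out inside it.
\<close>

section \<open>First-order definability with parameters\<close>

primrec vars :: "fm \<Rightarrow> nat set" where
  "vars (Mem i j) = {i, j}"
| "vars (Equal i j) = {i, j}"
| "vars (Neg p) = vars p"
| "vars (Conj p q) = vars p \<union> vars q"
| "vars (Forall i p) = insert i (vars p)"

lemma finite_vars: "finite (vars p)"
  by (induction p) auto

lemma sat_cong: "(\<And>i. i \<in> vars p \<Longrightarrow> v i = w i) \<Longrightarrow> sat E p v = sat E p w"
proof (induction p arbitrary: v w)
  case (Forall i p)
  have "sat E p (v(i := x)) = sat E p (w(i := x))" for x
    by (rule Forall.IH) (use Forall.prems in auto)
  then show ?case by simp
next
  case (Conj p q)
  have "sat E p v = sat E p w" by (rule Conj.IH(1)) (use Conj.prems in auto)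
  moreover have "sat E q v = sat E q w" by (rule Conj.IH(2)) (use Conj.prems in auto)
  ultimately show ?case by simp
next
  case (Mem i j)
  have "v i = w i" "v j = w j" by (rule Mem, simp)+
  then show ?case by simp
next
  case (Equal i j)
  have "v i = w i" "v j = w j" by (rule Equal, simp)+
  then show ?case by simp
next
  case (Neg p)
  have "sat E p v = sat E p w" by (rule Neg.IH) (use Neg.prems in auto)
  then show ?case by simp
qed

text \<open>Renaming must avoid capture: under a quantifier the bound variable is first moved to an
  index that no renamed variable uses.\<close>
lemma sat_rename: "\<exists>q. \<forall>v. sat E q v = sat E p (v \<circ> \<sigma>)"
proof (induction p arbitrary: \<sigma>)
  case (Mem i j)
  show ?case by (rule exI[of _ "Mem (\<sigma> i) (\<sigma> j)"]) simp
next
  case (Equal i j)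
  show ?case by (rule exI[of _ "Equal (\<sigma> i) (\<sigma> j)"]) simp
next
  case (Neg p)
  then obtain q where "\<forall>v. sat E q v = sat E p (v \<circ> \<sigma>)" by blast
  then show ?case by (intro exI[of _ "Neg q"]) (simp add: comp_def)
next
  case (Conj p1 p2)
  then obtain q1 q2 where "\<forall>v. sat E q1 v = sat E p1 (v \<circ> \<sigma>)" "\<forall>v. sat E q2 v = sat E p2 (v \<circ> \<sigma>)" by blast
  then show ?case by (intro exI[of _ "Conj q1 q2"]) (simp add: comp_def)
next
  case (Forall i p)
  obtain k where k: "k \<notin> \<sigma> ` vars p"
    using finite_vars[of p] by (metis ex_new_if_finite finite_imageI infinite_UNIV_nat)
  obtain q where q: "\<forall>v. sat E q v = sat E p (v \<circ> \<sigma>(i := k))" using Forall by blast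
  have "sat E p ((v \<circ> \<sigma>)(i := x)) = sat E p (v(k := x) \<circ> \<sigma>(i := k))" for v x
    by (rule sat_cong) (use k in auto)
  with q have "sat E (Forall k q) v = sat E (Forall i p) (v \<circ> \<sigma>)" for v
    by (simp only: sat.simps)
  then show ?case by blast
qed

text \<open>An assignment of variables \<open>v\<close> and a sequence of parameters \<open>u\<close> are stored in the even and
  the odd positions of one assignment. This leaves room for infinitely many parameters whatever
  the variables of a formula are.\<close>
definition interleave :: "(nat \<Rightarrow> 'a) \<Rightarrow> (nat \<Rightarrow> 'a) \<Rightarrow> nat \<Rightarrow> 'a" where
  "interleave u v i = (if even i then v (i div 2) else u (i div 2))"

lemma interleave_even [simp]: "interleave u v (2 * i) = v i"
  and interleave_odd [simp]: "interleave u v (Suc (2 * i)) = u i"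
  by (auto simp: interleave_def)

locale zf_model =
  fixes E :: "'a \<Rightarrow> 'a \<Rightarrow> bool"  (infix \<open>\<epsilon>\<close> 50)
  assumes ZF: "ZF E"
begin

text \<open>Predicates of whole assignments serve all arities at once. In the rules for quantifiers
  the bound variable becomes variable \<open>0\<close> and the others move up by one, as with de Bruijn
  indices, so that higher-order unification can peel off the outermost symbol of a formula written
  in HOL.\<close>
definition definable :: "((nat \<Rightarrow> 'a) \<Rightarrow> bool) \<Rightarrow> bool" where
  "definable P \<longleftrightarrow> (\<exists>p u. \<forall>v. P v = sat E p (interleave u v))"

lemma definableI: "(\<And>v. P v = sat E p (interleave u v)) \<Longrightarrow> definable P"
  unfolding definable_def by blast

text \<open>The function \<open>s\<close> says what becomes of each variable: it is renamed (\<open>Inl\<close>) or replaced by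
  a parameter (\<open>Inr\<close>).\<close>
lemma definable_spec:
  assumes "definable P"
  shows "definable (\<lambda>w. P (\<lambda>i. case s i of Inl j \<Rightarrow> w j | Inr a \<Rightarrow> a))"
proof -
  obtain p u where p: "\<And>v. P v = sat E p (interleave u v)"
    using assms unfolding definable_def by blast
  define u' where "u' = interleave u (\<lambda>i. case s i of Inl j \<Rightarrow> undefined | Inr a \<Rightarrow> a)"
  define \<sigma> where "\<sigma> i = (if even i then (case s (i div 2) of Inl j \<Rightarrow> 2 * j | Inr a \<Rightarrow> Suc (2 * (2 * (i div 2))))
      else Suc (2 * (Suc (2 * (i div 2)))))" for i
  obtain q where q: "\<forall>v. sat E q v = sat E p (v \<circ> \<sigma>)" using sat_rename by blast
  have "interleave u (\<lambda>i. case s i of Inl j \<Rightarrow> w j | Inr a \<Rightarrow> a) = interleave u' w \<circ> \<sigma>" for w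
  proof
    fix i
    show "interleave u (\<lambda>i. case s i of Inl j \<Rightarrow> w j | Inr a \<Rightarrow> a) i = (interleave u' w \<circ> \<sigma>) i"
    proof (cases "even i")
      case True
      then show ?thesis
        by (cases "s (i div 2)") (simp_all add: \<sigma>_def u'_def interleave_def)
    next
      case False
      then show ?thesis by (simp only: \<sigma>_def u'_def comp_def if_False interleave_odd) (simp add: interleave_def)
    qed
  qed
  then show ?thesis by (intro definableI[of _ q u']) (simp add: p q)
qed

lemma definable_rename: "definable P \<Longrightarrow> definable (\<lambda>w. P (\<lambda>i. w (\<sigma> i)))"
  using definable_spec[of P "\<lambda>i. Inl (\<sigma> i)"] by simp

lemma definable_tail: "definable P \<Longrightarrow> definable (\<lambda>w. P (\<lambda>i. w (Suc i)))"
  by (rule definable_rename)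

text \<open>The rules that decompose a formula or a term.\<close>
named_theorems defin

lemma definable_not [defin]: "definable P \<Longrightarrow> definable (\<lambda>v. \<not> P v)"
  unfolding definable_def by (metis sat.simps(3))

lemma definable_conj [defin]:
  assumes "definable P" "definable Q"
  shows "definable (\<lambda>v. P v \<and> Q v)"
proof -
  obtain p u where p: "\<And>v. P v = sat E p (interleave u v)"
    using assms unfolding definable_def by blast
  obtain q t where q: "\<And>v. Q v = sat E q (interleave t v)"
    using assms unfolding definable_def by blast
  define \<sigma> :: "nat \<Rightarrow> nat" where "\<sigma> i = (if even i then i else Suc (2 * (2 * (i div 2))))" for i
  define \<tau> :: "nat \<Rightarrow> nat" where "\<tau> i = (if even i then i else Suc (2 * (Suc (2 * (i div 2)))))" for i
  obtain p' where p': "\<forall>v. sat E p' v = sat E p (v \<circ> \<sigma>)" using sat_rename by blast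
  obtain q' where q': "\<forall>v. sat E q' v = sat E q (v \<circ> \<tau>)" using sat_rename by blast
  have 1: "interleave (interleave t u) v \<circ> \<sigma> = interleave u v" for v
  proof
    fix i show "(interleave (interleave t u) v \<circ> \<sigma>) i = interleave u v i"
      by (cases "even i") (simp_all only: \<sigma>_def comp_def if_True if_False interleave_odd interleave_even, simp_all add: interleave_def)
  qed
  have 2: "interleave (interleave t u) v \<circ> \<tau> = interleave t v" for v
  proof
    fix i show "(interleave (interleave t u) v \<circ> \<tau>) i = interleave t v i"
      by (cases "even i") (simp_all only: \<tau>_def comp_def if_True if_False interleave_odd interleave_even, simp_all add: interleave_def)
  qed
  show ?thesis
    by (intro definableI[of _ "Conj p' q'" "interleave t u"]) (simp add: p' q' 1 2 p q)
qed

lemma definable_imp [defin]: "definable P \<Longrightarrow> definable Q \<Longrightarrow> definable (\<lambda>v. P v \<longrightarrow> Q v)"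
proof -
  assume "definable P" "definable Q"
  then have "definable (\<lambda>v. \<not> (P v \<and> \<not> Q v))" by (intro definable_not definable_conj)
  then show ?thesis by simp
qed

lemma definable_disj [defin]: "definable P \<Longrightarrow> definable Q \<Longrightarrow> definable (\<lambda>v. P v \<or> Q v)"
proof -
  assume "definable P" "definable Q"
  then have "definable (\<lambda>v. \<not> P v \<longrightarrow> Q v)" by (intro definable_not definable_imp)
  then show ?thesis by (simp add: disj_imp)
qed

lemma definable_iff [defin]: "definable P \<Longrightarrow> definable Q \<Longrightarrow> definable (\<lambda>v. P v = Q v)"
  unfolding iff_conv_conj_imp by (intro definable_conj definable_imp)

lemma definable_all [defin]:
  assumes "definable (\<lambda>w. Q (\<lambda>i. w (Suc i)) (w 0))"
  shows "definable (\<lambda>v. \<forall>x. Q v x)"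
proof -
  obtain p u where p: "\<And>w. Q (\<lambda>i. w (Suc i)) (w 0) = sat E p (interleave u w)"
    using assms unfolding definable_def by blast
  obtain B where B: "\<And>i. i \<in> vars p \<Longrightarrow> i < B"
    using finite_vars[of p] by (meson finite_nat_set_iff_bounded)
  \<comment> \<open>Position \<open>2 * B\<close> is a variable position beyond all variables of \<open>p\<close>; it takes over
    the role of position \<open>0\<close>, and the other variable positions move down.\<close>
  define \<sigma> :: "nat \<Rightarrow> nat" where "\<sigma> i = (if i = 0 then 2 * B else if even i then i - 2 else i)" for i
  obtain q where q: "\<forall>v. sat E q v = sat E p (v \<circ> \<sigma>)" using sat_rename by blast
  have "Q v x = sat E q ((interleave u v)(2 * B := x))" for v x
  proof -
    have "Q v x = sat E p (interleave u (case_nat x v))"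
      using p[of "case_nat x v"] by simp
    also have "\<dots> = sat E p ((interleave u v)(2 * B := x) \<circ> \<sigma>)"
    proof (rule sat_cong)
      fix i assume "i \<in> vars p"
      then have "i < B" by (rule B)
      moreover have "i div 2 - Suc 0 = (i - 2) div 2" by linarith
      ultimately show "interleave u (case_nat x v) i = ((interleave u v)(2 * B := x) \<circ> \<sigma>) i"
        by (auto simp: interleave_def \<sigma>_def split: nat.split)
    qed
    finally show ?thesis using q by simp
  qed
  then show ?thesis by (intro definableI[of _ "Forall (2 * B) q" u]) simp
qed

lemma definable_ex [defin]:
  assumes "definable (\<lambda>w. Q (\<lambda>i. w (Suc i)) (w 0))"
  shows "definable (\<lambda>v. \<exists>x. Q v x)"
proof -
  have "definable (\<lambda>v. \<not> (\<forall>x. \<not> Q v x))"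
    by (rule definable_not, rule definable_all, rule definable_not, rule assms)
  then show ?thesis by simp
qed

lemma definable_ex1 [defin]:
  assumes "definable (\<lambda>w. Q (\<lambda>i. w (Suc i)) (w 0))"
    "definable (\<lambda>w. Q (\<lambda>i. w (Suc (Suc i))) (w 0) \<longrightarrow> w 0 = w (Suc 0))"
  shows "definable (\<lambda>v. \<exists>!x. Q v x)"
  unfolding Ex1_def
  by (rule definable_ex, rule definable_conj, rule assms(1), rule definable_all, rule assms(2))

definition definable_term :: "((nat \<Rightarrow> 'a) \<Rightarrow> 'a) \<Rightarrow> bool" where
  "definable_term f \<longleftrightarrow> definable (\<lambda>w. w 0 = f (\<lambda>i. w (Suc i)))"

lemma definable_eq_var: "definable (\<lambda>w. w i = w j)"
  by (rule definableI[of _ "Equal (2 * i) (2 * j)"]) simp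

lemma definable_mem_var: "definable (\<lambda>w. w i \<epsilon> w j)"
  by (rule definableI[of _ "Mem (2 * i) (2 * j)"]) simp

lemma definable_var [defin]: "definable_term (\<lambda>w. w i)"
  unfolding definable_term_def by (rule definable_eq_var)

lemma definable_param [defin]: "definable_term (\<lambda>w. c)"
  unfolding definable_term_def
  by (rule definableI[of _ "Equal 0 1" "\<lambda>i. c"]) (simp add: interleave_def)

text \<open>The reason is \<open>P (f v) \<longleftrightarrow> (\<exists>x. x = f v \<and> P x)\<close>.\<close>
lemma definable_subst:
  assumes "definable_term f" "definable P"
  shows "definable (\<lambda>v. P (case_nat (f v) v))"
proof -
  have "definable (\<lambda>v. \<exists>x. x = f v \<and> P (case_nat x v))"
  proof (intro definable_ex definable_conj)
    show "definable (\<lambda>w. w 0 = f (\<lambda>i. w (Suc i)))" using assms(1) unfolding definable_term_def .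
    have "case_nat (w 0) (\<lambda>i. w (Suc i)) = w" for w :: "nat \<Rightarrow> 'a" by (auto split: nat.split)
    then show "definable (\<lambda>w. P (case_nat (w 0) (\<lambda>i. w (Suc i))))" using assms(2) by simp
  qed
  then show ?thesis by simp
qed

lemma definable_term_rename:
  assumes "definable_term f" shows "definable_term (\<lambda>w. f (\<lambda>i. w (\<sigma> i)))"
  using definable_rename[OF assms[unfolded definable_term_def], of "case_nat 0 (\<lambda>i. Suc (\<sigma> i))"]
  unfolding definable_term_def by simp

lemma definable_term_tail: "definable_term f \<Longrightarrow> definable_term (\<lambda>w. f (\<lambda>i. w (Suc i)))"
  by (rule definable_term_rename)

text \<open>These rules reduce definability of a defined constant applied to arbitrary terms to
  definability of its defining formula in variables.\<close>
lemma definable_comp1: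
  assumes "definable (\<lambda>w. P (w 0))" "definable_term f"
  shows "definable (\<lambda>v. P (f v))"
  using definable_subst[OF assms(2,1)] by simp

lemma definable_comp2:
  assumes "definable (\<lambda>w. P (w 0) (w (Suc 0)))" "definable_term f" "definable_term g"
  shows "definable (\<lambda>v. P (f v) (g v))"
proof -
  have R: "definable (\<lambda>w. P (w (Suc 0)) (w 0))"
    using definable_rename[OF assms(1), of "case_nat (Suc 0) (\<lambda>_. 0)"] by simp
  have "definable (\<lambda>w. P (w 0) (g (\<lambda>i. w (Suc i))))"
    using definable_subst[OF definable_term_tail[OF assms(3)] R] by simp
  from definable_subst[OF assms(2) this] show ?thesis by simp
qed

lemma definable_comp3:
  assumes "definable (\<lambda>w. P (w 0) (w (Suc 0)) (w (Suc (Suc 0))))"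
    "definable_term f" "definable_term g" "definable_term h"
  shows "definable (\<lambda>v. P (f v) (g v) (h v))"
proof -
  have R: "definable (\<lambda>w. P (w (Suc (Suc 0))) (w (Suc 0)) (w 0))"
    using definable_rename[OF assms(1), of "case_nat (Suc (Suc 0)) (case_nat (Suc 0) (\<lambda>_. 0))"] by simp
  have "definable (\<lambda>w. P (w (Suc 0)) (w 0) (h (\<lambda>i. w (Suc (Suc i)))))"
    using definable_subst[OF definable_term_tail[OF definable_term_tail[OF assms(4)]] R] by simp
  from definable_subst[OF definable_term_tail[OF assms(3)] this]
  have "definable (\<lambda>w. P (w 0) (g (\<lambda>i. w (Suc i))) (h (\<lambda>i. w (Suc i))))" by simp
  from definable_subst[OF assms(2) this] show ?thesis by simp
qed

lemma definable_comp4: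
  assumes "definable (\<lambda>w. P (w 0) (w (Suc 0)) (w (Suc (Suc 0))) (w (Suc (Suc (Suc 0)))))"
    "definable_term f" "definable_term g" "definable_term h" "definable_term k"
  shows "definable (\<lambda>v. P (f v) (g v) (h v) (k v))"
proof -
  have R: "definable (\<lambda>w. P (w (Suc 0)) (w (Suc (Suc 0))) (w (Suc (Suc (Suc 0)))) (w 0))"
    using definable_rename[OF assms(1), of "case_nat (Suc 0) (case_nat (Suc (Suc 0)) (case_nat (Suc (Suc (Suc 0))) (\<lambda>_. 0)))"] by simp
  have R: "definable (\<lambda>w. P (w 0) (w (Suc 0)) (w (Suc (Suc 0))) (k (\<lambda>i. w (Suc (Suc (Suc i))))))"
    using definable_subst[OF definable_term_tail[OF definable_term_tail[OF definable_term_tail[OF assms(5)]]] R] by simp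
  have R: "definable (\<lambda>w. P (w (Suc 0)) (w (Suc (Suc 0))) (w 0) (k (\<lambda>i. w (Suc (Suc (Suc i))))))"
    using definable_rename[OF R, of "case_nat (Suc 0) (case_nat (Suc (Suc 0)) (case_nat 0 (\<lambda>i. Suc (Suc (Suc i)))))"] by simp
  have R: "definable (\<lambda>w. P (w 0) (w (Suc 0)) (h (\<lambda>i. w (Suc (Suc i)))) (k (\<lambda>i. w (Suc (Suc i)))))"
    using definable_subst[OF definable_term_tail[OF definable_term_tail[OF assms(4)]] R] by simp
  have R: "definable (\<lambda>w. P (w (Suc 0)) (w 0) (h (\<lambda>i. w (Suc (Suc i)))) (k (\<lambda>i. w (Suc (Suc i)))))"
    using definable_rename[OF R, of "case_nat (Suc 0) (case_nat 0 (\<lambda>i. (Suc (Suc i))))"] by simp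
  from definable_subst[OF definable_term_tail[OF assms(3)] R]
  have "definable (\<lambda>w. P (w 0) (g (\<lambda>i. w (Suc i))) (h (\<lambda>i. w (Suc i))) (k (\<lambda>i. w (Suc i))))" by simp
  from definable_subst[OF assms(2) this] show ?thesis by simp
qed

lemma definable_eq [defin]:
  "definable_term f \<Longrightarrow> definable_term g \<Longrightarrow> definable (\<lambda>v. f v = g v)"
  by (rule definable_comp2[of "(=)"]) (rule definable_eq_var)

lemma definable_mem [defin]:
  "definable_term f \<Longrightarrow> definable_term g \<Longrightarrow> definable (\<lambda>v. f v \<epsilon> g v)"
  by (rule definable_comp2[of "(\<epsilon>)"]) (rule definable_mem_var)

lemma definable_term_comp1:
  assumes "definable_term (\<lambda>w. F (w 0))" "definable_term f"
  shows "definable_term (\<lambda>v. F (f v))"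
  unfolding definable_term_def
  by (rule definable_comp2[of "\<lambda>x y. x = F y", OF assms(1)[unfolded definable_term_def]])
     (intro definable_var definable_term_tail assms)+

lemma definable_term_comp2:
  assumes "definable_term (\<lambda>w. F (w 0) (w (Suc 0)))" "definable_term f" "definable_term g"
  shows "definable_term (\<lambda>v. F (f v) (g v))"
  unfolding definable_term_def
  by (rule definable_comp3[of "\<lambda>x y z. x = F y z", OF assms(1)[unfolded definable_term_def]])
     (intro definable_var definable_term_tail assms)+

lemma definable_term_comp3:
  assumes "definable_term (\<lambda>w. F (w 0) (w (Suc 0)) (w (Suc (Suc 0))))" "definable_term f" "definable_term g" "definable_term h"
  shows "definable_term (\<lambda>v. F (f v) (g v) (h v))"
  unfolding definable_term_def
  by (rule definable_comp4[of "\<lambda>x y z u. x = F y z u", OF assms(1)[unfolded definable_term_def]])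
     (intro definable_var definable_term_tail assms)+

text \<open>Under a binder, separation and replacement are applied with the outer variables \<open>v\<close> held
  fixed as parameters.\<close>
lemma definable_fix:
  assumes "definable (\<lambda>w. Q (\<lambda>i. w (Suc i)) (w 0))"
  shows "definable (\<lambda>w. Q v (w 0))"
  using definable_spec[OF assms, of "case_nat (Inl 0) (\<lambda>i. Inr (v i))"] by simp

lemma definable_term_if [defin]:
  assumes "definable P" "definable_term f" "definable_term g"
  shows "definable_term (\<lambda>v. if P v then f v else g v)"
proof -
  have "definable (\<lambda>w. (P (\<lambda>i. w (Suc i)) \<longrightarrow> w 0 = f (\<lambda>i. w (Suc i))) \<and> (\<not> P (\<lambda>i. w (Suc i)) \<longrightarrow> w 0 = g (\<lambda>i. w (Suc i))))"
    by (intro defin definable_tail[OF assms(1)] definable_term_tail[OF assms(2)] definable_term_tail[OF assms(3)])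
  moreover have "(w 0 = (if P (\<lambda>i. w (Suc i)) then f (\<lambda>i. w (Suc i)) else g (\<lambda>i. w (Suc i)))) = ((P (\<lambda>i. w (Suc i)) \<longrightarrow> w 0 = f (\<lambda>i. w (Suc i))) \<and> (\<not> P (\<lambda>i. w (Suc i)) \<longrightarrow> w 0 = g (\<lambda>i. w (Suc i))))" for w
    by simp
  ultimately show ?thesis unfolding definable_term_def by simp
qed

section \<open>Sets, pairs and functions in a model of ZF\<close>

lemma ext: "(\<And>x. x \<epsilon> a \<longleftrightarrow> x \<epsilon> b) \<Longrightarrow> a = b"
  using ZF unfolding ZF_def extensionality_ax_def by blast

definition is_set :: "('a \<Rightarrow> bool) \<Rightarrow> bool" where
  "is_set Q \<longleftrightarrow> (\<exists>a. \<forall>x. x \<epsilon> a \<longleftrightarrow> Q x)"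

definition setof :: "('a \<Rightarrow> bool) \<Rightarrow> 'a" where
  "setof Q = (THE a. \<forall>x. x \<epsilon> a \<longleftrightarrow> Q x)"

lemma setof_eq_iff: "is_set Q \<Longrightarrow> a = setof Q \<longleftrightarrow> (\<forall>x. x \<epsilon> a \<longleftrightarrow> Q x)"
proof -
  assume "is_set Q"
  then obtain b where b: "\<forall>x. x \<epsilon> b \<longleftrightarrow> Q x" unfolding is_set_def by blast
  then have "setof Q = b" unfolding setof_def by (intro the_equality) (auto intro: ext)
  then show ?thesis using b ext by blast
qed

lemma mem_setof: "is_set Q \<Longrightarrow> x \<epsilon> setof Q \<longleftrightarrow> Q x"
  using setof_eq_iff by blast

text \<open>The basic set constructors are instances of \<open>setof\<close>, so this one rule makes all of them
  definable: \<open>a = setof Q\<close> says which elements \<open>a\<close> has.\<close>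
lemma definable_setof:
  assumes "\<And>v. is_set (Q v)" "definable (\<lambda>w. Q (\<lambda>i. w (Suc i)) (w 0))"
  shows "definable_term (\<lambda>v. setof (Q v))"
proof -
  have "definable (\<lambda>w. Q (\<lambda>i. w (Suc (Suc i))) (w 0))"
    using definable_rename[OF assms(2), of "case_nat 0 (\<lambda>i. Suc (Suc i))"] by simp
  then have "definable (\<lambda>w. \<forall>x. x \<epsilon> w 0 \<longleftrightarrow> Q (\<lambda>i. w (Suc i)) x)"
    by (intro definable_all definable_iff) (intro defin)
  then show ?thesis unfolding definable_term_def by (simp add: setof_eq_iff[OF assms(1)])
qed

lemma is_set_sep:
  assumes "definable (\<lambda>w. P (w 0))" shows "is_set (\<lambda>x. x \<epsilon> A \<and> P x)"
proof -
  obtain p u where p: "\<And>w. P (w 0) = sat E p (interleave u w)"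
    using assms unfolding definable_def by blast
  have "interleave u (\<lambda>i. if i = 0 then x else y) = (interleave u (\<lambda>_. y))(0 := x)" for x y
    by (rule HOL.ext) (auto simp: interleave_def)
  then have "P x = sat E p ((interleave u (\<lambda>_. undefined))(0 := x))" for x
    using p[of "\<lambda>i. if i = 0 then x else undefined"] by simp
  then show ?thesis using ZF unfolding ZF_def separation_scheme_def is_set_def by simp
qed

lemma is_set_upair: "is_set (\<lambda>x. x = a \<or> x = b)"
  using ZF unfolding ZF_def pairing_ax_def is_set_def by blast

lemma is_set_Union: "is_set (\<lambda>x. \<exists>y. y \<epsilon> a \<and> x \<epsilon> y)"
  using ZF unfolding ZF_def union_ax_def is_set_def by blast

lemma is_set_Pow: "is_set (\<lambda>x. \<forall>y. y \<epsilon> x \<longrightarrow> y \<epsilon> a)"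
  using ZF unfolding ZF_def powerset_ax_def is_set_def by blast

lemma is_set_replace:
  assumes "definable (\<lambda>w. P (w 0) (w (Suc 0)))" "\<And>x y z. P x y \<Longrightarrow> P x z \<Longrightarrow> y = z"
  shows "is_set (\<lambda>y. \<exists>x. x \<epsilon> A \<and> P x y)"
proof -
  obtain p u where p: "\<And>w. P (w 0) (w (Suc 0)) = sat E p (interleave u w)"
    using assms(1) unfolding definable_def by blast
  \<comment> \<open>The replacement scheme reads its second variable at position \<open>1\<close>, the interleaved
    assignment at position \<open>2\<close>.\<close>
  define \<sigma> :: "nat \<Rightarrow> nat" where "\<sigma> i = (if i = 2 then 1 else if i = 1 then 2 else i)" for i
  obtain q where q: "\<forall>v. sat E q v = sat E p (v \<circ> \<sigma>)" using sat_rename by blast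
  define t where "t = interleave u (\<lambda>_. undefined) \<circ> \<sigma>"
  have "t(0 := x, 1 := y) \<circ> \<sigma> = interleave u (case_nat x (case_nat y (\<lambda>_. undefined)))" for x y
    by (rule HOL.ext) (auto simp: interleave_def \<sigma>_def t_def split: nat.split)
  then have P: "P x y = sat E q (t(0 := x, 1 := y))" for x y
    using p[of "case_nat x (case_nat y (\<lambda>_. undefined))"] q by simp
  have "\<forall>p v. (\<forall>x y z. sat E p (v(0 := x, 1 := y)) \<and> sat E p (v(0 := x, 1 := z)) \<longrightarrow> y = z) \<longrightarrow>
        (\<forall>a. \<exists>b. \<forall>y. y \<epsilon> b \<longleftrightarrow> (\<exists>x. x \<epsilon> a \<and> sat E p (v(0 := x, 1 := y))))"
    using ZF unfolding ZF_def replacement_scheme_def by blast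
  from this[rule_format, of q t] show ?thesis
    using assms(2) unfolding is_set_def P by blast
qed

lemma foundation: "x \<epsilon> a \<Longrightarrow> \<exists>x. x \<epsilon> a \<and> (\<forall>y. y \<epsilon> x \<longrightarrow> \<not> y \<epsilon> a)"
  using ZF unfolding ZF_def foundation_ax_def by blast

definition emp :: 'a where "emp = setof (\<lambda>x. False)"
definition upair :: "'a \<Rightarrow> 'a \<Rightarrow> 'a" where "upair a b = setof (\<lambda>x. x = a \<or> x = b)"
definition union :: "'a \<Rightarrow> 'a" where "union a = setof (\<lambda>x. \<exists>y. y \<epsilon> a \<and> x \<epsilon> y)"
definition pow :: "'a \<Rightarrow> 'a" where "pow a = setof (\<lambda>x. \<forall>y. y \<epsilon> x \<longrightarrow> y \<epsilon> a)"
definition sep :: "'a \<Rightarrow> ('a \<Rightarrow> bool) \<Rightarrow> 'a" where "sep A P = setof (\<lambda>x. x \<epsilon> A \<and> P x)"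
definition img :: "'a \<Rightarrow> ('a \<Rightarrow> 'a) \<Rightarrow> 'a" where "img A F = setof (\<lambda>y. \<exists>x. x \<epsilon> A \<and> y = F x)"

lemma mem_emp [simp]: "\<not> x \<epsilon> emp"
proof -
  have "definable (\<lambda>w. w 0 \<noteq> w 0)" by (intro defin)
  then have "is_set (\<lambda>x. False)" using is_set_sep[of "\<lambda>x. x \<noteq> x" undefined] by simp
  then show ?thesis unfolding emp_def using mem_setof by blast
qed

lemma mem_upair [simp]: "x \<epsilon> upair a b \<longleftrightarrow> x = a \<or> x = b"
  unfolding upair_def by (rule mem_setof[OF is_set_upair])

lemma mem_union [simp]: "x \<epsilon> union a \<longleftrightarrow> (\<exists>y. y \<epsilon> a \<and> x \<epsilon> y)"
  unfolding union_def by (rule mem_setof[OF is_set_Union])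

lemma mem_pow [simp]: "x \<epsilon> pow a \<longleftrightarrow> (\<forall>y. y \<epsilon> x \<longrightarrow> y \<epsilon> a)"
  unfolding pow_def by (rule mem_setof[OF is_set_Pow])

lemma mem_sep: "definable (\<lambda>w. P (w 0)) \<Longrightarrow> x \<epsilon> sep A P \<longleftrightarrow> x \<epsilon> A \<and> P x"
  unfolding sep_def by (rule mem_setof[OF is_set_sep])

lemma is_set_img: "definable_term (\<lambda>w. F (w 0)) \<Longrightarrow> is_set (\<lambda>y. \<exists>x. x \<epsilon> A \<and> y = F x)"
  by (rule is_set_replace) (auto intro: definable_eq definable_var definable_term_comp1)

lemma mem_img: "definable_term (\<lambda>w. F (w 0)) \<Longrightarrow> y \<epsilon> img A F \<longleftrightarrow> (\<exists>x. x \<epsilon> A \<and> y = F x)"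
  unfolding img_def by (rule mem_setof[OF is_set_img])

lemma definable_upair [defin]: "definable_term f \<Longrightarrow> definable_term g \<Longrightarrow> definable_term (\<lambda>v. upair (f v) (g v))"
  apply (rule definable_term_comp2[of upair])
  unfolding upair_def by (rule definable_setof, rule is_set_upair, intro defin)

lemma definable_union [defin]: "definable_term f \<Longrightarrow> definable_term (\<lambda>v. union (f v))"
  apply (rule definable_term_comp1[of union])
  unfolding union_def by (rule definable_setof, rule is_set_Union, intro defin)

lemma definable_pow [defin]: "definable_term f \<Longrightarrow> definable_term (\<lambda>v. pow (f v))"
  apply (rule definable_term_comp1[of pow])
  unfolding pow_def by (rule definable_setof, rule is_set_Pow, intro defin)

lemma definable_sep [defin]:
  assumes "definable_term A" "definable (\<lambda>w. P (\<lambda>i. w (Suc i)) (w 0))"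
  shows "definable_term (\<lambda>v. sep (A v) (P v))"
  unfolding sep_def
  by (rule definable_setof, rule is_set_sep, rule definable_fix[OF assms(2)])
     (intro definable_conj definable_mem definable_var definable_term_tail assms)

lemma definable_img [defin]:
  assumes "definable_term A" "definable_term (\<lambda>w. F (\<lambda>i. w (Suc i)) (w 0))"
  shows "definable_term (\<lambda>v. img (A v) (F v))"
proof -
  have F: "definable_term (\<lambda>w. F (\<lambda>i. w (Suc (Suc i))) (w 0))"
    using definable_term_rename[OF assms(2), of "case_nat 0 (\<lambda>i. Suc (Suc i))"] by simp
  have "definable_term (\<lambda>w. F v (w 0))" for v
    using definable_spec[OF assms(2)[unfolded definable_term_def], of "case_nat (Inl 0) (case_nat (Inl 1) (\<lambda>i. Inr (v i)))"]
    unfolding definable_term_def by simp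
  then show ?thesis unfolding img_def
    by (intro definable_setof is_set_img)
       (auto intro!: definable_ex definable_conj definable_mem definable_eq definable_var F
             definable_term_tail[OF definable_term_tail[OF assms(1)]])
qed

definition un :: "'a \<Rightarrow> 'a \<Rightarrow> 'a" where "un a b = union (upair a b)"
definition sing :: "'a \<Rightarrow> 'a" where "sing a = upair a a"
definition succ :: "'a \<Rightarrow> 'a" where "succ a = un a (sing a)"
definition opair :: "'a \<Rightarrow> 'a \<Rightarrow> 'a" where "opair a b = upair (upair a a) (upair a b)"

lemma mem_un [simp]: "x \<epsilon> un a b \<longleftrightarrow> x \<epsilon> a \<or> x \<epsilon> b" unfolding un_def by auto
lemma mem_sing [simp]: "x \<epsilon> sing a \<longleftrightarrow> x = a" unfolding sing_def by auto
lemma mem_succ [simp]: "x \<epsilon> succ a \<longleftrightarrow> x \<epsilon> a \<or> x = a" unfolding succ_def by auto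

lemma definable_un [defin]: "definable_term f \<Longrightarrow> definable_term g \<Longrightarrow> definable_term (\<lambda>v. un (f v) (g v))"
  unfolding un_def by (intro defin)
lemma definable_sing [defin]: "definable_term f \<Longrightarrow> definable_term (\<lambda>v. sing (f v))"
  unfolding sing_def by (intro defin)
lemma definable_succ [defin]: "definable_term f \<Longrightarrow> definable_term (\<lambda>v. succ (f v))"
  unfolding succ_def by (intro defin)
lemma definable_opair [defin]: "definable_term f \<Longrightarrow> definable_term g \<Longrightarrow> definable_term (\<lambda>v. opair (f v) (g v))"
  unfolding opair_def by (intro defin)

lemma upair_eq_iff: "upair a b = upair c d \<longleftrightarrow> a = c \<and> b = d \<or> a = d \<and> b = c"
proof
  assume "upair a b = upair c d"
  then have "x = a \<or> x = b \<longleftrightarrow> x = c \<or> x = d" for x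
    using mem_upair[of x a b] mem_upair[of x c d] by simp
  from this[of a] this[of b] this[of c] this[of d]
  show "a = c \<and> b = d \<or> a = d \<and> b = c" by auto
qed (auto intro: ext)

lemma opair_inject [simp]: "opair a b = opair c d \<longleftrightarrow> a = c \<and> b = d"
  unfolding opair_def upair_eq_iff by auto

lemma is_upair_iff [simp]: "is_upair E c a b \<longleftrightarrow> c = upair a b"
  unfolding is_upair_def by (auto intro: ext)

lemma is_opair_iff [simp]: "is_opair E p a b \<longleftrightarrow> p = opair a b"
  unfolding is_opair_def opair_def by auto

lemma related_iff [simp]: "related E r x y \<longleftrightarrow> opair x y \<epsilon> r"
  unfolding related_def by auto

lemma is_empty_iff [simp]: "is_empty E a \<longleftrightarrow> a = emp"
  unfolding is_empty_def by (auto intro: ext)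

lemma is_successor_iff [simp]: "is_successor E s a \<longleftrightarrow> s = succ a"
  unfolding is_successor_def by (auto intro: ext)

lemma nonempty_iff: "a \<noteq> emp \<longleftrightarrow> (\<exists>x. x \<epsilon> a)"
  by (metis ext mem_emp)

text \<open>The union of a singleton is its element; this is how the components of a pair and the
  value of a function are extracted by a total operation. Away from pairs and functional arguments
  the values are irrelevant.\<close>
definition pfst :: "'a \<Rightarrow> 'a" where "pfst p = union (sep (union p) (\<lambda>x. \<exists>y. p = opair x y))"
definition psnd :: "'a \<Rightarrow> 'a" where "psnd p = union (sep (union p) (\<lambda>y. \<exists>x. p = opair x y))"
definition prod :: "'a \<Rightarrow> 'a \<Rightarrow> 'a" where "prod A B = union (img A (\<lambda>x. img B (\<lambda>y. opair x y)))"
definition lam :: "'a \<Rightarrow> ('a \<Rightarrow> 'a) \<Rightarrow> 'a" where "lam A F = img A (\<lambda>x. opair x (F x))"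
definition app :: "'a \<Rightarrow> 'a \<Rightarrow> 'a" where "app f x = union (sep (union (union f)) (\<lambda>y. opair x y \<epsilon> f))"

lemma definable_pfst [defin]: "definable_term f \<Longrightarrow> definable_term (\<lambda>v. pfst (f v))"
  apply (rule definable_term_comp1[of pfst])
  unfolding pfst_def by (intro defin)
lemma definable_psnd [defin]: "definable_term f \<Longrightarrow> definable_term (\<lambda>v. psnd (f v))"
  apply (rule definable_term_comp1[of psnd])
  unfolding psnd_def by (intro defin)
lemma definable_prod [defin]: "definable_term f \<Longrightarrow> definable_term g \<Longrightarrow> definable_term (\<lambda>v. prod (f v) (g v))"
  apply (rule definable_term_comp2[of prod])
  unfolding prod_def by (intro defin)
lemma definable_app [defin]: "definable_term f \<Longrightarrow> definable_term g \<Longrightarrow> definable_term (\<lambda>v. app (f v) (g v))"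
  apply (rule definable_term_comp2[of app])
  unfolding app_def by (intro defin)
lemma definable_lam [defin]:
  "definable_term A \<Longrightarrow> definable_term (\<lambda>w. F (\<lambda>i. w (Suc i)) (w 0)) \<Longrightarrow> definable_term (\<lambda>v. lam (A v) (F v))"
  unfolding lam_def by (intro defin)

lemma pfst_opair [simp]: "pfst (opair x y) = x"
proof (rule ext)
  fix z
  have "w \<epsilon> sep (union (opair x y)) (\<lambda>x'. \<exists>y'. opair x y = opair x' y') \<longleftrightarrow> w \<epsilon> union (opair x y) \<and> (\<exists>y'. opair x y = opair w y')" for w
    by (rule mem_sep) (intro defin)
  moreover have "x \<epsilon> union (opair x y)" unfolding opair_def by auto
  ultimately show "z \<epsilon> pfst (opair x y) \<longleftrightarrow> z \<epsilon> x" unfolding pfst_def by auto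
qed

lemma psnd_opair [simp]: "psnd (opair x y) = y"
proof (rule ext)
  fix z
  have "w \<epsilon> sep (union (opair x y)) (\<lambda>y'. \<exists>x'. opair x y = opair x' y') \<longleftrightarrow> w \<epsilon> union (opair x y) \<and> (\<exists>x'. opair x y = opair x' w)" for w
    by (rule mem_sep) (intro defin)
  moreover have "y \<epsilon> union (opair x y)" unfolding opair_def by auto
  ultimately show "z \<epsilon> psnd (opair x y) \<longleftrightarrow> z \<epsilon> y" unfolding psnd_def by auto
qed

lemma mem_prod: "p \<epsilon> prod A B \<longleftrightarrow> (\<exists>x y. x \<epsilon> A \<and> y \<epsilon> B \<and> p = opair x y)"
proof -
  have 1: "p \<epsilon> img B (\<lambda>y. opair x y) \<longleftrightarrow> (\<exists>y. y \<epsilon> B \<and> p = opair x y)" for p x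
    by (rule mem_img) (intro defin)
  have "q \<epsilon> img A (\<lambda>x. img B (\<lambda>y. opair x y)) \<longleftrightarrow> (\<exists>x. x \<epsilon> A \<and> q = img B (\<lambda>y. opair x y))" for q
    by (rule mem_img) (intro defin)
  then show ?thesis unfolding prod_def using 1 by auto
qed

lemma opair_mem_prod [simp]: "opair x y \<epsilon> prod A B \<longleftrightarrow> x \<epsilon> A \<and> y \<epsilon> B"
  by (auto simp: mem_prod)

lemma mem_lam: "definable_term (\<lambda>w. F (w 0)) \<Longrightarrow> p \<epsilon> lam A F \<longleftrightarrow> (\<exists>x. x \<epsilon> A \<and> p = opair x (F x))"
  unfolding lam_def by (rule mem_img) (intro defin)

lemma app_eq:
  assumes "opair x y \<epsilon> f" "\<And>y'. opair x y' \<epsilon> f \<Longrightarrow> y' = y"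
  shows "app f x = y"
proof (rule ext)
  fix z
  have "w \<epsilon> sep (union (union f)) (\<lambda>y. opair x y \<epsilon> f) \<longleftrightarrow> w \<epsilon> union (union f) \<and> opair x w \<epsilon> f" for w
    by (rule mem_sep) (intro defin)
  moreover have "upair x y \<epsilon> opair x y" "y \<epsilon> upair x y" by (simp_all add: opair_def)
  then have "y \<epsilon> union (union f)" using assms(1) unfolding mem_union by blast
  ultimately have "w \<epsilon> sep (union (union f)) (\<lambda>y. opair x y \<epsilon> f) \<longleftrightarrow> w = y" for w
    using assms by blast
  then show "z \<epsilon> app f x \<longleftrightarrow> z \<epsilon> y" unfolding app_def by simp
qed

lemma app_lam: "definable_term (\<lambda>w. F (w 0)) \<Longrightarrow> x \<epsilon> A \<Longrightarrow> app (lam A F) x = F x"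
  by (rule app_eq) (auto simp: mem_lam)

abbreviation definable_fun :: "('a \<Rightarrow> 'a) \<Rightarrow> bool" where
  "definable_fun F \<equiv> definable_term (\<lambda>w. F (w 0))"

text \<open>Passing to HOL sets makes \<open>inj_on\<close> and \<open>bij_betw\<close> available for definable functions.\<close>
definition elts :: "'a \<Rightarrow> 'a set" where "elts A = {x. x \<epsilon> A}"

lemma mem_elts [simp]: "x \<in> elts A \<longleftrightarrow> x \<epsilon> A" by (simp add: elts_def)

lemma is_function_app:
  assumes "is_function E f A B" "x \<epsilon> A"
  shows "app f x \<epsilon> B" "opair x (app f x) \<epsilon> f" "opair x y \<epsilon> f \<longleftrightarrow> y = app f x"
proof -
  obtain y where y: "opair x y \<epsilon> f" "\<And>y'. opair x y' \<epsilon> f \<Longrightarrow> y' = y"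
    using assms unfolding is_function_def by auto
  then have "app f x = y" by (rule app_eq)
  moreover obtain x' y' where "y' \<epsilon> B" "opair x y = opair x' y'"
    using y(1) assms unfolding is_function_def is_relation_def is_opair_iff by blast
  moreover have "opair x y'' \<epsilon> f \<longleftrightarrow> y'' = y" for y'' using y by blast
  ultimately show "app f x \<epsilon> B" "opair x (app f x) \<epsilon> f" "opair x y \<epsilon> f \<longleftrightarrow> y = app f x" for y
    by simp_all
qed

lemma opair_in_function: "is_function E f A B \<Longrightarrow> opair x y \<epsilon> f \<longleftrightarrow> x \<epsilon> A \<and> y = app f x"
  by (metis is_function_app(3) is_function_def is_opair_iff is_relation_def opair_inject)

lemma is_function_lam:
  assumes "definable_fun F" "\<And>x. x \<epsilon> A \<Longrightarrow> F x \<epsilon> B"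
  shows "is_function E (lam A F) A B"
  using assms(2) unfolding is_function_def is_relation_def by (auto simp: mem_lam[OF assms(1)])

lemma is_bijection_app:
  assumes "is_bijection E f A B" shows "bij_betw (app f) (elts A) (elts B)"
proof -
  have f: "is_function E f A B" using assms unfolding is_bijection_def by blast
  show ?thesis
  proof (rule bij_betwI')
    fix x y assume xy: "x \<in> elts A" "y \<in> elts A"
    show "(app f x = app f y) = (x = y)"
      using assms xy is_function_app(1,2)[OF f] unfolding is_bijection_def related_iff mem_elts by metis
  next
    fix x assume "x \<in> elts A" then show "app f x \<in> elts B" using is_function_app(1)[OF f] by simp
  next
    fix y assume "y \<in> elts B"
    then obtain x where "opair x y \<epsilon> f" using assms unfolding is_bijection_def related_iff mem_elts by blast
    then show "\<exists>x\<in>elts A. y = app f x" using opair_in_function[OF f] by auto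
  qed
qed

lemma is_bijection_lam:
  assumes "definable_fun F" "bij_betw F (elts A) (elts B)"
  shows "is_bijection E (lam A F) A B"
proof -
  have "\<exists>!x. x \<epsilon> A \<and> y = F x" if "y \<epsilon> B" for y
    using assms(2) that unfolding bij_betw_def inj_on_def
    by (metis (no_types, lifting) image_iff mem_elts)
  moreover have "is_function E (lam A F) A B"
    by (rule is_function_lam[OF assms(1)]) (use assms(2) in \<open>auto simp: bij_betw_def\<close>)
  ultimately show ?thesis
    unfolding is_bijection_def by (simp add: mem_lam[OF assms(1)])
qed

section \<open>Ordinals and natural numbers\<close>

lemma mem_irrefl: "\<not> x \<epsilon> x"
  using foundation[of x "sing x"] by auto

lemma mem_asym: "x \<epsilon> y \<Longrightarrow> \<not> y \<epsilon> x"
  using foundation[of x "upair x y"] by auto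

definition transitive :: "'a \<Rightarrow> bool" where
  "transitive a \<longleftrightarrow> (\<forall>x y. y \<epsilon> x \<and> x \<epsilon> a \<longrightarrow> y \<epsilon> a)"

text \<open>Foundation makes membership well-founded on every set, so von Neumann ordinals are just
  the transitive sets of transitive sets.\<close>
definition ordinal :: "'a \<Rightarrow> bool" where
  "ordinal a \<longleftrightarrow> transitive a \<and> (\<forall>x. x \<epsilon> a \<longrightarrow> transitive x)"

lemma definable_transitive [defin]: "definable_term f \<Longrightarrow> definable (\<lambda>v. transitive (f v))"
  apply (rule definable_comp1[of transitive])
  unfolding transitive_def by (intro defin)

lemma definable_ordinal [defin]: "definable_term f \<Longrightarrow> definable (\<lambda>v. ordinal (f v))"
  apply (rule definable_comp1[of ordinal])
  unfolding ordinal_def by (intro defin)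

lemma ordinal_mem: "ordinal a \<Longrightarrow> x \<epsilon> a \<Longrightarrow> ordinal x"
  unfolding ordinal_def transitive_def by blast

lemma ordinal_trans: "ordinal a \<Longrightarrow> x \<epsilon> a \<Longrightarrow> y \<epsilon> x \<Longrightarrow> y \<epsilon> a"
  unfolding ordinal_def transitive_def by blast

lemma ordinal_min:
  assumes "definable (\<lambda>w. P (w 0))" "ordinal a" "P a"
  shows "\<exists>m. ordinal m \<and> P m \<and> (\<forall>x. x \<epsilon> m \<longrightarrow> \<not> P x)"
proof -
  have s: "x \<epsilon> sep (succ a) P \<longleftrightarrow> (x \<epsilon> a \<or> x = a) \<and> P x" for x
    using mem_sep[OF assms(1)] by simp
  obtain m where "m \<epsilon> sep (succ a) P" "\<And>y. y \<epsilon> m \<Longrightarrow> \<not> y \<epsilon> sep (succ a) P"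
    using foundation[of a "sep (succ a) P"] s assms(3) by blast
  then have m: "m \<epsilon> a \<or> m = a" "P m" and min: "\<And>y. y \<epsilon> m \<Longrightarrow> \<not> ((y \<epsilon> a \<or> y = a) \<and> P y)"
    unfolding s by blast+
  have "ordinal m" using m(1) assms(2) ordinal_mem by auto
  moreover have "y \<epsilon> a" if "y \<epsilon> m" for y using m(1) that ordinal_trans[OF assms(2)] by auto
  ultimately show ?thesis using m(2) min by blast
qed

text \<open>If some ordinal is incomparable with another, let \<open>m\<close> be a least such ordinal and \<open>n\<close> a
  least ordinal incomparable with \<open>m\<close>. Minimality forces \<open>m\<close> and \<open>n\<close> to have the same elements.\<close>
lemma ordinal_linear: "ordinal a \<Longrightarrow> ordinal b \<Longrightarrow> a \<epsilon> b \<or> a = b \<or> b \<epsilon> a"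
proof (rule ccontr)
  define bad where "bad a b \<longleftrightarrow> ordinal b \<and> \<not> (a \<epsilon> b \<or> a = b \<or> b \<epsilon> a)" for a b
  have bad: "definable (\<lambda>w. bad (w 0) (w (Suc 0)))" unfolding bad_def by (intro defin)
  assume "ordinal a" "ordinal b" "\<not> (a \<epsilon> b \<or> a = b \<or> b \<epsilon> a)"
  then have "\<exists>b. bad a b" unfolding bad_def by blast
  moreover have "definable (\<lambda>w. \<exists>b. bad (w 0) b)"
    by (intro defin definable_comp2[OF bad])
  ultimately obtain m where m: "ordinal m" "\<exists>b. bad m b" "\<And>x. x \<epsilon> m \<Longrightarrow> \<not> (\<exists>b. bad x b)"
    using ordinal_min[of "\<lambda>a. \<exists>b. bad a b", OF _ \<open>ordinal a\<close>] by blast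
  then obtain b' where b': "bad m b'" by blast
  moreover have "ordinal b'" using b' unfolding bad_def by blast
  moreover have "definable (\<lambda>w. bad m (w 0))" by (intro definable_comp2[OF bad] defin)
  ultimately obtain n where n: "ordinal n" "bad m n" "\<And>x. x \<epsilon> n \<Longrightarrow> \<not> bad m x"
    using ordinal_min[of "\<lambda>b. bad m b"] by blast
  have "m = n"
  proof (rule ext)
    fix x
    show "x \<epsilon> m \<longleftrightarrow> x \<epsilon> n"
    proof
      assume x: "x \<epsilon> m"
      then have "\<not> bad x n" using m by blast
      then show "x \<epsilon> n" using n x ordinal_trans[OF m(1) x] unfolding bad_def by blast
    next
      assume x: "x \<epsilon> n"
      then have "\<not> bad m x" using n by blast
      then show "x \<epsilon> m" using n x ordinal_trans[OF n(1) x] ordinal_mem[OF n(1) x] unfolding bad_def by blast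
    qed
  qed
  then show False using n(2) unfolding bad_def by blast
qed

lemma ordinal_emp: "ordinal emp"
  unfolding ordinal_def transitive_def by simp

lemma ordinal_succ: "ordinal a \<Longrightarrow> ordinal (succ a)"
  unfolding ordinal_def transitive_def mem_succ by blast

lemma succ_inject: "succ x = succ y \<Longrightarrow> x = y"
proof -
  assume "succ x = succ y"
  then have "x \<epsilon> succ y" "y \<epsilon> succ x" by (metis mem_succ)+
  then show ?thesis unfolding mem_succ using mem_asym by blast
qed

lemma succ_not_emp: "succ x \<noteq> emp"
  using mem_succ[of x x] mem_emp[of x] by metis

lemma is_inductive_iff [simp]: "is_inductive E w \<longleftrightarrow> emp \<epsilon> w \<and> (\<forall>x. x \<epsilon> w \<longrightarrow> succ x \<epsilon> w)"
  unfolding is_inductive_def by simp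

lemma definable_is_inductive [defin]: "definable_term f \<Longrightarrow> definable (\<lambda>v. is_inductive E (f v))"
  apply (rule definable_comp1[of "is_inductive E"])
  unfolding is_inductive_iff by (intro defin)

lemma definable_is_natural [defin]: "definable_term f \<Longrightarrow> definable (\<lambda>v. is_natural E (f v))"
  apply (rule definable_comp1[of "is_natural E"])
  unfolding is_natural_def by (intro defin)

text \<open>Any inductive set will do: the natural numbers are the elements common to all of them.\<close>
definition omega :: 'a where
  "omega = sep (SOME w. is_inductive E w) (is_natural E)"

lemma mem_omega: "n \<epsilon> omega \<longleftrightarrow> is_natural E n"
proof -
  have "definable (\<lambda>w. is_natural E (w 0))" by (intro defin)
  note s = mem_sep[OF this]
  have "is_inductive E (SOME w. is_inductive E w)"
    using ZF unfolding ZF_def infinity_ax_def by (metis someI_ex)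
  then show ?thesis unfolding omega_def s unfolding is_natural_def by blast
qed

lemma emp_omega [simp]: "emp \<epsilon> omega"
  unfolding mem_omega is_natural_def by simp

lemma succ_omega: "n \<epsilon> omega \<Longrightarrow> succ n \<epsilon> omega"
  unfolding mem_omega is_natural_def by simp

lemma omega_induct [consumes 1, case_names definable emp succ]:
  assumes "n \<epsilon> omega" "definable (\<lambda>w. P (w 0))" "P emp" "\<And>n. n \<epsilon> omega \<Longrightarrow> P n \<Longrightarrow> P (succ n)"
  shows "P n"
proof -
  have s: "x \<epsilon> sep omega P \<longleftrightarrow> x \<epsilon> omega \<and> P x" for x
    by (rule mem_sep) (rule assms(2))
  have "is_inductive E (sep omega P)"
    using assms(3,4) by (auto simp: s succ_omega)
  then have "n \<epsilon> sep omega P" using assms(1) unfolding mem_omega is_natural_def by blast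
  then show ?thesis using s by blast
qed

lemma omega_ordinal: "n \<epsilon> omega \<Longrightarrow> ordinal n"
  by (induction rule: omega_induct) (intro defin, auto simp: ordinal_emp ordinal_succ)

lemma omega_trans: "n \<epsilon> omega \<Longrightarrow> \<forall>x. x \<epsilon> n \<longrightarrow> x \<epsilon> omega"
  by (induction rule: omega_induct) (intro defin, auto)

lemma omega_cases: "n \<epsilon> omega \<Longrightarrow> n = emp \<or> (\<exists>m. m \<epsilon> omega \<and> n = succ m)"
  by (induction rule: omega_induct) (intro defin, auto)

section \<open>Injections and Hartogs' theorem\<close>

text \<open>Definable injections can be composed without building sets of pairs. The equivalence
  \<open>lepoll_iff_injection\<close> with injections that are elements of the model is what makes this
  relation itself definable.\<close>
definition lepoll :: "'a \<Rightarrow> 'a \<Rightarrow> bool" where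
  "lepoll A B \<longleftrightarrow> (\<exists>F. definable_fun F \<and> inj_on F (elts A) \<and> F ` elts A \<subseteq> elts B)"

lemma lepollI:
  assumes "definable_fun F" "\<And>x. x \<epsilon> A \<Longrightarrow> F x \<epsilon> B" "\<And>x y. x \<epsilon> A \<Longrightarrow> y \<epsilon> A \<Longrightarrow> F x = F y \<Longrightarrow> x = y"
  shows "lepoll A B"
proof -
  have "inj_on F (elts A)" by (rule inj_onI, rule assms(3)) simp_all
  moreover have "F ` elts A \<subseteq> elts B" by (rule image_subsetI) (simp add: assms(2))
  ultimately show ?thesis unfolding lepoll_def using assms(1) by blast
qed

lemma lepollE:
  assumes "lepoll A B"
  obtains F where "definable_fun F" "\<forall>x. x \<epsilon> A \<longrightarrow> F x \<epsilon> B" "\<forall>x y. x \<epsilon> A \<longrightarrow> y \<epsilon> A \<longrightarrow> F x = F y \<longrightarrow> x = y"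
  using assms unfolding lepoll_def inj_on_def image_subset_iff Ball_def mem_elts by blast

lemma lepoll_trans:
  assumes "lepoll A B" "lepoll B C" shows "lepoll A C"
proof -
  obtain F where F: "definable_fun F" "\<forall>x. x \<epsilon> A \<longrightarrow> F x \<epsilon> B" "\<forall>x y. x \<epsilon> A \<longrightarrow> y \<epsilon> A \<longrightarrow> F x = F y \<longrightarrow> x = y"
    using assms(1) by (rule lepollE)
  obtain G where G: "definable_fun G" "\<forall>x. x \<epsilon> B \<longrightarrow> G x \<epsilon> C" "\<forall>x y. x \<epsilon> B \<longrightarrow> y \<epsilon> B \<longrightarrow> G x = G y \<longrightarrow> x = y"
    using assms(2) by (rule lepollE)
  have "definable_fun (\<lambda>x. G (F x))" by (rule definable_term_comp1[OF G(1) F(1)])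
  then show ?thesis
  proof (rule lepollI)
    show "G (F x) \<epsilon> C" if "x \<epsilon> A" for x using F(2) G(2) that by blast
    show "x = y" if "x \<epsilon> A" "y \<epsilon> A" "G (F x) = G (F y)" for x y
      using F(2,3) G(3) that by blast
  qed
qed

lemma lepoll_subset: "(\<And>x. x \<epsilon> A \<Longrightarrow> x \<epsilon> B) \<Longrightarrow> lepoll A B"
  by (rule lepollI[of "\<lambda>x. x"]) (intro defin)

definition injection :: "'a \<Rightarrow> 'a \<Rightarrow> 'a \<Rightarrow> bool" where
  "injection f A B \<longleftrightarrow> (\<forall>x. x \<epsilon> A \<longrightarrow> app f x \<epsilon> B \<and> (\<forall>y. y \<epsilon> A \<longrightarrow> app f x = app f y \<longrightarrow> x = y))"

lemma definable_injection [defin]: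
  "definable_term f \<Longrightarrow> definable_term g \<Longrightarrow> definable_term h \<Longrightarrow> definable (\<lambda>v. injection (f v) (g v) (h v))"
  apply (rule definable_comp3[of injection])
  unfolding injection_def by (intro defin)

lemma lepoll_iff_injection: "lepoll A B \<longleftrightarrow> (\<exists>f. injection f A B)"
proof
  assume "lepoll A B"
  then obtain F where F: "definable_fun F" "\<forall>x. x \<epsilon> A \<longrightarrow> F x \<epsilon> B" "\<forall>x y. x \<epsilon> A \<longrightarrow> y \<epsilon> A \<longrightarrow> F x = F y \<longrightarrow> x = y"
    by (rule lepollE)
  have "injection (lam A F) A B" unfolding injection_def using F(2,3) by (simp add: app_lam[OF F(1)])
  then show "\<exists>f. injection f A B" ..
next
  assume "\<exists>f. injection f A B"
  then obtain f where "injection f A B" ..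
  then show "lepoll A B" unfolding injection_def by (intro lepollI[of "app f"]) (intro defin, auto)
qed

lemma definable_lepoll [defin]: "definable_term f \<Longrightarrow> definable_term g \<Longrightarrow> definable (\<lambda>v. lepoll (f v) (g v))"
  apply (rule definable_comp2[of lepoll])
  unfolding lepoll_iff_injection by (intro defin)

text \<open>\<open>R\<close> is the reflexive order of the ordinal \<open>W\<close> transported to \<open>Y\<close> along \<open>f\<close>. It is taken
  reflexive so that the range of \<open>f\<close> can be read off from \<open>R\<close>, also when \<open>W\<close> has a single element.\<close>
definition codes :: "'a \<Rightarrow> 'a \<Rightarrow> 'a \<Rightarrow> 'a \<Rightarrow> bool" where
  "codes f Y R W \<longleftrightarrow> injection f W Y \<and>
     (\<forall>p. p \<epsilon> R \<longleftrightarrow> (\<exists>x y. x \<epsilon> W \<and> y \<epsilon> W \<and> (x \<epsilon> y \<or> x = y) \<and> p = opair (app f x) (app f y)))"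

text \<open>The composite of \<open>f\<close> with the inverse of \<open>g\<close> is an isomorphism between transitive sets,
  and such an isomorphism is the identity: at a least argument \<open>x\<close> where it is not, \<open>x\<close> and its
  image have the same elements.\<close>
lemma codes_subset:
  assumes R: "codes f Y R W" "codes g Y R W'" and W: "ordinal W" "ordinal W'" and x: "x \<epsilon> W"
  shows "x \<epsilon> W'"
proof -
  define bad where "bad x \<longleftrightarrow> \<not> (x \<epsilon> W' \<and> app f x = app g x)" for x
  have bad: "definable (\<lambda>w. bad (w 0))" unfolding bad_def by (intro defin)
  have finj: "u = v" if "u \<epsilon> W" "v \<epsilon> W" "app f u = app f v" for u v
    using R(1) that unfolding codes_def injection_def by blast
  have ginj: "u = v" if "u \<epsilon> W'" "v \<epsilon> W'" "app g u = app g v" for u v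
    using R(2) that unfolding codes_def injection_def by blast
  have Rf: "opair a b \<epsilon> R \<longleftrightarrow> (\<exists>x y. x \<epsilon> W \<and> y \<epsilon> W \<and> (x \<epsilon> y \<or> x = y) \<and> a = app f x \<and> b = app f y)" for a b
    using R(1) unfolding codes_def by simp
  have Rg: "opair a b \<epsilon> R \<longleftrightarrow> (\<exists>x y. x \<epsilon> W' \<and> y \<epsilon> W' \<and> (x \<epsilon> y \<or> x = y) \<and> a = app g x \<and> b = app g y)" for a b
    using R(2) unfolding codes_def by simp
  have fg: "\<exists>u v. u \<epsilon> W' \<and> v \<epsilon> W' \<and> (u \<epsilon> v \<or> u = v) \<and> app f x = app g u \<and> app f y = app g v"
    if "x \<epsilon> W" "y \<epsilon> W" "x \<epsilon> y \<or> x = y" for x y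
    using Rf[of "app f x" "app f y"] Rg[of "app f x" "app f y"] that by blast
  have gf: "\<exists>u v. u \<epsilon> W \<and> v \<epsilon> W \<and> (u \<epsilon> v \<or> u = v) \<and> app g x = app f u \<and> app g y = app f v"
    if "x \<epsilon> W'" "y \<epsilon> W'" "x \<epsilon> y \<or> x = y" for x y
    using Rf[of "app g x" "app g y"] Rg[of "app g x" "app g y"] that by blast
  have "\<not> bad x" if x: "x \<epsilon> W" and IH: "\<And>y. y \<epsilon> x \<Longrightarrow> \<not> bad y" for x
  proof -
    obtain x' where x': "x' \<epsilon> W'" "app f x = app g x'" using fg[of x x] x by blast
    have "x' = x"
    proof (rule ext)
      fix y
      show "y \<epsilon> x' \<longleftrightarrow> y \<epsilon> x"
      proof
        assume y: "y \<epsilon> x"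
        then have yW: "y \<epsilon> W" using ordinal_trans[OF W(1) x] by blast
        have y': "y \<epsilon> W'" "app f y = app g y" using IH[OF y] unfolding bad_def by auto
        obtain u v where uv: "u \<epsilon> W'" "v \<epsilon> W'" "u \<epsilon> v \<or> u = v" "app f y = app g u" "app f x = app g v"
          using fg[of y x] yW x y by blast
        have "u = y" by (rule ginj) (use uv y' in simp_all)
        moreover have "v = x'" by (rule ginj) (use uv x' in simp_all)
        moreover have "y \<noteq> x'"
        proof
          assume "y = x'"
          then have "y = x" using finj[of y x] yW x y' x' by simp
          then show False using y mem_irrefl by blast
        qed
        ultimately show "y \<epsilon> x'" using uv(3) by blast
      next
        assume y: "y \<epsilon> x'"
        then have yW: "y \<epsilon> W'" using ordinal_trans[OF W(2) x'(1)] by blast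
        obtain u v where uv: "u \<epsilon> W" "v \<epsilon> W" "u \<epsilon> v \<or> u = v" "app g y = app f u" "app g x' = app f v"
          using gf[of y x'] yW x' y by blast
        have v: "v = x" by (rule finj) (use uv x x' in simp_all)
        have "u \<noteq> x"
        proof
          assume "u = x"
          then have "y = x'" using ginj[of y x'] yW x' uv by simp
          then show False using y mem_irrefl by blast
        qed
        then have ux: "u \<epsilon> x" using uv(3) v by blast
        then have "u \<epsilon> W'" "app f u = app g u" using IH[OF ux] unfolding bad_def by auto
        then have "u = y" using ginj[of u y] yW uv by simp
        then show "y \<epsilon> x" using ux by simp
      qed
    qed
    then show ?thesis using x' unfolding bad_def by simp
  qed
  moreover have "\<exists>m. ordinal m \<and> (m \<epsilon> W \<and> bad m) \<and> (\<forall>x. x \<epsilon> m \<longrightarrow> \<not> (x \<epsilon> W \<and> bad x))" if "bad x"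
    using that x ordinal_mem[OF W(1) x]
    by (intro ordinal_min[of "\<lambda>x. x \<epsilon> W \<and> bad x"]) (auto intro!: defin bad)
  ultimately have "\<not> bad x" using ordinal_trans[OF W(1)] by blast
  then show ?thesis unfolding bad_def by blast
qed

text \<open>Otherwise every ordinal is coded by a relation on \<open>Y\<close>. A relation codes at most one
  ordinal, so replacement collects all ordinals into a set, which is then an ordinal and an
  element of itself.\<close>
lemma hartogs: "\<exists>W. ordinal W \<and> \<not> lepoll W Y"
proof (rule ccontr)
  assume "\<not> ?thesis"
  then have all: "\<exists>f. injection f W Y" if "ordinal W" for W
    using that unfolding lepoll_iff_injection by blast
  define P where "P R W \<longleftrightarrow> ordinal W \<and> (\<exists>f. codes f Y R W)" for R W
  have "definable (\<lambda>w. P (w 0) (w (Suc 0)))"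
    unfolding P_def codes_def by (intro defin)
  then have "is_set (\<lambda>W. \<exists>R. R \<epsilon> pow (prod Y Y) \<and> P R W)"
    by (rule is_set_replace) (auto simp: P_def intro!: ext elim: codes_subset)
  then obtain A where A: "\<And>W. W \<epsilon> A \<longleftrightarrow> (\<exists>R. R \<epsilon> pow (prod Y Y) \<and> P R W)"
    unfolding is_set_def by blast
  have "W \<epsilon> A" if W: "ordinal W" for W
  proof -
    obtain f where f: "injection f W Y" using all[OF W] by blast
    define Q where "Q p \<longleftrightarrow> (\<exists>x y. x \<epsilon> W \<and> y \<epsilon> W \<and> (x \<epsilon> y \<or> x = y) \<and> p = opair (app f x) (app f y))" for p
    have "definable (\<lambda>w. Q (w 0))" unfolding Q_def by (intro defin)
    then have "p \<epsilon> sep (prod Y Y) Q \<longleftrightarrow> p \<epsilon> prod Y Y \<and> Q p" for p by (rule mem_sep)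
    moreover have "Q p \<Longrightarrow> p \<epsilon> prod Y Y" for p using f unfolding injection_def Q_def by auto
    ultimately have s: "p \<epsilon> sep (prod Y Y) Q \<longleftrightarrow> p \<epsilon> prod Y Y \<and> Q p" "p \<epsilon> sep (prod Y Y) Q \<longleftrightarrow> Q p" for p
      by blast+
    have "codes f Y (sep (prod Y Y) Q) W"
      unfolding codes_def s(2) using f by (simp add: Q_def)
    then show ?thesis unfolding A P_def using W s(1) mem_pow by blast
  qed
  moreover have "W \<epsilon> A \<Longrightarrow> ordinal W" for W unfolding A P_def by blast
  ultimately have A: "W \<epsilon> A \<longleftrightarrow> ordinal W" for W by blast
  then have "ordinal A" unfolding ordinal_def[of A] transitive_def[of A]
    using ordinal_mem unfolding ordinal_def by blast
  then show False using A mem_irrefl by blast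
qed

text \<open>A definite description that is definable: the union of a singleton.\<close>
definition the_in :: "'a \<Rightarrow> ('a \<Rightarrow> bool) \<Rightarrow> 'a" where
  "the_in A P = union (sep A P)"

lemma definable_the_in [defin]:
  "definable_term A \<Longrightarrow> definable (\<lambda>w. P (\<lambda>i. w (Suc i)) (w 0)) \<Longrightarrow> definable_term (\<lambda>v. the_in (A v) (P v))"
  unfolding the_in_def by (intro defin)

lemma the_in_eq:
  assumes "definable (\<lambda>w. P (w 0))" "x \<epsilon> A" "P x" "\<And>y. y \<epsilon> A \<Longrightarrow> P y \<Longrightarrow> y = x"
  shows "the_in A P = x"
proof (rule ext)
  have "y \<epsilon> sep A P \<longleftrightarrow> y = x" for y using mem_sep[OF assms(1)] assms(2-4) by blast
  then show "z \<epsilon> the_in A P \<longleftrightarrow> z \<epsilon> x" for z unfolding the_in_def by simp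
qed

section \<open>From homogeneous orders to choice\<close>

lemma lepoll_bijection:
  assumes "is_bijection E f A B" shows "lepoll A B" "lepoll B A"
proof -
  have bij: "bij_betw (app f) (elts A) (elts B)" by (rule is_bijection_app[OF assms])
  show "lepoll A B" unfolding lepoll_def
    by (rule exI[of _ "app f"]) (use bij in \<open>auto simp: bij_betw_def intro: defin\<close>)
  define G where "G y = the_in A (\<lambda>x. app f x = y)" for y
  have G: "G (app f x) = x" if "x \<epsilon> A" for x
    unfolding G_def
  proof (rule the_in_eq)
    show "definable (\<lambda>w. app f (w 0) = app f x)" by (intro defin)
    show "y = x" if "y \<epsilon> A" "app f y = app f x" for y
      using bij that \<open>x \<epsilon> A\<close> unfolding bij_betw_def inj_on_def by simp
  qed (use that in simp_all)
  have onto: "\<exists>x. x \<epsilon> A \<and> app f x = y" if "y \<epsilon> B" for y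
  proof -
    have "y \<in> app f ` elts A" using bij that unfolding bij_betw_def by simp
    then show ?thesis by auto
  qed
  have "definable_fun G" unfolding G_def by (intro defin)
  then show "lepoll B A"
  proof (rule lepollI)
    show "G y \<epsilon> A" if "y \<epsilon> B" for y using onto[OF that] G by metis
    show "x = y" if "x \<epsilon> B" "y \<epsilon> B" "G x = G y" for x y
      using onto[OF that(1)] onto[OF that(2)] that(3) G by metis
  qed
qed

lemma strictly_below_iff: "strictly_below E r x y \<longleftrightarrow> opair x y \<epsilon> r \<and> x \<noteq> y"
  unfolding strictly_below_def by simp

lemma definable_strictly_below [defin]:
  "definable_term f \<Longrightarrow> definable_term g \<Longrightarrow> definable_term h \<Longrightarrow> definable (\<lambda>v. strictly_below E (f v) (g v) (h v))"
  unfolding strictly_below_iff by (intro defin)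

text \<open>\<open>W\<close> is an ordinal that does not inject into the power set of \<open>X\<close>, and the homogeneous
  order lives on \<open>X \<union> W\<close>; the two sets may overlap.\<close>
lemma lepoll_ordinal_of_homogeneous:
  assumes hom: "\<And>S. \<not> finite_in E S \<Longrightarrow> \<exists>r. globally_homogeneous E S r"
  shows "\<exists>\<alpha>. ordinal \<alpha> \<and> lepoll X \<alpha>"
proof -
  obtain W where W: "ordinal W" "\<not> lepoll W (pow X)" using hartogs by blast
  define S where "S = un X W"
  have XS: "lepoll X S" by (rule lepoll_subset) (simp add: S_def)
  show ?thesis
  proof (cases "finite_in E S")
    case True
    then obtain n f where "is_natural E n" "is_bijection E f S n" unfolding finite_in_def by blast
    then show ?thesis using omega_ordinal mem_omega lepoll_bijection XS lepoll_trans by blast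
  next
    case False
    then obtain r where r: "globally_homogeneous E S r" using hom by blast
    have lin: "opair x y \<epsilon> r \<or> opair y x \<epsilon> r" if "x \<epsilon> S" "y \<epsilon> S" for x y
      using r that unfolding globally_homogeneous_def is_linear_order_def related_iff by blast
    have antisym: "x = y" if "opair x y \<epsilon> r" "opair y x \<epsilon> r" for x y
      using r that unfolding globally_homogeneous_def is_linear_order_def related_iff by blast
    \<comment> \<open>If \<open>X\<close> met every interval, distinct elements of \<open>W\<close> would cut off distinct subsets
      of \<open>X\<close>.\<close>
    have "\<exists>a b. a \<epsilon> S \<and> b \<epsilon> S \<and> strictly_below E r a b \<and>
      (\<forall>x. x \<epsilon> X \<longrightarrow> \<not> (strictly_below E r a x \<and> strictly_below E r x b))"
    proof (rule ccontr)
      assume "\<not> ?thesis"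
      then have dense: "\<exists>x. x \<epsilon> X \<and> strictly_below E r a x \<and> strictly_below E r x b"
        if "a \<epsilon> S" "b \<epsilon> S" "strictly_below E r a b" for a b using that by blast
      define F where "F w = sep X (\<lambda>x. strictly_below E r x w)" for w
      have F: "x \<epsilon> F w \<longleftrightarrow> x \<epsilon> X \<and> strictly_below E r x w" for x w
        unfolding F_def by (rule mem_sep) (intro defin)
      have ne: "F a \<noteq> F b" if ab: "a \<epsilon> S" "b \<epsilon> S" "strictly_below E r a b" for a b
      proof
        assume "F a = F b"
        obtain x where x: "x \<epsilon> X" "strictly_below E r a x" "strictly_below E r x b" using dense[OF ab] by blast
        then have "x \<epsilon> F a" using \<open>F a = F b\<close> F by simp
        then have "strictly_below E r x a" using F by blast
        then show False using x(2) antisym unfolding strictly_below_iff by blast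
      qed
      have "definable_fun F" unfolding F_def by (intro defin)
      then have "lepoll W (pow X)"
      proof (rule lepollI)
        show "F w \<epsilon> pow X" for w using F by simp
        show "a = b" if "a \<epsilon> W" "b \<epsilon> W" "F a = F b" for a b
        proof (rule ccontr)
          assume "a \<noteq> b"
          have S: "a \<epsilon> S" "b \<epsilon> S" using that by (simp_all add: S_def)
          have "strictly_below E r a b \<or> strictly_below E r b a"
            using lin[OF S] \<open>a \<noteq> b\<close> unfolding strictly_below_iff by blast
          then show False using ne S that(3) by metis
        qed
      qed
      then show False using W(2) by blast
    qed
    then obtain a b where ab: "a \<epsilon> S" "b \<epsilon> S" "strictly_below E r a b"
      and empty: "\<And>x. x \<epsilon> X \<Longrightarrow> \<not> (strictly_below E r a x \<and> strictly_below E r x b)" by blast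
    obtain I where I: "is_interval E I S r a b" "order_isomorphic E I r S r"
      using r ab unfolding globally_homogeneous_def by blast
    have IW: "x \<epsilon> W" if "x \<epsilon> I" for x
    proof -
      have x: "x \<epsilon> S \<and> strictly_below E r a x \<and> strictly_below E r x b"
        using I(1) that unfolding is_interval_def by blast
      then have "\<not> x \<epsilon> X" using empty by blast
      then show ?thesis using x by (simp add: S_def)
    qed
    obtain f where "is_bijection E f I S" using I(2) unfolding order_isomorphic_def by blast
    then have "lepoll S I" by (rule lepoll_bijection)
    then have "lepoll X W" using XS lepoll_subset[OF IW] lepoll_trans by blast
    then show ?thesis using W(1) by blast
  qed
qed

text \<open>An injection of \<open>\<Union>F\<close> into an ordinal selects from each member of \<open>F\<close> the element with
  least image.\<close>
lemma AC_of_lepoll_ordinal: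
  assumes "\<And>X. \<exists>\<alpha>. ordinal \<alpha> \<and> lepoll X \<alpha>"
  shows "AC E"
  unfolding AC_def is_empty_iff
proof (intro allI impI)
  fix F assume F: "\<forall>X. X \<epsilon> F \<longrightarrow> X \<noteq> emp"
  obtain \<alpha> where \<alpha>: "ordinal \<alpha>" "lepoll (union F) \<alpha>" using assms by blast
  obtain G where G: "definable_fun G" "\<forall>x. x \<epsilon> union F \<longrightarrow> G x \<epsilon> \<alpha>"
    "\<forall>x y. x \<epsilon> union F \<longrightarrow> y \<epsilon> union F \<longrightarrow> G x = G y \<longrightarrow> x = y"
    using \<alpha>(2) by (rule lepollE)
  define least where "least X x \<longleftrightarrow> (\<forall>z. z \<epsilon> X \<longrightarrow> \<not> G z \<epsilon> G x)" for X x
  have least [defin]: "definable (\<lambda>v. least (f v) (g v))" if "definable_term f" "definable_term g" for f g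
    apply (rule definable_comp2[of least, OF _ that]) unfolding least_def
    by (intro defin definable_term_comp1[OF G(1)])
  define c where "c X = the_in X (least X)" for X
  have c: "c X \<epsilon> X" if X: "X \<epsilon> F" for X
  proof -
    obtain x where "x \<epsilon> X" using F X nonempty_iff by blast
    then have "G x \<epsilon> img X G" using mem_img[OF G(1)] by blast
    then obtain m where m: "m \<epsilon> img X G" "\<forall>y. y \<epsilon> m \<longrightarrow> \<not> y \<epsilon> img X G" using foundation by blast
    then obtain x where x: "x \<epsilon> X" "m = G x" using mem_img[OF G(1)] by blast
    have "c X = x" unfolding c_def
    proof (rule the_in_eq)
      show "definable (\<lambda>w. least X (w 0))" by (intro defin least)
      show "least X x" using m x mem_img[OF G(1)] unfolding least_def by blast
      show "y = x" if y: "y \<epsilon> X" "least X y" for y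
      proof -
        have u: "x \<epsilon> union F" "y \<epsilon> union F" using x y X by auto
        then have "ordinal (G x)" "ordinal (G y)" using G(2) \<alpha>(1) ordinal_mem by blast+
        then have "G x = G y"
          using ordinal_linear y \<open>least X x\<close> x unfolding least_def by blast
        then show ?thesis using G(3) u by blast
      qed
    qed (use x in simp)
    then show ?thesis using x by simp
  qed
  have dc: "definable_fun c" unfolding c_def by (intro defin least)
  have "is_function E (lam F c) F (union F)"
    by (rule is_function_lam[OF dc]) (use c in auto)
  moreover have "\<forall>X y. X \<epsilon> F \<and> related E (lam F c) X y \<longrightarrow> y \<epsilon> X"
    using c by (auto simp: mem_lam[OF dc])
  ultimately show "\<exists>f B. is_function E f F B \<and> (\<forall>X y. X \<epsilon> F \<and> related E f X y \<longrightarrow> y \<epsilon> X)" by blast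
qed

section \<open>Zorn's lemma\<close>

lemma AC_select:
  assumes "AC E" "definable (\<lambda>w. P (w 0) (w (Suc 0)))" "\<And>x. x \<epsilon> A \<Longrightarrow> \<exists>y. y \<epsilon> B \<and> P x y"
  shows "\<exists>f. \<forall>x. x \<epsilon> A \<longrightarrow> app f x \<epsilon> B \<and> P x (app f x)"
proof -
  define G where "G x = sep B (P x)" for x
  have "definable (\<lambda>w. P x (w 0))" for x by (intro definable_comp2[OF assms(2)] defin)
  then have G: "y \<epsilon> G x \<longleftrightarrow> y \<epsilon> B \<and> P x y" for x y
    unfolding G_def by (rule mem_sep)
  have dG: "definable_fun G" unfolding G_def by (intro defin definable_comp2[OF assms(2)])
  have "\<forall>X. X \<epsilon> img A G \<longrightarrow> X \<noteq> emp" using assms(3) G nonempty_iff by (auto simp: mem_img[OF dG])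
  then obtain ch B' where ch: "is_function E ch (img A G) B'" "\<And>X y. X \<epsilon> img A G \<Longrightarrow> opair X y \<epsilon> ch \<Longrightarrow> y \<epsilon> X"
    using assms(1) unfolding AC_def is_empty_iff related_iff by blast
  define F where "F x = app ch (G x)" for x
  have dF: "definable_fun F" unfolding F_def by (intro defin definable_term_comp1[OF dG])
  have "F x \<epsilon> G x" if "x \<epsilon> A" for x
  proof -
    have "G x \<epsilon> img A G" using that mem_img[OF dG] by blast
    then show ?thesis unfolding F_def using is_function_app(2)[OF ch(1)] ch(2) by blast
  qed
  then have "app (lam A F) x \<epsilon> B \<and> P x (app (lam A F) x)" if "x \<epsilon> A" for x
    using that G app_lam[OF dF] by simp
  then show ?thesis by blast
qed

definition sub :: "'a \<Rightarrow> 'a \<Rightarrow> bool" where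
  "sub x y \<longleftrightarrow> (\<forall>z. z \<epsilon> x \<longrightarrow> z \<epsilon> y)"

definition chain :: "'a \<Rightarrow> bool" where
  "chain C \<longleftrightarrow> (\<forall>x y. x \<epsilon> C \<and> y \<epsilon> C \<longrightarrow> sub x y \<or> sub y x)"

lemma definable_sub [defin]: "definable_term f \<Longrightarrow> definable_term g \<Longrightarrow> definable (\<lambda>v. sub (f v) (g v))"
  apply (rule definable_comp2[of sub])
  unfolding sub_def by (intro defin)

lemma definable_chain [defin]: "definable_term f \<Longrightarrow> definable (\<lambda>v. chain (f v))"
  apply (rule definable_comp1[of chain])
  unfolding chain_def by (intro defin)

lemma sub_refl: "sub x x" unfolding sub_def by blast
lemma sub_trans: "sub x y \<Longrightarrow> sub y z \<Longrightarrow> sub x z" unfolding sub_def by blast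
lemma sub_antisym: "sub x y \<Longrightarrow> sub y x \<Longrightarrow> x = y" unfolding sub_def by (blast intro: ext)
lemma sub_union: "x \<epsilon> C \<Longrightarrow> sub x (union C)" unfolding sub_def by auto
lemma union_sub: "(\<And>x. x \<epsilon> C \<Longrightarrow> sub x y) \<Longrightarrow> sub (union C) y" unfolding sub_def by auto

text \<open>Towers are the families closed under the operations that generate the chain in the
  Bourbaki--Witt argument.\<close>
definition tower :: "'a \<Rightarrow> 'a \<Rightarrow> 'a \<Rightarrow> bool" where
  "tower a s T \<longleftrightarrow> a \<epsilon> T \<and> (\<forall>x. x \<epsilon> T \<longrightarrow> app s x \<epsilon> T) \<and>
    (\<forall>C. sub C T \<and> chain C \<and> (\<exists>x. x \<epsilon> C) \<longrightarrow> union C \<epsilon> T)"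

lemma definable_tower [defin]:
  "definable_term f \<Longrightarrow> definable_term g \<Longrightarrow> definable_term h \<Longrightarrow> definable (\<lambda>v. tower (f v) (g v) (h v))"
  apply (rule definable_comp3[of tower])
  unfolding tower_def by (intro defin)

text \<open>The theorem of Bourbaki and Witt. The least tower \<open>M\<close> is a chain, so its union belongs to
  \<open>M\<close> and cannot be enlarged by \<open>s\<close>. To see that \<open>M\<close> is a chain, call \<open>c\<close> extreme if \<open>s\<close> maps
  everything strictly below \<open>c\<close> to something below \<open>c\<close>. For extreme \<open>c\<close>, each \<open>x\<close> in \<open>M\<close> is below
  \<open>c\<close> or above \<open>s c\<close>, and by a second induction all elements of \<open>M\<close> are extreme.\<close>
lemma tower_fixpoint:
  assumes T: "tower a s A" and s: "\<And>x. x \<epsilon> A \<Longrightarrow> sub x (app s x)"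
  shows "\<exists>m. m \<epsilon> A \<and> app s m = m"
proof -
  define M where "M = sep A (\<lambda>x. \<forall>T. tower a s T \<longrightarrow> x \<epsilon> T)"
  have M: "x \<epsilon> M \<longleftrightarrow> x \<epsilon> A \<and> (\<forall>T. tower a s T \<longrightarrow> x \<epsilon> T)" for x
    unfolding M_def by (rule mem_sep) (intro defin)
  have MT: "tower a s M"
    unfolding tower_def
  proof (intro conjI allI impI)
    show "a \<epsilon> M" unfolding M using T unfolding tower_def by blast
    show "app s x \<epsilon> M" if "x \<epsilon> M" for x using that T unfolding M tower_def by blast
    fix C assume C: "sub C M \<and> chain C \<and> (\<exists>x. x \<epsilon> C)"
    have "union C \<epsilon> T" if "tower a s T" for T
    proof -
      have "sub C T" using C that M unfolding sub_def by blast
      then show ?thesis using that C unfolding tower_def by blast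
    qed
    then show "union C \<epsilon> M" unfolding M using T by blast
  qed
  have sM: "sub x (app s x)" if "x \<epsilon> M" for x using that s M by blast
  have induct: "P x" if "x \<epsilon> M" "definable (\<lambda>w. P (w 0))" "P a" "\<And>x. x \<epsilon> M \<Longrightarrow> P x \<Longrightarrow> P (app s x)"
    "\<And>C. sub C M \<Longrightarrow> chain C \<Longrightarrow> (\<exists>x. x \<epsilon> C) \<Longrightarrow> (\<And>x. x \<epsilon> C \<Longrightarrow> P x) \<Longrightarrow> P (union C)" for x P
  proof -
    have p: "x \<epsilon> sep M P \<longleftrightarrow> x \<epsilon> M \<and> P x" for x by (rule mem_sep) (rule that(2))
    have "tower a s (sep M P)"
      unfolding tower_def
    proof (intro conjI allI impI)
      show "a \<epsilon> sep M P" unfolding p using that(3) MT unfolding tower_def by blast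
      show "app s x \<epsilon> sep M P" if "x \<epsilon> sep M P" for x
        using that \<open>\<And>x. x \<epsilon> M \<Longrightarrow> P x \<Longrightarrow> P (app s x)\<close> MT unfolding p tower_def by blast
      fix C assume C: "sub C (sep M P) \<and> chain C \<and> (\<exists>x. x \<epsilon> C)"
      then have "sub C M" "\<And>x. x \<epsilon> C \<Longrightarrow> P x" unfolding sub_def p by blast+
      then show "union C \<epsilon> sep M P" unfolding p using C that(5)[of C] MT unfolding tower_def by blast
    qed
    then have "x \<epsilon> sep M P" using that(1) M by blast
    then show ?thesis using p by blast
  qed
  define extreme where "extreme c \<longleftrightarrow> (\<forall>x. x \<epsilon> M \<and> sub x c \<and> x \<noteq> c \<longrightarrow> sub (app s x) c)" for c
  have dichotomy: "sub x c \<or> sub (app s c) x" if c: "c \<epsilon> M" "extreme c" and "x \<epsilon> M" for c x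
    using \<open>x \<epsilon> M\<close>
  proof (rule induct[of x "\<lambda>x. sub x c \<or> sub (app s c) x"])
    show "definable (\<lambda>w. sub (w 0) c \<or> sub (app s c) (w 0))" by (intro defin)
    have "definable (\<lambda>w. sub a (w 0))" by (intro defin)
    then have "sub a c"
    proof (rule induct[OF c(1)])
      show "sub a (app s x)" if "x \<epsilon> M" "sub a x" for x using that sM sub_trans by blast
      show "sub a (union C)" if C: "\<exists>x. x \<epsilon> C" "\<And>x. x \<epsilon> C \<Longrightarrow> sub a x" for C
        using C sub_union sub_trans by blast
    qed (rule sub_refl)
    then show "sub a c \<or> sub (app s c) a" ..
    show "sub (app s x) c \<or> sub (app s c) (app s x)" if "x \<epsilon> M" "sub x c \<or> sub (app s c) x" for x
      using that c(2) sM[OF that(1)] sub_trans sub_refl unfolding extreme_def by blast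
    show "sub (union C) c \<or> sub (app s c) (union C)" if C: "\<And>x. x \<epsilon> C \<Longrightarrow> sub x c \<or> sub (app s c) x" for C
    proof (cases "\<forall>x. x \<epsilon> C \<longrightarrow> sub x c")
      case True
      then show ?thesis by (blast intro: union_sub)
    next
      case False
      then obtain x where "x \<epsilon> C" "sub (app s c) x" using C by blast
      then show ?thesis using sub_union sub_trans by blast
    qed
  qed
  have ext: "extreme c" if "c \<epsilon> M" for c
    using that
  proof (rule induct)
    show "definable (\<lambda>w. extreme (w 0))" unfolding extreme_def by (intro defin)
    show "extreme a" unfolding extreme_def
    proof (intro allI impI)
      fix x assume x: "x \<epsilon> M \<and> sub x a \<and> x \<noteq> a"
      have "definable (\<lambda>w. sub a (w 0))" by (intro defin)
      then have "sub a x"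
      proof (rule induct[of x, rotated])
        show "sub a (app s x)" if "x \<epsilon> M" "sub a x" for x using that sM sub_trans by blast
        show "sub a (union C)" if C: "\<exists>x. x \<epsilon> C" "\<And>x. x \<epsilon> C \<Longrightarrow> sub a x" for C
          using C sub_union sub_trans by blast
      qed (use x sub_refl in blast)+
      then show "sub (app s x) a" using x sub_antisym by blast
    qed
    show "extreme (app s c)" if c: "c \<epsilon> M" "extreme c" for c
      unfolding extreme_def
    proof (intro allI impI)
      fix x assume x: "x \<epsilon> M \<and> sub x (app s c) \<and> x \<noteq> app s c"
      then have "sub x c" using dichotomy[OF c] sub_antisym by blast
      then show "sub (app s x) (app s c)"
        using c(2) x sM[OF c(1)] sub_trans sub_refl unfolding extreme_def by blast
    qed
    show "extreme (union C)" if C: "sub C M" "\<And>x. x \<epsilon> C \<Longrightarrow> extreme x" for C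
      unfolding extreme_def
    proof (intro allI impI)
      fix x assume x: "x \<epsilon> M \<and> sub x (union C) \<and> x \<noteq> union C"
      then have "\<not> (\<forall>c. c \<epsilon> C \<longrightarrow> sub c x)" using union_sub sub_antisym by blast
      then obtain c where c: "c \<epsilon> C" "\<not> sub c x" by blast
      then have cM: "c \<epsilon> M" using C unfolding sub_def by blast
      have "sub x c \<or> sub (app s c) x" using dichotomy[OF cM C(2)[OF c(1)]] x by blast
      then have "sub x c" using c(2) sM[OF cM] sub_trans by blast
      moreover have "x \<noteq> c" using c(2) sub_refl by blast
      ultimately have "sub (app s x) c" using C(2)[OF c(1)] x unfolding extreme_def by blast
      then show "sub (app s x) (union C)" using c(1) sub_union sub_trans by blast
    qed
  qed
  have "chain M" unfolding chain_def using dichotomy ext sM sub_trans by blast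
  moreover have "\<exists>x. x \<epsilon> M" using MT unfolding tower_def by blast
  ultimately have u: "union M \<epsilon> M" using MT sub_refl unfolding tower_def by blast
  then have "app s (union M) \<epsilon> M" using MT unfolding tower_def by blast
  then have "app s (union M) = union M" using sub_union sM[OF u] sub_antisym by blast
  then show ?thesis using u M by blast
qed

text \<open>If no element above \<open>a\<close> were maximal, choice would give a function \<open>s\<close> that properly
  enlarges each of them, against \<open>tower_fixpoint\<close>.\<close>
lemma zorn:
  assumes "AC E" "a \<epsilon> A"
    and chains: "\<And>C. (\<And>x. x \<epsilon> C \<Longrightarrow> x \<epsilon> A) \<Longrightarrow> chain C \<Longrightarrow> \<exists>x. x \<epsilon> C \<Longrightarrow> union C \<epsilon> A"
  shows "\<exists>m. m \<epsilon> A \<and> sub a m \<and> (\<forall>x. x \<epsilon> A \<and> sub m x \<longrightarrow> x = m)"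
proof (rule ccontr)
  assume contr: "\<not> ?thesis"
  define B where "B = sep A (sub a)"
  have B: "x \<epsilon> B \<longleftrightarrow> x \<epsilon> A \<and> sub a x" for x unfolding B_def by (rule mem_sep) (intro defin)
  have "\<exists>y. y \<epsilon> B \<and> (sub x y \<and> y \<noteq> x)" if "x \<epsilon> B" for x
    using contr that sub_trans unfolding B by blast
  moreover have "definable (\<lambda>w. sub (w 0) (w (Suc 0)) \<and> w (Suc 0) \<noteq> w 0)" by (intro defin)
  ultimately obtain s where s: "\<forall>x. x \<epsilon> B \<longrightarrow> app s x \<epsilon> B \<and> sub x (app s x) \<and> app s x \<noteq> x"
    using AC_select[OF assms(1), of "\<lambda>x y. sub x y \<and> y \<noteq> x" B B] by blast
  have "tower a s B"
    unfolding tower_def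
  proof (intro conjI allI impI)
    show "a \<epsilon> B" using assms(2) sub_refl B by blast
    show "app s x \<epsilon> B" if "x \<epsilon> B" for x using s that by blast
    fix C assume C: "sub C B \<and> chain C \<and> (\<exists>x. x \<epsilon> C)"
    then obtain x where "x \<epsilon> C" by blast
    then have "sub a (union C)" using C B sub_union sub_trans unfolding sub_def[of C B] by blast
    moreover have "union C \<epsilon> A" using C B by (intro chains) (auto simp: sub_def[of C B])
    ultimately show "union C \<epsilon> B" using B by blast
  qed
  then obtain m where "m \<epsilon> B" "app s m = m" using tower_fixpoint s by blast
  then show False using s by blast
qed

section \<open>The Schroeder--Bernstein theorem for sets and for linear orders\<close>

text \<open>\<open>X\<close> is the least fixed point of the monotone operator \<open>X \<mapsto> A - G[B - F[X]]\<close>. On \<open>X\<close> one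
  uses \<open>F\<close>, elsewhere the inverse of \<open>G\<close>. Leastness, the third property, is what the version for
  linear orders needs.\<close>
lemma schroeder_partition:
  assumes F: "definable_fun F" and G: "definable_fun G"
  obtains X where "\<forall>x. x \<epsilon> X \<longrightarrow> x \<epsilon> A"
    "\<forall>x. x \<epsilon> A \<longrightarrow> (\<not> x \<epsilon> X \<longleftrightarrow> (\<exists>y. y \<epsilon> B \<and> (\<forall>z. z \<epsilon> X \<longrightarrow> F z \<noteq> y) \<and> G y = x))"
    "\<forall>Y. (\<forall>x. x \<epsilon> Y \<longrightarrow> x \<epsilon> A) \<and>
        (\<forall>x. x \<epsilon> A \<and> \<not> x \<epsilon> Y \<longrightarrow> (\<exists>y. y \<epsilon> B \<and> (\<forall>z. z \<epsilon> Y \<longrightarrow> F z \<noteq> y) \<and> G y = x)) \<longrightarrow>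
      (\<forall>x. x \<epsilon> X \<longrightarrow> x \<epsilon> Y)"
proof -
  define pre where "pre Y \<longleftrightarrow> (\<forall>x. x \<epsilon> Y \<longrightarrow> x \<epsilon> A) \<and>
        (\<forall>x. x \<epsilon> A \<and> \<not> x \<epsilon> Y \<longrightarrow> (\<exists>y. y \<epsilon> B \<and> (\<forall>z. z \<epsilon> Y \<longrightarrow> F z \<noteq> y) \<and> G y = x))" for Y
  have pre: "definable (\<lambda>w. pre (w 0))"
    unfolding pre_def by (intro defin definable_term_comp1[OF F] definable_term_comp1[OF G])
  define X where "X = sep A (\<lambda>x. \<forall>Y. pre Y \<longrightarrow> x \<epsilon> Y)"
  have X: "x \<epsilon> X \<longleftrightarrow> x \<epsilon> A \<and> (\<forall>Y. pre Y \<longrightarrow> x \<epsilon> Y)" for x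
    unfolding X_def by (rule mem_sep) (intro defin definable_comp1[OF pre])
  have 1: "\<exists>y. y \<epsilon> B \<and> (\<forall>z. z \<epsilon> X \<longrightarrow> F z \<noteq> y) \<and> G y = x" if x: "x \<epsilon> A" "\<not> x \<epsilon> X" for x
  proof -
    obtain Y where Y: "pre Y" "\<not> x \<epsilon> Y" using x X by blast
    then have "\<exists>y. y \<epsilon> B \<and> (\<forall>z. z \<epsilon> Y \<longrightarrow> F z \<noteq> y) \<and> G y = x" using x unfolding pre_def by blast
    then obtain y where "y \<epsilon> B" "\<forall>z. z \<epsilon> Y \<longrightarrow> F z \<noteq> y" "G y = x" by blast
    moreover have "\<forall>z. z \<epsilon> X \<longrightarrow> z \<epsilon> Y" using X Y(1) by blast
    ultimately show ?thesis by blast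
  qed
  have 2: "\<not> x \<epsilon> X" if x: "y \<epsilon> B" "\<forall>z. z \<epsilon> X \<longrightarrow> F z \<noteq> y" "G y = x" for x y
  proof
    assume xX: "x \<epsilon> X"
    have Y: "z \<epsilon> sep X (\<lambda>z. z \<noteq> x) \<longleftrightarrow> z \<epsilon> X \<and> z \<noteq> x" for z by (rule mem_sep) (intro defin)
    have "pre (sep X (\<lambda>z. z \<noteq> x))"
      unfolding pre_def Y
    proof (intro conjI allI impI)
      fix z assume z: "z \<epsilon> A \<and> \<not> (z \<epsilon> X \<and> z \<noteq> x)"
      show "\<exists>y. y \<epsilon> B \<and> (\<forall>z. z \<epsilon> X \<and> z \<noteq> x \<longrightarrow> F z \<noteq> y) \<and> G y = z"
      proof (cases "z = x")
        case True then show ?thesis using x by blast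
      next
        case False then show ?thesis using 1[of z] z by blast
      qed
    qed (use X in blast)
    then have "x \<epsilon> sep X (\<lambda>z. z \<noteq> x)" using xX X by blast
    then show False using Y by blast
  qed
  show thesis
  proof (rule that[of X])
    show "\<forall>x. x \<epsilon> X \<longrightarrow> x \<epsilon> A" using X by blast
    show "\<forall>x. x \<epsilon> A \<longrightarrow> (\<not> x \<epsilon> X \<longleftrightarrow> (\<exists>y. y \<epsilon> B \<and> (\<forall>z. z \<epsilon> X \<longrightarrow> F z \<noteq> y) \<and> G y = x))"
      using 1 2 by blast
    show "\<forall>Y. (\<forall>x. x \<epsilon> Y \<longrightarrow> x \<epsilon> A) \<and>
        (\<forall>x. x \<epsilon> A \<and> \<not> x \<epsilon> Y \<longrightarrow> (\<exists>y. y \<epsilon> B \<and> (\<forall>z. z \<epsilon> Y \<longrightarrow> F z \<noteq> y) \<and> G y = x)) \<longrightarrow>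
      (\<forall>x. x \<epsilon> X \<longrightarrow> x \<epsilon> Y)"
      using X unfolding pre_def by blast
  qed
qed

lemma schroeder_glue:
  assumes F: "definable_fun F" "\<forall>x. x \<epsilon> A \<longrightarrow> F x \<epsilon> B" "\<forall>x y. x \<epsilon> A \<longrightarrow> y \<epsilon> A \<longrightarrow> F x = F y \<longrightarrow> x = y"
    and G: "definable_fun G" "\<forall>x. x \<epsilon> B \<longrightarrow> G x \<epsilon> A" "\<forall>x y. x \<epsilon> B \<longrightarrow> y \<epsilon> B \<longrightarrow> G x = G y \<longrightarrow> x = y"
    and X: "\<forall>x. x \<epsilon> X \<longrightarrow> x \<epsilon> A"
    "\<forall>x. x \<epsilon> A \<longrightarrow> (\<not> x \<epsilon> X \<longleftrightarrow> (\<exists>y. y \<epsilon> B \<and> (\<forall>z. z \<epsilon> X \<longrightarrow> F z \<noteq> y) \<and> G y = x))"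
  obtains H where "definable_fun H" "bij_betw H (elts A) (elts B)" "\<forall>x. x \<epsilon> X \<longrightarrow> H x = F x"
    "\<forall>x. x \<epsilon> A \<and> \<not> x \<epsilon> X \<longrightarrow> H x \<epsilon> B \<and> G (H x) = x \<and> (\<forall>z. z \<epsilon> X \<longrightarrow> F z \<noteq> H x)"
proof -
  define H where "H x = (if x \<epsilon> X then F x else the_in B (\<lambda>y. G y = x))" for x
  have dH: "definable_fun H"
    unfolding H_def by (intro defin definable_term_comp1[OF F(1)] definable_term_comp1[OF G(1)])
  have HX: "H x = F x" if "x \<epsilon> X" for x using that by (simp add: H_def)
  have HG: "H x \<epsilon> B \<and> G (H x) = x \<and> (\<forall>z. z \<epsilon> X \<longrightarrow> F z \<noteq> H x)" if x: "x \<epsilon> A" "\<not> x \<epsilon> X" for x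
  proof -
    obtain y where y: "y \<epsilon> B" "\<forall>z. z \<epsilon> X \<longrightarrow> F z \<noteq> y" "G y = x" using X(2) x by blast
    have "the_in B (\<lambda>y. G y = x) = y"
    proof (rule the_in_eq)
      show "definable (\<lambda>w. G (w 0) = x)" by (intro defin definable_term_comp1[OF G(1)])
      show "y' = y" if "y' \<epsilon> B" "G y' = x" for y' using G(3) that y by blast
    qed (use y in auto)
    then show ?thesis using y x by (simp add: H_def)
  qed
  have "bij_betw H (elts A) (elts B)"
  proof (rule bij_betwI')
    fix x y assume xy: "x \<in> elts A" "y \<in> elts A"
    have "x = y" if e: "H x = H y"
    proof (cases "x \<epsilon> X")
      case True
      then have "y \<epsilon> X" using e HX[OF True] HG[of y] xy by (metis mem_elts)
      then show ?thesis using True e HX F(3) xy by simp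
    next
      case False
      then have "\<not> y \<epsilon> X" using e HX[of y] HG[of x] xy by (metis mem_elts)
      then have "G (H x) = x" "G (H y) = y" using False HG[of x] HG[of y] xy mem_elts by blast+
      then show ?thesis using e by metis
    qed
    then show "H x = H y \<longleftrightarrow> x = y" by metis
  next
    fix x assume "x \<in> elts A"
    then show "H x \<in> elts B" using HX[of x] HG[of x] F(2) by (cases "x \<epsilon> X") auto
  next
    fix y assume "y \<in> elts B"
    then have y: "y \<epsilon> B" by simp
    show "\<exists>x\<in>elts A. y = H x"
    proof (cases "\<exists>z. z \<epsilon> X \<and> F z = y")
      case True
      then show ?thesis using HX X(1) mem_elts by metis
    next
      case False
      then have "G y \<epsilon> A" "\<not> G y \<epsilon> X" using X(2) G(2) y by blast+
      then have "H (G y) = y" using HG[of "G y"] G(3) y by blast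
      then show ?thesis using \<open>G y \<epsilon> A\<close> by (intro bexI[of _ "G y"]) simp_all
    qed
  qed
  then show thesis using that dH HX HG by blast
qed

lemma schroeder_bernstein:
  assumes "lepoll A B" "lepoll B A"
  obtains H where "definable_fun H" "bij_betw H (elts A) (elts B)"
proof -
  obtain F where F: "definable_fun F" "\<forall>x. x \<epsilon> A \<longrightarrow> F x \<epsilon> B" "\<forall>x y. x \<epsilon> A \<longrightarrow> y \<epsilon> A \<longrightarrow> F x = F y \<longrightarrow> x = y"
    using assms(1) by (rule lepollE)
  obtain G where G: "definable_fun G" "\<forall>x. x \<epsilon> B \<longrightarrow> G x \<epsilon> A" "\<forall>x y. x \<epsilon> B \<longrightarrow> y \<epsilon> B \<longrightarrow> G x = G y \<longrightarrow> x = y"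
    using assms(2) by (rule lepollE)
  obtain X where X: "\<forall>x. x \<epsilon> X \<longrightarrow> x \<epsilon> A"
    "\<forall>x. x \<epsilon> A \<longrightarrow> (\<not> x \<epsilon> X \<longleftrightarrow> (\<exists>y. y \<epsilon> B \<and> (\<forall>z. z \<epsilon> X \<longrightarrow> F z \<noteq> y) \<and> G y = x))"
    by (rule schroeder_partition[OF F(1) G(1), of A B]) blast
  show thesis by (rule schroeder_glue[OF F G X]) (blast intro: that)
qed

text \<open>The order is a HOL relation; requiring its definability here keeps this condition out of
  all later statements.\<close>
definition strict_linear :: "'a \<Rightarrow> ('a \<Rightarrow> 'a \<Rightarrow> bool) \<Rightarrow> bool" where
  "strict_linear A R \<longleftrightarrow> definable (\<lambda>w. R (w 0) (w (Suc 0))) \<and> (\<forall>x. x \<epsilon> A \<longrightarrow> \<not> R x x) \<and>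
    (\<forall>x y z. x \<epsilon> A \<and> y \<epsilon> A \<and> z \<epsilon> A \<and> R x y \<and> R y z \<longrightarrow> R x z) \<and>
    (\<forall>x y. x \<epsilon> A \<and> y \<epsilon> A \<longrightarrow> R x y \<or> x = y \<or> R y x)"

lemma strict_linearD:
  assumes "strict_linear A R"
  shows "definable (\<lambda>w. R (w 0) (w (Suc 0)))" "x \<epsilon> A \<Longrightarrow> \<not> R x x"
    "x \<epsilon> A \<Longrightarrow> y \<epsilon> A \<Longrightarrow> z \<epsilon> A \<Longrightarrow> R x y \<Longrightarrow> R y z \<Longrightarrow> R x z"
    "x \<epsilon> A \<Longrightarrow> y \<epsilon> A \<Longrightarrow> R x y \<or> x = y \<or> R y x"
  using assms unfolding strict_linear_def by blast+

lemma strict_linear_subset: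
  assumes "strict_linear A R" "\<And>x. x \<epsilon> B \<Longrightarrow> x \<epsilon> A" shows "strict_linear B R"
  unfolding strict_linear_def
proof (intro conjI allI impI)
  show "R x z" if "x \<epsilon> B \<and> y \<epsilon> B \<and> z \<epsilon> B \<and> R x y \<and> R y z" for x y z
    using that strict_linearD(3)[OF assms(1), of x y z] assms(2) by simp
qed (simp_all add: strict_linearD[OF assms(1)] assms(2))

lemma strict_mono_reflects:
  assumes "strict_linear A R" "strict_linear B Q" "\<forall>x. x \<epsilon> A \<longrightarrow> F x \<epsilon> B"
    "\<forall>x y. x \<epsilon> A \<longrightarrow> y \<epsilon> A \<longrightarrow> R x y \<longrightarrow> Q (F x) (F y)" "x \<epsilon> A" "y \<epsilon> A"
  shows "Q (F x) (F y) \<longleftrightarrow> R x y" "F x = F y \<longleftrightarrow> x = y"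
proof -
  have B: "F x \<epsilon> B" "F y \<epsilon> B" using assms by blast+
  note irr = strict_linearD(2)[OF assms(2) B(1)]
  have n: "\<not> (Q (F x) (F y) \<and> Q (F y) (F x))" using strict_linearD(3)[OF assms(2) B(1) B(2) B(1)] irr by blast
  have c: "R x y \<or> x = y \<or> R y x" by (rule strict_linearD(4)[OF assms(1,5,6)])
  have m: "R x y \<Longrightarrow> Q (F x) (F y)" "R y x \<Longrightarrow> Q (F y) (F x)" using assms(4-6) by blast+
  have i: "\<not> R x x" by (rule strict_linearD(2)[OF assms(1,5)])
  show "Q (F x) (F y) \<longleftrightarrow> R x y" using n c m irr by metis
  show "F x = F y \<longleftrightarrow> x = y" using n c m irr by metis
qed

text \<open>If \<open>F\<close> maps \<open>A\<close> onto an initial segment of \<open>B\<close> and \<open>G\<close> maps \<open>B\<close> onto a final segment of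
  \<open>A\<close>, the least fixed point \<open>X\<close> is an initial segment of \<open>A\<close>; then the bijection that uses \<open>F\<close> on
  \<open>X\<close> and the inverse of \<open>G\<close> above \<open>X\<close> is monotone. To see that \<open>X\<close> is initial, let \<open>K\<close> be the set
  of elements of \<open>X\<close> all of whose predecessors are in \<open>X\<close>. The operator maps initial segments to
  initial segments, so \<open>K\<close> is still closed under it, and leastness gives \<open>X = K\<close>.\<close>
lemma lindenbaum:
  assumes lin: "strict_linear A R" "strict_linear B Q"
    and F: "definable_fun F" "\<forall>x. x \<epsilon> A \<longrightarrow> F x \<epsilon> B" "\<forall>x y. x \<epsilon> A \<longrightarrow> y \<epsilon> A \<longrightarrow> R x y \<longrightarrow> Q (F x) (F y)"
    and F_initial: "\<forall>x y. x \<epsilon> A \<longrightarrow> y \<epsilon> B \<longrightarrow> Q y (F x) \<longrightarrow> (\<exists>z. z \<epsilon> A \<and> F z = y)"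
    and G: "definable_fun G" "\<forall>x. x \<epsilon> B \<longrightarrow> G x \<epsilon> A" "\<forall>x y. x \<epsilon> B \<longrightarrow> y \<epsilon> B \<longrightarrow> Q x y \<longrightarrow> R (G x) (G y)"
    and G_final: "\<forall>x y. x \<epsilon> B \<longrightarrow> y \<epsilon> A \<longrightarrow> R (G x) y \<longrightarrow> (\<exists>z. z \<epsilon> B \<and> G z = y)"
  obtains H where "definable_fun H" "bij_betw H (elts A) (elts B)"
    "\<forall>x y. x \<epsilon> A \<longrightarrow> y \<epsilon> A \<longrightarrow> R x y \<longrightarrow> Q (H x) (H y)"
proof -
  note Fr = strict_mono_reflects[OF lin F(2,3)]
  note Gr = strict_mono_reflects[OF lin(2,1) G(2,3)]
  have Fi: "\<forall>x y. x \<epsilon> A \<longrightarrow> y \<epsilon> A \<longrightarrow> F x = F y \<longrightarrow> x = y" using Fr(2) by blast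
  have Gi: "\<forall>x y. x \<epsilon> B \<longrightarrow> y \<epsilon> B \<longrightarrow> G x = G y \<longrightarrow> x = y" using Gr(2) by blast
  obtain X where X: "\<forall>x. x \<epsilon> X \<longrightarrow> x \<epsilon> A"
    "\<forall>x. x \<epsilon> A \<longrightarrow> (\<not> x \<epsilon> X \<longleftrightarrow> (\<exists>y. y \<epsilon> B \<and> (\<forall>z. z \<epsilon> X \<longrightarrow> F z \<noteq> y) \<and> G y = x))"
    "\<forall>Y. (\<forall>x. x \<epsilon> Y \<longrightarrow> x \<epsilon> A) \<and>
        (\<forall>x. x \<epsilon> A \<and> \<not> x \<epsilon> Y \<longrightarrow> (\<exists>y. y \<epsilon> B \<and> (\<forall>z. z \<epsilon> Y \<longrightarrow> F z \<noteq> y) \<and> G y = x)) \<longrightarrow>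
      (\<forall>x. x \<epsilon> X \<longrightarrow> x \<epsilon> Y)"
    by (rule schroeder_partition[OF F(1) G(1), of A B])
  define K where "K = sep X (\<lambda>x. \<forall>x'. x' \<epsilon> A \<and> R x' x \<longrightarrow> x' \<epsilon> X)"
  have K: "x \<epsilon> K \<longleftrightarrow> x \<epsilon> X \<and> (\<forall>x'. x' \<epsilon> A \<and> R x' x \<longrightarrow> x' \<epsilon> X)" for x
    unfolding K_def by (rule mem_sep) (intro defin definable_comp2[OF strict_linearD(1)[OF lin(1)]])
  have XK: "\<forall>x. x \<epsilon> X \<longrightarrow> x \<epsilon> K"
  proof (rule X(3)[THEN spec, THEN mp], rule conjI)
    show "\<forall>x. x \<epsilon> K \<longrightarrow> x \<epsilon> A" using K X(1) by blast
    show "\<forall>x. x \<epsilon> A \<and> \<not> x \<epsilon> K \<longrightarrow> (\<exists>y. y \<epsilon> B \<and> (\<forall>z. z \<epsilon> K \<longrightarrow> F z \<noteq> y) \<and> G y = x)"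
    proof (intro allI impI)
      fix x assume x: "x \<epsilon> A \<and> \<not> x \<epsilon> K"
      show "\<exists>y. y \<epsilon> B \<and> (\<forall>z. z \<epsilon> K \<longrightarrow> F z \<noteq> y) \<and> G y = x"
      proof (cases "x \<epsilon> X")
        case False
        then show ?thesis using X(2) x K by blast
      next
        case True
        then obtain x' where x': "x' \<epsilon> A" "R x' x" "\<not> x' \<epsilon> X" using x K by blast
        then obtain y' where y': "y' \<epsilon> B" "\<forall>z. z \<epsilon> X \<longrightarrow> F z \<noteq> y'" "G y' = x'" using X(2) by blast
        then obtain y where y: "y \<epsilon> B" "G y = x" using G_final x x' by blast
        have Q: "Q y' y" using Gr(1)[OF y'(1) y(1)] y y' x' by simp
        have "F z \<noteq> y" if z: "z \<epsilon> K" for z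
        proof
          assume "F z = y"
          have zA: "z \<epsilon> A" using z K X(1) by blast
          then obtain z' where z': "z' \<epsilon> A" "F z' = y'" using F_initial Q \<open>F z = y\<close> y'(1) by blast
          then have "R z' z" using Fr(1)[OF z'(1) zA] Q \<open>F z = y\<close> by simp
          then show False using z K z' y' by blast
        qed
        then show ?thesis using y by blast
      qed
    qed
  qed
  have initial: "x' \<epsilon> X" if "x \<epsilon> X" "x' \<epsilon> A" "R x' x" for x x' using XK K that by blast
  obtain H where H: "definable_fun H" "bij_betw H (elts A) (elts B)" "\<forall>x. x \<epsilon> X \<longrightarrow> H x = F x"
    "\<forall>x. x \<epsilon> A \<and> \<not> x \<epsilon> X \<longrightarrow> H x \<epsilon> B \<and> G (H x) = x \<and> (\<forall>z. z \<epsilon> X \<longrightarrow> F z \<noteq> H x)"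
    by (rule schroeder_glue[OF F(1,2) Fi G(1,2) Gi X(1,2)])
  have "Q (H x) (H y)" if xy: "x \<epsilon> A" "y \<epsilon> A" "R x y" for x y
  proof (cases "y \<epsilon> X")
    case True
    then show ?thesis using initial[OF True xy(1,3)] H(3) F(3) xy by simp
  next
    case yX: False
    have y: "H y \<epsilon> B" "G (H y) = y" "\<forall>z. z \<epsilon> X \<longrightarrow> F z \<noteq> H y" using H(4) yX xy by blast+
    show ?thesis
    proof (cases "x \<epsilon> X")
      case False
      then have x: "H x \<epsilon> B" "G (H x) = x" using H(4) xy by blast+
      then show ?thesis using Gr(1)[OF x(1) y(1)] y xy by simp
    next
      case True
      have "\<not> Q (H y) (F x)"
      proof
        assume Q: "Q (H y) (F x)"
        then obtain z where z: "z \<epsilon> A" "F z = H y" using F_initial xy y by blast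
        then have "R z x" using Fr(1)[OF z(1) xy(1)] Q by simp
        then show False using initial[OF True z(1)] y z by blast
      qed
      moreover have "F x \<noteq> H y" using y True by blast
      moreover have "F x \<epsilon> B" using F(2) xy by blast
      ultimately show ?thesis using strict_linearD(4)[OF lin(2) _ y(1), of "F x"] H(3) True by simp
    qed
  qed
  then show thesis using that H by blast
qed

section \<open>Homogeneity from automorphisms\<close>

definition aut :: "'a \<Rightarrow> ('a \<Rightarrow> 'a \<Rightarrow> bool) \<Rightarrow> ('a \<Rightarrow> 'a) \<Rightarrow> bool" where
  "aut L R F \<longleftrightarrow> definable_fun F \<and> (\<forall>x. x \<epsilon> L \<longrightarrow> F x \<epsilon> L) \<and> (\<forall>y. y \<epsilon> L \<longrightarrow> (\<exists>x. x \<epsilon> L \<and> F x = y)) \<and>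
    (\<forall>x y. x \<epsilon> L \<longrightarrow> y \<epsilon> L \<longrightarrow> R x y \<longrightarrow> R (F x) (F y))"

lemma autD:
  assumes "aut L R F"
  shows "definable_fun F" "x \<epsilon> L \<Longrightarrow> F x \<epsilon> L" "y \<epsilon> L \<Longrightarrow> \<exists>x. x \<epsilon> L \<and> F x = y"
    "x \<epsilon> L \<Longrightarrow> y \<epsilon> L \<Longrightarrow> R x y \<Longrightarrow> R (F x) (F y)"
  using assms unfolding aut_def by blast+

lemma aut_comp:
  assumes F: "aut L R F" and G: "aut L R G" shows "aut L R (\<lambda>x. G (F x))"
  unfolding aut_def
proof (intro conjI allI impI)
  show "definable_fun (\<lambda>x. G (F x))" by (rule definable_term_comp1[OF autD(1)[OF G] autD(1)[OF F]])
  show "G (F x) \<epsilon> L" if "x \<epsilon> L" for x by (intro autD(2)[OF G] autD(2)[OF F] that)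
  show "\<exists>x. x \<epsilon> L \<and> G (F x) = y" if y: "y \<epsilon> L" for y
  proof -
    obtain z where z: "z \<epsilon> L" "G z = y" using autD(3)[OF G y] by blast
    obtain x where "x \<epsilon> L" "F x = z" using autD(3)[OF F z(1)] by blast
    then show ?thesis using z by blast
  qed
  show "R (G (F x)) (G (F y))" if "x \<epsilon> L" "y \<epsilon> L" "R x y" for x y
    by (intro autD(4)[OF G] autD(4)[OF F] autD(2)[OF F] that)
qed

lemma aut_iff:
  assumes "strict_linear L R" "aut L R F" "x \<epsilon> L" "y \<epsilon> L"
  shows "R (F x) (F y) \<longleftrightarrow> R x y" "F x = F y \<longleftrightarrow> x = y"
  using strict_mono_reflects[OF assms(1,1) _ _ assms(3,4), of F] autD(2,4)[OF assms(2)] by blast+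

lemma aut_inverse:
  assumes "strict_linear L R" "aut L R F"
  obtains G where "aut L R G" "\<forall>x. x \<epsilon> L \<longrightarrow> G (F x) = x" "\<forall>x. x \<epsilon> L \<longrightarrow> F (G x) = x"
proof -
  define G where "G y = the_in L (\<lambda>x. F x = y)" for y
  have F: "definable_fun F" "\<And>x. x \<epsilon> L \<Longrightarrow> F x \<epsilon> L" "\<And>y. y \<epsilon> L \<Longrightarrow> \<exists>x. x \<epsilon> L \<and> F x = y"
    using assms(2) unfolding aut_def by blast+
  have GF: "G (F x) = x" if "x \<epsilon> L" for x
    unfolding G_def
  proof (rule the_in_eq)
    show "definable (\<lambda>w. F (w 0) = F x)" by (intro defin definable_term_comp1[OF F(1)])
    show "y = x" if "y \<epsilon> L" "F y = F x" for y using aut_iff(2)[OF assms that(1) \<open>x \<epsilon> L\<close>] that by simp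
  qed (use that in simp_all)
  have FG: "F (G y) = y" "G y \<epsilon> L" if "y \<epsilon> L" for y using F(3)[OF that] GF by metis+
  have "definable_fun G" unfolding G_def by (intro defin definable_term_comp1[OF F(1)])
  moreover have "R (G x) (G y)" if "x \<epsilon> L" "y \<epsilon> L" "R x y" for x y
    using aut_iff(1)[OF assms FG(2)[OF that(1)] FG(2)[OF that(2)]] FG that by simp
  moreover have "\<exists>x. x \<epsilon> L \<and> G x = y" if "y \<epsilon> L" for y using that GF F(2) by blast
  ultimately have "aut L R G" unfolding aut_def using FG(2) by blast
  then show thesis using that GF FG by blast
qed

text \<open>Moving \<open>a\<close> to the base point \<open>z0\<close>, contracting, and moving \<open>z0\<close> to \<open>c\<close> maps \<open>[a,b)\<close> onto
  an initial segment of \<open>[c,d)\<close>. Moving \<open>b\<close> to \<open>z0\<close>, contracting, and moving \<open>z0\<close> to \<open>d\<close> maps it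
  onto a final segment. Lindenbaum's theorem combines one map of each kind.\<close>
lemma half_open_isomorphic:
  assumes lin: "strict_linear L R" and z0: "z0 \<epsilon> L"
    and trans: "\<And>a. a \<epsilon> L \<Longrightarrow> \<exists>F. aut L R F \<and> F z0 = a"
    and contract_up: "\<And>b d. b \<epsilon> L \<Longrightarrow> d \<epsilon> L \<Longrightarrow> R z0 b \<Longrightarrow> R z0 d \<Longrightarrow> \<exists>F. aut L R F \<and> F z0 = z0 \<and> R (F d) b"
    and contract_down: "\<And>b d. b \<epsilon> L \<Longrightarrow> d \<epsilon> L \<Longrightarrow> R b z0 \<Longrightarrow> R d z0 \<Longrightarrow> \<exists>F. aut L R F \<and> F z0 = z0 \<and> R b (F d)"
    and A: "\<And>x. x \<epsilon> A \<longleftrightarrow> x \<epsilon> L \<and> (R a x \<or> a = x) \<and> R x b" and ab: "a \<epsilon> L" "b \<epsilon> L" "R a b"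
    and B: "\<And>x. x \<epsilon> B \<longleftrightarrow> x \<epsilon> L \<and> (R c x \<or> c = x) \<and> R x d" and cd: "c \<epsilon> L" "d \<epsilon> L" "R c d"
  obtains H where "definable_fun H" "bij_betw H (elts A) (elts B)"
    "\<forall>x y. x \<epsilon> A \<longrightarrow> y \<epsilon> A \<longrightarrow> R x y \<longrightarrow> R (H x) (H y)"
proof -
  note lt_trans = strict_linearD(3)[OF lin]
  have to_zero: "\<exists>F. aut L R F \<and> F a = z0" if h: "a \<epsilon> L" for a
  proof -
    obtain F where F: "aut L R F" "F z0 = a" using trans h by blast
    obtain G where "aut L R G" "\<forall>x. x \<epsilon> L \<longrightarrow> G (F x) = x" by (rule aut_inverse[OF lin F(1)])
    then show ?thesis using F(2) z0 by blast
  qed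
  have autL: "F x \<epsilon> L" if h: "aut L R F" "x \<epsilon> L" for F x using h unfolding aut_def by blast
  have autR: "R (F x) (F y)" if h: "aut L R F" "x \<epsilon> L" "y \<epsilon> L" "R x y" for F x y using h unfolding aut_def by blast
  have initial: "\<exists>F. aut L R F \<and> F a = c \<and> R (F b) d"
    if h: "a \<epsilon> L" "b \<epsilon> L" "R a b" "c \<epsilon> L" "d \<epsilon> L" "R c d" for a b c d
  proof -
    obtain F where F: "aut L R F" "F a = z0" using to_zero h by blast
    obtain K where K: "aut L R K" "K z0 = c" using trans h by blast
    obtain J where J: "aut L R J" "\<forall>x. x \<epsilon> L \<longrightarrow> J (K x) = x" "\<forall>x. x \<epsilon> L \<longrightarrow> K (J x) = x" by (rule aut_inverse[OF lin K(1)])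
    have "R z0 (F b)" using autR[OF F(1) h(1,2,3)] F(2) by simp
    moreover have "R z0 (J d)" using autR[OF J(1) h(4,5,6)] J(2) K(2) z0 by metis
    ultimately obtain C where C: "aut L R C" "C z0 = z0" "R (C (F b)) (J d)"
      using contract_up[of "J d" "F b"] autL F J h by blast
    have "R (K (C (F b))) (K (J d))"
      by (rule autR[OF K(1) autL[OF C(1) autL[OF F(1) h(2)]] autL[OF J(1) h(5)] C(3)])
    then have "R (K (C (F b))) d" using J(3) h by simp
    moreover have "aut L R (\<lambda>x. K (C (F x)))" by (rule aut_comp[OF aut_comp[OF F(1) C(1)] K(1)])
    ultimately show ?thesis using F C K by (intro exI[of _ "\<lambda>x. K (C (F x))"]) simp
  qed
  have final: "\<exists>F. aut L R F \<and> F b = d \<and> R c (F a)"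
    if h: "a \<epsilon> L" "b \<epsilon> L" "R a b" "c \<epsilon> L" "d \<epsilon> L" "R c d" for a b c d
  proof -
    obtain F where F: "aut L R F" "F b = z0" using to_zero h by blast
    obtain K where K: "aut L R K" "K z0 = d" using trans h by blast
    obtain J where J: "aut L R J" "\<forall>x. x \<epsilon> L \<longrightarrow> J (K x) = x" "\<forall>x. x \<epsilon> L \<longrightarrow> K (J x) = x" by (rule aut_inverse[OF lin K(1)])
    have "R (F a) z0" using autR[OF F(1) h(1,2,3)] F(2) by simp
    moreover have "R (J c) z0" using autR[OF J(1) h(4,5,6)] J(2) K(2) z0 by metis
    ultimately obtain C where C: "aut L R C" "C z0 = z0" "R (J c) (C (F a))"
      using contract_down[of "J c" "F a"] autL F J h by blast
    have "R (K (J c)) (K (C (F a)))"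
      by (rule autR[OF K(1) autL[OF J(1) h(4)] autL[OF C(1) autL[OF F(1) h(1)]] C(3)])
    then have "R c (K (C (F a)))" using J(3) h by simp
    moreover have "aut L R (\<lambda>x. K (C (F x)))" by (rule aut_comp[OF aut_comp[OF F(1) C(1)] K(1)])
    ultimately show ?thesis using F C K by (intro exI[of _ "\<lambda>x. K (C (F x))"]) simp
  qed
  obtain F where F: "aut L R F" "F a = c" "R (F b) d" using initial ab cd by blast
  obtain G where G: "aut L R G" "G d = b" "R a (G c)" using final ab cd by blast
  have Fb: "F b \<epsilon> L" "G c \<epsilon> L" using autL F G ab cd by blast+
  have linA: "strict_linear A R" "strict_linear B R"
    by (rule strict_linear_subset[OF lin], simp add: A B)+
  show thesis
  proof (rule lindenbaum[OF linA, of F G])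
    show "definable_fun F" "definable_fun G" using F G unfolding aut_def by blast+
    show "\<forall>x. x \<epsilon> A \<longrightarrow> F x \<epsilon> B"
    proof (intro allI impI)
      fix x assume "x \<epsilon> A"
      then have x: "x \<epsilon> L" "R a x \<or> a = x" "R x b" using A by blast+
      have "R (F x) d" using autR[OF F(1) x(1) ab(2) x(3)] F(3) lt_trans[OF autL[OF F(1) x(1)] Fb(1) cd(2)] by blast
      moreover have "R c (F x) \<or> c = F x" using x(2) autR[OF F(1) ab(1) x(1)] F(2) by auto
      ultimately show "F x \<epsilon> B" using B autL[OF F(1) x(1)] by blast
    qed
    show "\<forall>x. x \<epsilon> B \<longrightarrow> G x \<epsilon> A"
    proof (intro allI impI)
      fix x assume "x \<epsilon> B"
      then have x: "x \<epsilon> L" "R c x \<or> c = x" "R x d" using B by blast+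
      have "R a (G x)" using x(2) autR[OF G(1) cd(1) x(1)] G(3) lt_trans[OF ab(1) Fb(2) autL[OF G(1) x(1)]] by blast
      moreover have "R (G x) b" using autR[OF G(1) x(1) cd(2) x(3)] G(2) by simp
      ultimately show "G x \<epsilon> A" using A autL[OF G(1) x(1)] by blast
    qed
    show "\<forall>x y. x \<epsilon> A \<longrightarrow> y \<epsilon> A \<longrightarrow> R x y \<longrightarrow> R (F x) (F y)" using A autR[OF F(1)] by blast
    show "\<forall>x y. x \<epsilon> B \<longrightarrow> y \<epsilon> B \<longrightarrow> R x y \<longrightarrow> R (G x) (G y)" using B autR[OF G(1)] by blast
    show "\<forall>x y. x \<epsilon> A \<longrightarrow> y \<epsilon> B \<longrightarrow> R y (F x) \<longrightarrow> (\<exists>z. z \<epsilon> A \<and> F z = y)"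
    proof (intro allI impI)
      fix x y assume h: "x \<epsilon> A" "y \<epsilon> B" "R y (F x)"
      then have x: "x \<epsilon> L" "R x b" and y: "y \<epsilon> L" "R c y \<or> c = y" using A B by blast+
      obtain z where z: "z \<epsilon> L" "F z = y" using F(1) y(1) unfolding aut_def by blast
      have "R z x" using aut_iff(1)[OF lin F(1) z(1) x(1)] h(3) z(2) by simp
      then have "R z b" using lt_trans[OF z(1) x(1) ab(2)] x(2) by blast
      moreover have "R a z \<or> a = z" using y(2) aut_iff[OF lin F(1) ab(1) z(1)] F(2) z(2) by auto
      ultimately show "\<exists>z. z \<epsilon> A \<and> F z = y" using A z by blast
    qed
    show "\<forall>x y. x \<epsilon> B \<longrightarrow> y \<epsilon> A \<longrightarrow> R (G x) y \<longrightarrow> (\<exists>z. z \<epsilon> B \<and> G z = y)"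
    proof (intro allI impI)
      fix x y assume h: "x \<epsilon> B" "y \<epsilon> A" "R (G x) y"
      then have x: "x \<epsilon> L" "R c x \<or> c = x" and y: "y \<epsilon> L" "R y b" using A B by blast+
      obtain z where z: "z \<epsilon> L" "G z = y" using G(1) y(1) unfolding aut_def by blast
      have "R x z" using aut_iff(1)[OF lin G(1) x(1) z(1)] h(3) z(2) by simp
      then have "R c z" using lt_trans[OF cd(1) x(1) z(1)] x(2) by blast
      moreover have "R z d" using y(2) aut_iff(1)[OF lin G(1) z(1) cd(2)] G(2) z(2) by auto
      ultimately show "\<exists>z. z \<epsilon> B \<and> G z = y" using B z by blast
    qed
  qed (rule that)
qed

section \<open>Cardinal arithmetic from choice\<close>

text \<open>A set that is generated from \<open>x0\<close> by operations \<open>F p\<close> with \<open>p \<epsilon> P\<close> is no larger than a set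
  \<open>K\<close> in which the terms describing its elements can be coded: \<open>z\<close> codes the term \<open>x0\<close>, and \<open>c p
  t\<close> codes \<open>F p\<close> applied to the term with code \<open>t\<close>. Since the coding is injective, evaluation, the
  least relation \<open>e\<close> that respects the operations, is single-valued. This takes the place of
  recursion on natural numbers.\<close>
lemma generated_lepoll:
  assumes AC: "AC E"
    and c: "definable_term (\<lambda>w. c (w 0) (w (Suc 0)))" and F: "definable_term (\<lambda>w. F (w 0) (w (Suc 0)))"
    and z: "z \<epsilon> K" and cK: "\<And>p t. p \<epsilon> P \<Longrightarrow> t \<epsilon> K \<Longrightarrow> c p t \<epsilon> K \<and> c p t \<noteq> z"
    and inj: "\<And>p t p' t'. p \<epsilon> P \<Longrightarrow> t \<epsilon> K \<Longrightarrow> p' \<epsilon> P \<Longrightarrow> t' \<epsilon> K \<Longrightarrow> c p t = c p' t' \<Longrightarrow> p = p' \<and> t = t'"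
    and x0: "x0 \<epsilon> X" and FX: "\<And>p x. p \<epsilon> P \<Longrightarrow> x \<epsilon> X \<Longrightarrow> F p x \<epsilon> X"
    and gen: "\<And>M. x0 \<epsilon> M \<Longrightarrow> (\<And>x. x \<epsilon> M \<Longrightarrow> x \<epsilon> X) \<Longrightarrow> (\<And>p x. p \<epsilon> P \<Longrightarrow> x \<epsilon> M \<Longrightarrow> F p x \<epsilon> M) \<Longrightarrow> (\<And>x. x \<epsilon> L \<Longrightarrow> x \<epsilon> M)"
  shows "lepoll L K"
proof -
  define cl where "cl R \<longleftrightarrow> opair z x0 \<epsilon> R \<and>
    (\<forall>p t x. p \<epsilon> P \<and> opair t x \<epsilon> R \<longrightarrow> opair (c p t) (F p x) \<epsilon> R)" for R
  define e where "e = sep (prod K X) (\<lambda>q. \<forall>R. cl R \<longrightarrow> q \<epsilon> R)"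
  have e: "q \<epsilon> e \<longleftrightarrow> q \<epsilon> prod K X \<and> (\<forall>R. cl R \<longrightarrow> q \<epsilon> R)" for q
    unfolding e_def by (rule mem_sep) (unfold cl_def, intro defin definable_term_comp2[OF c] definable_term_comp2[OF F])
  have e_cl: "cl e" unfolding cl_def
  proof (intro conjI allI impI)
    show "opair z x0 \<epsilon> e" unfolding e using z x0 by (simp add: cl_def)
    fix p t x assume h: "p \<epsilon> P \<and> opair t x \<epsilon> e"
    then have "t \<epsilon> K" "x \<epsilon> X" unfolding e by simp_all
    then have "opair (c p t) (F p x) \<epsilon> prod K X" using h cK FX by simp
    moreover have "opair (c p t) (F p x) \<epsilon> R" if R: "cl R" for R
    proof -
      have "opair t x \<epsilon> R" using h R e by blast
      then show ?thesis using R h unfolding cl_def by blast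
    qed
    ultimately show "opair (c p t) (F p x) \<epsilon> e" unfolding e by blast
  qed
  have e_ind: "Q q" if q: "q \<epsilon> e" and Q: "definable (\<lambda>w. Q (w 0))" and base: "Q (opair z x0)"
    and step: "\<And>p t x. p \<epsilon> P \<Longrightarrow> opair t x \<epsilon> e \<Longrightarrow> Q (opair t x) \<Longrightarrow> Q (opair (c p t) (F p x))" for Q q
  proof -
    have s: "q \<epsilon> sep e Q \<longleftrightarrow> q \<epsilon> e \<and> Q q" for q by (rule mem_sep[OF Q])
    have "cl (sep e Q)" unfolding cl_def s using e_cl base step unfolding cl_def by blast
    then show ?thesis using q e s by blast
  qed
  have eKX: "t \<epsilon> K \<and> x \<epsilon> X" if "opair t x \<epsilon> e" for t x using that unfolding e by simp
  have inv: "q = opair z x0 \<or> (\<exists>p t x. p \<epsilon> P \<and> opair t x \<epsilon> e \<and> q = opair (c p t) (F p x))" if "q \<epsilon> e" for q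
  proof (rule e_ind[OF that])
    show "definable (\<lambda>w. w 0 = opair z x0 \<or> (\<exists>p t x. p \<epsilon> P \<and> opair t x \<epsilon> e \<and> w 0 = opair (c p t) (F p x)))"
      by (intro defin definable_term_comp2[OF c] definable_term_comp2[OF F])
  qed blast+
  have fn: "\<forall>y. opair (pfst q) y \<epsilon> e \<longrightarrow> y = psnd q" if "q \<epsilon> e" for q
  proof (rule e_ind[OF that])
    show "definable (\<lambda>w. \<forall>y. opair (pfst (w 0)) y \<epsilon> e \<longrightarrow> y = psnd (w 0))" by (intro defin)
    show "\<forall>y. opair (pfst (opair z x0)) y \<epsilon> e \<longrightarrow> y = psnd (opair z x0)"
    proof (intro allI impI)
      fix y assume "opair (pfst (opair z x0)) y \<epsilon> e"
      then have "opair z y \<epsilon> e" by simp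
      from inv[OF this] show "y = psnd (opair z x0)"
        using cK eKX by (metis opair_inject psnd_opair)
    qed
    fix p t x assume h: "p \<epsilon> P" "opair t x \<epsilon> e" "\<forall>y. opair (pfst (opair t x)) y \<epsilon> e \<longrightarrow> y = psnd (opair t x)"
    show "\<forall>y. opair (pfst (opair (c p t) (F p x))) y \<epsilon> e \<longrightarrow> y = psnd (opair (c p t) (F p x))"
    proof (intro allI impI)
      fix y assume "opair (pfst (opair (c p t) (F p x))) y \<epsilon> e"
      then have "opair (c p t) y \<epsilon> e" by simp
      from inv[OF this] have "\<exists>p' t' x'. p' \<epsilon> P \<and> opair t' x' \<epsilon> e \<and> opair (c p t) y = opair (c p' t') (F p' x')"
        using cK[OF h(1)] eKX[OF h(2)] opair_inject by blast
      then obtain p' t' x' where p': "p' \<epsilon> P" "opair t' x' \<epsilon> e" "c p t = c p' t'" "y = F p' x'" by auto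
      have "p = p' \<and> t = t'" using inj[OF h(1) _ p'(1) _ p'(3)] eKX h(2) p'(2) by blast
      then show "y = psnd (opair (c p t) (F p x))" using h(3) p' by simp
    qed
  qed
  define M where "M = sep X (\<lambda>x. \<exists>t. opair t x \<epsilon> e)"
  have M: "x \<epsilon> M \<longleftrightarrow> x \<epsilon> X \<and> (\<exists>t. opair t x \<epsilon> e)" for x
    unfolding M_def by (rule mem_sep) (intro defin)
  have "x \<epsilon> M" if "x \<epsilon> L" for x
  proof (rule gen[OF _ _ _ that])
    show "x0 \<epsilon> M" using M x0 e_cl unfolding cl_def by blast
    show "x \<epsilon> X" if "x \<epsilon> M" for x using that M by blast
    show "F p x \<epsilon> M" if "p \<epsilon> P" "x \<epsilon> M" for p x using that M FX e_cl unfolding cl_def by blast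
  qed
  then have "\<exists>t. t \<epsilon> K \<and> opair t x \<epsilon> e" if "x \<epsilon> L" for x using that M eKX by blast
  moreover have "definable (\<lambda>w. opair (w (Suc 0)) (w 0) \<epsilon> e)" by (intro defin)
  ultimately obtain f where f: "\<forall>x. x \<epsilon> L \<longrightarrow> app f x \<epsilon> K \<and> opair (app f x) x \<epsilon> e"
    using AC_select[OF AC, of "\<lambda>x t. opair t x \<epsilon> e" L K] by blast
  show ?thesis
  proof (rule lepollI[of "app f"])
    show "definable_fun (app f)" by (intro defin)
    show "app f x \<epsilon> K" if "x \<epsilon> L" for x using f that by blast
    show "x = y" if "x \<epsilon> L" "y \<epsilon> L" "app f x = app f y" for x y
    proof -
      have "opair (app f x) x \<epsilon> e" "opair (app f x) y \<epsilon> e" using f that by metis+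
      then have "y = psnd (opair (app f x) x)" using fn[of "opair (app f x) x"] by simp
      then show ?thesis by simp
    qed
  qed
qed

text \<open>The successor function of an enumeration of the pairs of natural numbers shell by shell,
  the \<open>k\<close>-th shell being \<open>(0,k), (1,k), \<dots>, (k,k), (k,k-1), \<dots>, (k,0)\<close>. It needs membership as the
  order and \<open>\<Union>\<close> as the predecessor, but no addition.\<close>
definition shell_step :: "'a \<Rightarrow> 'a" where
  "shell_step q = (if pfst q \<epsilon> psnd q then opair (succ (pfst q)) (psnd q)
     else if psnd q = emp then opair emp (succ (pfst q)) else opair (pfst q) (union (psnd q)))"

lemma union_succ: "ordinal n \<Longrightarrow> union (succ n) = n"
  using ordinal_trans by (intro ext) (auto)

lemma shell_step_in: "q \<epsilon> prod omega omega \<Longrightarrow> shell_step q \<epsilon> prod omega omega"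
proof -
  assume "q \<epsilon> prod omega omega"
  then obtain m n where q: "m \<epsilon> omega" "n \<epsilon> omega" "q = opair m n" unfolding mem_prod by blast
  have "union n \<epsilon> omega" if "n \<noteq> emp"
    using omega_cases[OF q(2)] that union_succ omega_ordinal by auto
  then show ?thesis using q unfolding shell_step_def by (simp add: succ_omega)
qed

lemma succ_mem_succ: "ordinal k \<Longrightarrow> succ i \<epsilon> k \<or> succ i = k \<Longrightarrow> i \<epsilon> k"
  using ordinal_trans by (metis mem_succ)

lemma shell_steps_reach_all:
  assumes z: "opair emp emp \<epsilon> M" and step: "\<And>q. q \<epsilon> M \<Longrightarrow> shell_step q \<epsilon> M"
    and m: "m \<epsilon> omega" and n: "n \<epsilon> omega"
  shows "opair m n \<epsilon> M"
proof -
  have up: "i \<epsilon> k \<or> i = k \<longrightarrow> opair i k \<epsilon> M" if k: "k \<epsilon> omega" "opair emp k \<epsilon> M" and i: "i \<epsilon> omega" for i k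
    using i
  proof (induction rule: omega_induct)
    case definable show ?case by (intro defin)
  next
    case emp show ?case using k by blast
  next
    case (succ i)
    show ?case
    proof
      assume "succ i \<epsilon> k \<or> succ i = k"
      then have i: "i \<epsilon> k" using succ_mem_succ omega_ordinal[OF k(1)] by blast
      then have "opair i k \<epsilon> M" using succ by blast
      from step[OF this] show "opair (succ i) k \<epsilon> M" using i unfolding shell_step_def by simp
    qed
  qed
  have down: "(i \<epsilon> k \<or> i = k) \<and> opair k i \<epsilon> M \<longrightarrow> (\<forall>j. j \<epsilon> i \<or> j = i \<longrightarrow> opair k j \<epsilon> M)" if k: "k \<epsilon> omega" and i: "i \<epsilon> omega" for i k
    using i
  proof (induction rule: omega_induct)
    case definable show ?case by (intro defin)
  next
    case emp show ?case by simp
  next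
    case (succ i)
    show ?case
    proof (intro impI allI)
      fix j assume h: "(succ i \<epsilon> k \<or> succ i = k) \<and> opair k (succ i) \<epsilon> M" and j: "j \<epsilon> succ i \<or> j = succ i"
      have i: "i \<epsilon> k" using succ_mem_succ omega_ordinal[OF k] h by blast
      have "\<not> k \<epsilon> succ i" using i mem_asym[OF i] mem_irrefl by (metis mem_succ)
      then have "opair k i \<epsilon> M" using step[of "opair k (succ i)"] h union_succ[OF omega_ordinal[OF succ(1)]] succ_not_emp
        unfolding shell_step_def by simp
      then show "opair k j \<epsilon> M" using succ(2) i j h by (metis mem_succ)
    qed
  qed
  have bottom: "opair emp k \<epsilon> M" if "k \<epsilon> omega" for k
    using that
  proof (induction rule: omega_induct)
    case definable show ?case by (intro defin)
  next
    case emp show ?case by (rule z)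
  next
    case (succ k)
    have "opair k k \<epsilon> M" using up[OF succ(1,2) succ(1)] by blast
    then have "\<forall>j. j \<epsilon> k \<or> j = k \<longrightarrow> opair k j \<epsilon> M" using down[OF succ(1) succ(1)] by blast
    moreover have "emp \<epsilon> k \<or> emp = k"
      using ordinal_linear[OF ordinal_emp omega_ordinal[OF succ(1)]] by auto
    ultimately have "opair k emp \<epsilon> M" by blast
    from step[OF this] show ?case unfolding shell_step_def by simp
  qed
  have "m \<epsilon> n \<or> m = n \<or> n \<epsilon> m" using ordinal_linear omega_ordinal m n by blast
  moreover have "opair m m \<epsilon> M" using up[OF m bottom[OF m] m] by blast
  ultimately show ?thesis using up[OF n bottom[OF n] m] down[OF m m] by blast
qed

text \<open>The natural number \<open>n\<close> codes the \<open>n\<close>-fold application of \<open>shell_step\<close> to \<open>(0,0)\<close>; there is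
  a single, dummy, operation index.\<close>
lemma omega_square_lepoll: "AC E \<Longrightarrow> lepoll (prod omega omega) omega"
proof (rule generated_lepoll[of "\<lambda>p t. succ t" "\<lambda>p q. shell_step q" emp omega "sing emp" "opair emp emp" "prod omega omega"])
  show "definable_term (\<lambda>w. succ (w (Suc 0)))" by (intro defin)
  show "definable_term (\<lambda>w. shell_step (w (Suc 0)))" unfolding shell_step_def by (intro defin)
  show "p = p' \<and> t = t'" if "p \<epsilon> sing emp" "p' \<epsilon> sing emp" "succ t = succ t'" for p p' t t'
    using that succ_inject by simp
  show "x \<epsilon> M" if M: "opair emp emp \<epsilon> M" "\<And>p x. p \<epsilon> sing emp \<Longrightarrow> x \<epsilon> M \<Longrightarrow> shell_step x \<epsilon> M"
    and x: "x \<epsilon> prod omega omega" for M x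
  proof -
    obtain m n where "m \<epsilon> omega" "n \<epsilon> omega" "x = opair m n" using x unfolding mem_prod by blast
    then show ?thesis using shell_steps_reach_all[OF M(1)] M(2) by auto
  qed
qed (simp_all add: succ_omega succ_not_emp shell_step_in)

definition partial_injection :: "'a \<Rightarrow> bool" where
  "partial_injection f \<longleftrightarrow> (\<forall>x y x' y'. opair x y \<epsilon> f \<and> opair x' y' \<epsilon> f \<longrightarrow> (x = x' \<longleftrightarrow> y = y'))"

lemma definable_partial_injection [defin]: "definable_term f \<Longrightarrow> definable (\<lambda>v. partial_injection (f v))"
  apply (rule definable_comp1[of partial_injection])
  unfolding partial_injection_def by (intro defin)

lemma partial_injection_union:
  assumes "chain C" "\<And>f. f \<epsilon> C \<Longrightarrow> partial_injection f"
  shows "partial_injection (union C)"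
  unfolding partial_injection_def
proof (intro allI impI)
  fix x y x' y' assume "opair x y \<epsilon> union C \<and> opair x' y' \<epsilon> union C"
  then obtain f g where fg: "f \<epsilon> C" "g \<epsilon> C" "opair x y \<epsilon> f" "opair x' y' \<epsilon> g" by auto
  then have "sub f g \<or> sub g f" using assms(1) unfolding chain_def by blast
  then obtain h where "h \<epsilon> C" "opair x y \<epsilon> h" "opair x' y' \<epsilon> h" using fg unfolding sub_def by blast
  then show "x = x' \<longleftrightarrow> y = y'" using assms(2) unfolding partial_injection_def by blast
qed

lemma partial_injection_app:
  "partial_injection f \<Longrightarrow> opair x y \<epsilon> f \<Longrightarrow> app f x = y"
  unfolding partial_injection_def by (rule app_eq) blast+

lemma partial_injection_lepoll:
  assumes f: "partial_injection f" "\<And>x. x \<epsilon> A \<Longrightarrow> \<exists>y. y \<epsilon> B \<and> opair x y \<epsilon> f"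
  shows "lepoll A B"
proof (rule lepollI[of "app f"])
  show "definable_fun (app f)" by (intro defin)
  show "app f x \<epsilon> B" if "x \<epsilon> A" for x using f(2)[OF that] partial_injection_app[OF f(1)] by auto
  show "x = y" if "x \<epsilon> A" "y \<epsilon> A" "app f x = app f y" for x y
    using f(2)[OF that(1)] f(2)[OF that(2)] partial_injection_app[OF f(1)] that(3) f(1)
    unfolding partial_injection_def by metis
qed

lemma partial_injection_converse:
  assumes "partial_injection f"
  obtains g where "partial_injection g" "\<forall>x y. opair x y \<epsilon> g \<longleftrightarrow> opair y x \<epsilon> f"
proof -
  define g where "g = img (sep f (\<lambda>p. \<exists>x y. p = opair x y)) (\<lambda>p. opair (psnd p) (pfst p))"
  have s: "q \<epsilon> sep f (\<lambda>p. \<exists>x y. p = opair x y) \<longleftrightarrow> q \<epsilon> f \<and> (\<exists>x y. q = opair x y)" for q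
    by (rule mem_sep) (intro defin)
  have "q \<epsilon> g \<longleftrightarrow> (\<exists>p. p \<epsilon> sep f (\<lambda>p. \<exists>x y. p = opair x y) \<and> q = opair (psnd p) (pfst p))" for q
    unfolding g_def by (rule mem_img) (intro defin)
  then have g: "opair x y \<epsilon> g \<longleftrightarrow> opair y x \<epsilon> f" for x y unfolding s by auto
  moreover have "partial_injection g" using assms unfolding partial_injection_def g by blast
  ultimately show thesis using that by blast
qed

lemma partial_injection_insert:
  assumes "partial_injection f" "\<not> (\<exists>y. opair a y \<epsilon> f)" "\<not> (\<exists>x. opair x b \<epsilon> f)"
  shows "partial_injection (un f (sing (opair a b)))"
  using assms unfolding partial_injection_def by auto

text \<open>A maximal partial injection between \<open>A\<close> and \<open>B\<close> is total or surjective.\<close>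
lemma lepoll_total:
  assumes "AC E" shows "lepoll A B \<or> lepoll B A"
proof -
  define F where "F = sep (pow (prod A B)) partial_injection"
  have F: "f \<epsilon> F \<longleftrightarrow> (\<forall>p. p \<epsilon> f \<longrightarrow> p \<epsilon> prod A B) \<and> partial_injection f" for f
    unfolding F_def by (subst mem_sep) (intro defin, simp)
  have "\<exists>m. m \<epsilon> F \<and> sub emp m \<and> (\<forall>x. x \<epsilon> F \<and> sub m x \<longrightarrow> x = m)"
  proof (rule zorn[OF assms])
    show "emp \<epsilon> F" unfolding F partial_injection_def by simp
    show "union C \<epsilon> F" if "\<And>x. x \<epsilon> C \<Longrightarrow> x \<epsilon> F" "chain C" for C
      using that partial_injection_union[OF that(2)] unfolding F mem_union by blast
  qed
  then obtain m where m: "m \<epsilon> F" "\<And>x. x \<epsilon> F \<Longrightarrow> sub m x \<Longrightarrow> x = m" by blast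
  have pm: "partial_injection m" and mAB: "\<And>x y. opair x y \<epsilon> m \<Longrightarrow> x \<epsilon> A \<and> y \<epsilon> B"
    using m(1) F opair_mem_prod by blast+
  show ?thesis
  proof (cases "\<forall>x. x \<epsilon> A \<longrightarrow> (\<exists>y. opair x y \<epsilon> m)")
    case True
    then have "lepoll A B" using mAB by (intro partial_injection_lepoll[OF pm]) blast
    then show ?thesis ..
  next
    case False
    then obtain a where a: "a \<epsilon> A" "\<not> (\<exists>y. opair a y \<epsilon> m)" by blast
    obtain g where g: "partial_injection g" "\<forall>x y. opair x y \<epsilon> g \<longleftrightarrow> opair y x \<epsilon> m"
      by (rule partial_injection_converse[OF pm])
    have "\<exists>x. opair x b \<epsilon> m" if b: "b \<epsilon> B" for b
    proof (rule ccontr)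
      assume nb: "\<not> ?thesis"
      have "un m (sing (opair a b)) \<epsilon> F"
        using partial_injection_insert[OF pm a(2) nb] m(1) a b unfolding F by auto
      then have "un m (sing (opair a b)) = m" using m(2) unfolding sub_def by simp
      then have "opair a b \<epsilon> m" using mem_un mem_sing by metis
      then show False using a(2) by blast
    qed
    then have "lepoll B A" using mAB g by (intro partial_injection_lepoll[OF g(1)]) blast
    then show ?thesis ..
  qed
qed

text \<open>An ordinal that does not inject into \<open>S\<close> must receive an injection from \<open>S\<close>.\<close>
lemma well_orderable:
  assumes "AC E" shows "\<exists>W. ordinal W \<and> lepoll S W"
  using hartogs[of S] lepoll_total[OF assms] by blast

text \<open>Consider a maximal injection into \<open>S\<close> from an initial segment of the natural numbers. If
  its domain were a natural number, it would be onto \<open>S\<close> by maximality, and \<open>S\<close> would be finite.\<close>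
lemma omega_lepoll_infinite:
  assumes AC: "AC E" and inf: "\<not> finite_in E S"
  shows "lepoll omega S"
proof (rule ccontr)
  assume contr: "\<not> ?thesis"
  define I where "I f \<longleftrightarrow> (\<forall>x y x'. opair x y \<epsilon> f \<and> x' \<epsilon> x \<longrightarrow> (\<exists>y'. opair x' y' \<epsilon> f))" for f
  define F where "F = sep (pow (prod omega S)) (\<lambda>f. partial_injection f \<and> I f)"
  have F: "f \<epsilon> F \<longleftrightarrow> (\<forall>p. p \<epsilon> f \<longrightarrow> p \<epsilon> prod omega S) \<and> partial_injection f \<and> I f" for f
    unfolding F_def by (subst mem_sep) (unfold I_def, intro defin, simp)
  have "\<exists>m. m \<epsilon> F \<and> sub emp m \<and> (\<forall>x. x \<epsilon> F \<and> sub m x \<longrightarrow> x = m)"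
  proof (rule zorn[OF AC])
    show "emp \<epsilon> F" unfolding F partial_injection_def I_def by simp
    show "union C \<epsilon> F" if C: "\<And>x. x \<epsilon> C \<Longrightarrow> x \<epsilon> F" "chain C" for C
    proof -
      have "partial_injection (union C)" using C by (intro partial_injection_union) (auto simp: F)
      moreover have "I (union C)" using C(1) unfolding F I_def mem_union by blast
      moreover have "p \<epsilon> prod omega S" if "p \<epsilon> union C" for p using that C(1) unfolding F mem_union by blast
      ultimately show ?thesis unfolding F by blast
    qed
  qed
  then obtain m where m: "m \<epsilon> F" "\<And>x. x \<epsilon> F \<Longrightarrow> sub m x \<Longrightarrow> x = m" by blast
  have pm: "partial_injection m" and Im: "I m" and mS: "\<And>x y. opair x y \<epsilon> m \<Longrightarrow> x \<epsilon> omega \<and> y \<epsilon> S"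
    using m(1) F opair_mem_prod by blast+
  define D where "D = sep omega (\<lambda>x. \<not> (\<exists>y. opair x y \<epsilon> m))"
  have D: "x \<epsilon> D \<longleftrightarrow> x \<epsilon> omega \<and> \<not> (\<exists>y. opair x y \<epsilon> m)" for x
    unfolding D_def by (rule mem_sep) (intro defin)
  have "\<exists>x. x \<epsilon> D"
  proof (rule ccontr)
    assume "\<not> ?thesis"
    then have "lepoll omega S" using D mS by (intro partial_injection_lepoll[OF pm]) blast
    then show False using contr by blast
  qed
  then obtain n where n: "n \<epsilon> D" "\<And>x. x \<epsilon> n \<Longrightarrow> \<not> x \<epsilon> D" using foundation by blast
  then have n\<omega>: "n \<epsilon> omega" and n_dom: "\<not> (\<exists>y. opair n y \<epsilon> m)" unfolding D by blast+
  have dom: "x \<epsilon> n \<longleftrightarrow> (\<exists>y. opair x y \<epsilon> m)" for x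
  proof
    assume "x \<epsilon> n"
    then show "\<exists>y. opair x y \<epsilon> m" using n(2) D omega_trans[OF n\<omega>] by blast
  next
    assume "\<exists>y. opair x y \<epsilon> m"
    then obtain y where y: "opair x y \<epsilon> m" by blast
    then have "x \<epsilon> omega" using mS by blast
    moreover have "x \<noteq> n" using y n_dom by blast
    moreover have "\<not> n \<epsilon> x" using y n_dom Im unfolding I_def by blast
    ultimately show "x \<epsilon> n" using ordinal_linear omega_ordinal n\<omega> by blast
  qed
  show False
  proof (cases "\<forall>s. s \<epsilon> S \<longrightarrow> (\<exists>x. opair x s \<epsilon> m)")
    case True
    obtain g where g: "partial_injection g" "\<forall>x y. opair x y \<epsilon> g \<longleftrightarrow> opair y x \<epsilon> m"
      by (rule partial_injection_converse[OF pm])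
    have g_app: "app g s = x" if "opair x s \<epsilon> m" for x s
      using partial_injection_app[OF g(1)] g(2) that by blast
    have "bij_betw (app g) (elts S) (elts n)"
    proof (rule bij_betwI')
      fix s t assume "s \<in> elts S" "t \<in> elts S"
      then obtain x y where xy: "opair x s \<epsilon> m" "opair y t \<epsilon> m" using True unfolding mem_elts by blast
      then show "app g s = app g t \<longleftrightarrow> s = t" using g_app pm unfolding partial_injection_def by metis
    next
      fix s assume "s \<in> elts S"
      then obtain x where "opair x s \<epsilon> m" using True unfolding mem_elts by blast
      then show "app g s \<in> elts n" using g_app dom by auto
    next
      fix x assume "x \<in> elts n"
      then obtain s where "opair x s \<epsilon> m" using dom by auto
      then show "\<exists>s\<in>elts S. x = app g s" using g_app mS by (metis mem_elts)
    qed
    then have "is_bijection E (lam S (app g)) S n" by (intro is_bijection_lam) (intro defin)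
    then show False using inf n\<omega> unfolding finite_in_def mem_omega by blast
  next
    case False
    then obtain s where s: "s \<epsilon> S" "\<not> (\<exists>x. opair x s \<epsilon> m)" by blast
    have "I (un m (sing (opair n s)))"
      using Im dom unfolding I_def by simp blast
    then have "un m (sing (opair n s)) \<epsilon> F"
      using partial_injection_insert[OF pm n_dom s(2)] m(1) n\<omega> s(1) unfolding F by auto
    then have "un m (sing (opair n s)) = m" using m(2) unfolding sub_def by simp
    then have "opair n s \<epsilon> m" using mem_un mem_sing by metis
    then show False using s(2) by blast
  qed
qed

lemma ex_mem_prod: "(\<exists>q. q \<epsilon> prod A B \<and> P q) \<longleftrightarrow> (\<exists>x y. x \<epsilon> A \<and> y \<epsilon> B \<and> P (opair x y))"
  unfolding mem_prod by blast

lemma prod_lepoll_mono: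
  assumes "lepoll A A'" "lepoll B B'" shows "lepoll (prod A B) (prod A' B')"
proof -
  obtain F where F: "definable_fun F" "\<forall>x. x \<epsilon> A \<longrightarrow> F x \<epsilon> A'" "\<forall>x y. x \<epsilon> A \<longrightarrow> y \<epsilon> A \<longrightarrow> F x = F y \<longrightarrow> x = y"
    using assms(1) by (rule lepollE)
  obtain G where G: "definable_fun G" "\<forall>x. x \<epsilon> B \<longrightarrow> G x \<epsilon> B'" "\<forall>x y. x \<epsilon> B \<longrightarrow> y \<epsilon> B \<longrightarrow> G x = G y \<longrightarrow> x = y"
    using assms(2) by (rule lepollE)
  show ?thesis
  proof (rule lepollI[of "\<lambda>p. opair (F (pfst p)) (G (psnd p))"])
    show "definable_fun (\<lambda>p. opair (F (pfst p)) (G (psnd p)))"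
      by (intro defin definable_term_comp1[OF F(1)] definable_term_comp1[OF G(1)])
    show "opair (F (pfst p)) (G (psnd p)) \<epsilon> prod A' B'" if "p \<epsilon> prod A B" for p
      using that F(2) G(2) unfolding mem_prod[of _ A B] by auto
    show "p = q" if pq: "p \<epsilon> prod A B" "q \<epsilon> prod A B" "opair (F (pfst p)) (G (psnd p)) = opair (F (pfst q)) (G (psnd q))" for p q
    proof -
      obtain x y x' y' where "x \<epsilon> A" "y \<epsilon> B" "p = opair x y" "x' \<epsilon> A" "y' \<epsilon> B" "q = opair x' y'"
        using pq unfolding mem_prod by blast
      moreover from this have "F x = F x'" "G y = G y'" using pq(3) by simp_all
      ultimately show ?thesis using F(3) G(3) by metis
    qed
  qed
qed

text \<open>The disjoint union of two copies of \<open>A\<close> sits in \<open>A \<times> A\<close> as \<open>(A \<times> {a0}) \<union> (A \<times> {a1})\<close>.\<close>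
lemma union_lepoll:
  assumes A2: "lepoll (prod A A) A" and a: "a0 \<epsilon> A" "a1 \<epsilon> A" "a0 \<noteq> a1"
    and X: "\<And>x. x \<epsilon> X \<Longrightarrow> x \<epsilon> A \<or> x \<epsilon> B" and B: "lepoll B A"
  shows "lepoll X A"
proof -
  obtain F where F: "definable_fun F" "\<forall>x. x \<epsilon> B \<longrightarrow> F x \<epsilon> A" "\<forall>x y. x \<epsilon> B \<longrightarrow> y \<epsilon> B \<longrightarrow> F x = F y \<longrightarrow> x = y"
    using B by (rule lepollE)
  define G where "G x = (if x \<epsilon> A then opair x a0 else opair (F x) a1)" for x
  have "lepoll X (prod A A)"
  proof (rule lepollI[of G])
    show "definable_fun G" unfolding G_def by (intro defin definable_term_comp1[OF F(1)])
    show "G x \<epsilon> prod A A" if "x \<epsilon> X" for x using X[OF that] F(2) a unfolding G_def by auto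
    show "x = y" if "x \<epsilon> X" "y \<epsilon> X" "G x = G y" for x y
      using X[OF that(1)] X[OF that(2)] that(3) F(3) a(3) unfolding G_def by (auto split: if_splits)
  qed
  then show ?thesis using A2 lepoll_trans by blast
qed

text \<open>Take a maximal injection \<open>m\<close> of the form \<open>A \<times> A \<rightarrow> A\<close> with \<open>A \<subseteq> S\<close>, extending one on a
  countable set. If \<open>A\<close> injects into \<open>S - A\<close>, with image \<open>B\<close>, then all of \<open>(A \<union> B) \<times> (A \<union> B)\<close>
  injects into \<open>B\<close>, and using such an injection outside \<open>A \<times> A\<close> extends \<open>m\<close>. So \<open>S - A\<close> injects
  into \<open>A\<close>, and therefore so does \<open>S\<close>.\<close>
lemma square_lepoll:
  assumes AC: "AC E" and S: "lepoll omega S"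
  shows "lepoll (prod S S) S"
proof -
  \<comment> \<open>The set \<open>A\<close> is recovered from the injection as the set of \<open>x\<close> with \<open>(x,x)\<close> in its
    domain, so that extension of injections is plain inclusion and Zorn's lemma applies to a
    family of sets.\<close>
  define fld where "fld \<pi> x \<longleftrightarrow> (\<exists>z. opair (opair x x) z \<epsilon> \<pi>)" for \<pi> x
  define good where "good \<pi> \<longleftrightarrow> partial_injection \<pi> \<and>
    (\<forall>x y. fld \<pi> x \<and> fld \<pi> y \<longrightarrow> (\<exists>z. opair (opair x y) z \<epsilon> \<pi>)) \<and>
    (\<forall>x y z. opair (opair x y) z \<epsilon> \<pi> \<longrightarrow> fld \<pi> x \<and> fld \<pi> y \<and> fld \<pi> z)" for \<pi>
  define F where "F = sep (pow (prod (prod S S) S)) good"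
  have F: "\<pi> \<epsilon> F \<longleftrightarrow> (\<forall>p. p \<epsilon> \<pi> \<longrightarrow> p \<epsilon> prod (prod S S) S) \<and> good \<pi>" for \<pi>
    unfolding F_def by (subst mem_sep) (unfold good_def fld_def, intro defin, simp)
  obtain G where G: "definable_fun G" "\<forall>x. x \<epsilon> omega \<longrightarrow> G x \<epsilon> S" "\<forall>x y. x \<epsilon> omega \<longrightarrow> y \<epsilon> omega \<longrightarrow> G x = G y \<longrightarrow> x = y"
    using S by (rule lepollE)
  obtain J where J: "definable_fun J" "\<forall>x. x \<epsilon> prod omega omega \<longrightarrow> J x \<epsilon> omega"
    "\<forall>x y. x \<epsilon> prod omega omega \<longrightarrow> y \<epsilon> prod omega omega \<longrightarrow> J x = J y \<longrightarrow> x = y"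
    using omega_square_lepoll[OF AC] by (rule lepollE)
  define \<pi>0 where "\<pi>0 = img (prod omega omega) (\<lambda>q. opair (opair (G (pfst q)) (G (psnd q))) (G (J q)))"
  have \<pi>0: "p \<epsilon> \<pi>0 \<longleftrightarrow> (\<exists>m n. m \<epsilon> omega \<and> n \<epsilon> omega \<and> p = opair (opair (G m) (G n)) (G (J (opair m n))))" for p
  proof -
    have "p \<epsilon> \<pi>0 \<longleftrightarrow> (\<exists>q. q \<epsilon> prod omega omega \<and> p = opair (opair (G (pfst q)) (G (psnd q))) (G (J q)))"
      unfolding \<pi>0_def by (rule mem_img) (intro defin definable_term_comp1[OF G(1)] definable_term_comp1[OF J(1)])
    then show ?thesis unfolding ex_mem_prod pfst_opair psnd_opair .
  qed
  have fld0: "fld \<pi>0 x \<longleftrightarrow> (\<exists>n. n \<epsilon> omega \<and> x = G n)" for x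
    unfolding fld_def \<pi>0 by (auto)
  have J\<omega>: "J (opair m n) \<epsilon> omega" if "m \<epsilon> omega" "n \<epsilon> omega" for m n using J(2) that by simp
  have "partial_injection \<pi>0"
    unfolding partial_injection_def
  proof (intro allI impI)
    fix p y p' y' assume "opair p y \<epsilon> \<pi>0 \<and> opair p' y' \<epsilon> \<pi>0"
    then obtain m n m' n' where h: "m \<epsilon> omega" "n \<epsilon> omega" "m' \<epsilon> omega" "n' \<epsilon> omega"
      "p = opair (G m) (G n)" "y = G (J (opair m n))" "p' = opair (G m') (G n')" "y' = G (J (opair m' n'))"
      unfolding \<pi>0 opair_inject by blast
    have "y = y' \<longleftrightarrow> J (opair m n) = J (opair m' n')" using G(3) J\<omega> h by metis
    also have "\<dots> \<longleftrightarrow> opair m n = opair m' n'" using J(3) h opair_mem_prod by metis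
    also have "\<dots> \<longleftrightarrow> p = p'" using G(3) h opair_inject by metis
    finally show "p = p' \<longleftrightarrow> y = y'" by blast
  qed
  moreover have "\<exists>z. opair (opair x y) z \<epsilon> \<pi>0" if "fld \<pi>0 x" "fld \<pi>0 y" for x y
    using that unfolding fld0 \<pi>0 by auto
  moreover have "fld \<pi>0 x \<and> fld \<pi>0 y \<and> fld \<pi>0 z" if "opair (opair x y) z \<epsilon> \<pi>0" for x y z
    using that J\<omega> unfolding fld0 \<pi>0 by auto
  ultimately have "good \<pi>0" unfolding good_def by blast
  moreover have "p \<epsilon> prod (prod S S) S" if "p \<epsilon> \<pi>0" for p using that G(2) J\<omega> unfolding \<pi>0 by auto
  ultimately have "\<pi>0 \<epsilon> F" unfolding F by blast
  have "\<exists>m. m \<epsilon> F \<and> sub \<pi>0 m \<and> (\<forall>x. x \<epsilon> F \<and> sub m x \<longrightarrow> x = m)"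
  proof (rule zorn[OF AC \<open>\<pi>0 \<epsilon> F\<close>])
    fix C assume C: "\<And>x. x \<epsilon> C \<Longrightarrow> x \<epsilon> F" "chain C"
    then have good: "\<And>x. x \<epsilon> C \<Longrightarrow> good x" unfolding F by blast
    have fldU: "fld (union C) x \<longleftrightarrow> (\<exists>f. f \<epsilon> C \<and> fld f x)" for x unfolding fld_def mem_union by blast
    have "partial_injection (union C)" using C good by (intro partial_injection_union) (auto simp: good_def)
    moreover have "\<exists>z. opair (opair x y) z \<epsilon> union C" if xy: "fld (union C) x" "fld (union C) y" for x y
    proof -
      obtain f g where fg: "f \<epsilon> C" "g \<epsilon> C" "fld f x" "fld g y" using xy fldU by blast
      then have "sub f g \<or> sub g f" using C(2) unfolding chain_def by blast
      then obtain h where h: "h \<epsilon> C" "fld h x" "fld h y" using fg unfolding sub_def fld_def by blast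
      then have "\<exists>z. opair (opair x y) z \<epsilon> h" using good unfolding good_def by blast
      then show ?thesis using h(1) unfolding mem_union by blast
    qed
    moreover have "fld (union C) x \<and> fld (union C) y \<and> fld (union C) z" if "opair (opair x y) z \<epsilon> union C" for x y z
      using that good unfolding fldU mem_union good_def by blast
    ultimately have "good (union C)" unfolding good_def by blast
    moreover have "p \<epsilon> prod (prod S S) S" if "p \<epsilon> union C" for p using that C(1) unfolding F mem_union by blast
    ultimately show "union C \<epsilon> F" unfolding F by blast
  qed
  then obtain m where m: "m \<epsilon> F" "sub \<pi>0 m" "\<And>x. x \<epsilon> F \<Longrightarrow> sub m x \<Longrightarrow> x = m" by blast
  then have gm: "good m" and mS: "\<And>x y z. opair (opair x y) z \<epsilon> m \<Longrightarrow> x \<epsilon> S \<and> y \<epsilon> S \<and> z \<epsilon> S"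
    using F by (blast, metis opair_mem_prod)
  define A where "A = sep S (fld m)"
  have dfld: "definable (\<lambda>w. fld m (w 0))" unfolding fld_def by (intro defin)
  have A: "x \<epsilon> A \<longleftrightarrow> fld m x" for x
    using mem_sep[OF dfld] mS unfolding A_def fld_def by blast
  have AS: "x \<epsilon> S" if "x \<epsilon> A" for x using that mS unfolding A fld_def by blast
  have pm: "partial_injection m" using gm unfolding good_def by blast
  have m_dom: "\<exists>z. opair (opair x y) z \<epsilon> m" if "x \<epsilon> A" "y \<epsilon> A" for x y
    using gm that unfolding good_def A by blast
  have m_in: "x \<epsilon> A \<and> y \<epsilon> A \<and> z \<epsilon> A" if "opair (opair x y) z \<epsilon> m" for x y z
    using gm that unfolding good_def A by blast
  have A2: "lepoll (prod A A) A"
  proof (rule partial_injection_lepoll[OF pm])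
    fix p assume "p \<epsilon> prod A A"
    then obtain x y where "x \<epsilon> A" "y \<epsilon> A" "p = opair x y" unfolding mem_prod by blast
    then show "\<exists>z. z \<epsilon> A \<and> opair p z \<epsilon> m" using m_dom m_in by blast
  qed
  have GA: "G n \<epsilon> A" if "n \<epsilon> omega" for n
  proof -
    have "fld \<pi>0 (G n)" using that fld0 by blast
    then show ?thesis using m(2) unfolding A fld_def sub_def by blast
  qed
  define a0 a1 where "a0 = G emp" and "a1 = G (succ emp)"
  have a: "a0 \<epsilon> A" "a1 \<epsilon> A" "a0 \<noteq> a1"
    using GA G(3) succ_not_emp[of emp] succ_omega[OF emp_omega] emp_omega unfolding a0_def a1_def by metis+
  define D where "D = sep S (\<lambda>x. \<not> x \<epsilon> A)"
  have D: "x \<epsilon> D \<longleftrightarrow> x \<epsilon> S \<and> \<not> x \<epsilon> A" for x unfolding D_def by (rule mem_sep) (intro defin)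
  have "\<not> lepoll A D"
  proof
    assume "lepoll A D"
    then obtain H where H: "definable_fun H" "\<forall>x. x \<epsilon> A \<longrightarrow> H x \<epsilon> D" "\<forall>x y. x \<epsilon> A \<longrightarrow> y \<epsilon> A \<longrightarrow> H x = H y \<longrightarrow> x = y"
      by (rule lepollE)
    define B where "B = img A H"
    have B: "y \<epsilon> B \<longleftrightarrow> (\<exists>x. x \<epsilon> A \<and> y = H x)" for y unfolding B_def by (rule mem_img[OF H(1)])
    have AB: "lepoll A B" by (rule lepollI[OF H(1)]) (use B H in blast)+
    have BA: "lepoll B A"
    proof -
      have "partial_injection (lam A H)"
        using H(3) unfolding partial_injection_def mem_lam[OF H(1)] by auto
      then obtain g where g: "partial_injection g" "\<forall>x y. opair x y \<epsilon> g \<longleftrightarrow> opair y x \<epsilon> lam A H"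
        by (rule partial_injection_converse)
      show ?thesis by (rule partial_injection_lepoll[OF g(1)]) (use g(2) B in \<open>auto simp: mem_lam[OF H(1)]\<close>)
    qed
    define U where "U = un A B"
    have "lepoll U A" by (rule union_lepoll[OF A2 a _ BA]) (simp add: U_def)
    then have "lepoll (prod U U) B"
      using prod_lepoll_mono A2 AB lepoll_trans by meson
    then obtain Q where Q: "definable_fun Q" "\<forall>x. x \<epsilon> prod U U \<longrightarrow> Q x \<epsilon> B"
      "\<forall>x y. x \<epsilon> prod U U \<longrightarrow> y \<epsilon> prod U U \<longrightarrow> Q x = Q y \<longrightarrow> x = y"
      by (rule lepollE)
    \<comment> \<open>The new pairs get their values in \<open>B\<close>, hence outside the range of \<open>m\<close>.\<close>
    define N where "N = sep (prod U U) (\<lambda>p. \<not> p \<epsilon> prod A A)"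
    have N: "p \<epsilon> N \<longleftrightarrow> p \<epsilon> prod U U \<and> \<not> p \<epsilon> prod A A" for p unfolding N_def by (rule mem_sep) (intro defin)
    define m' where "m' = un m (lam N Q)"
    have m': "opair p z \<epsilon> m' \<longleftrightarrow> opair p z \<epsilon> m \<or> (p \<epsilon> N \<and> z = Q p)" for p z
      unfolding m'_def by (auto simp: mem_lam[OF Q(1)])
    have BD: "x \<epsilon> S \<and> \<not> x \<epsilon> A" if xB: "x \<epsilon> B" for x
    proof -
      obtain y where "y \<epsilon> A" "x = H y" using xB unfolding B by blast
      then have "x \<epsilon> D" using H(2) by simp
      then show ?thesis unfolding D .
    qed
    have m_prod: "p \<epsilon> prod A A \<and> z \<epsilon> A" if "opair p z \<epsilon> m" for p z
    proof -
      have "opair p z \<epsilon> prod (prod S S) S" using that m(1) F by blast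
      then obtain x y where "p = opair x y" using opair_mem_prod mem_prod by metis
      then show ?thesis using m_in that by simp
    qed
    have QB: "Q p \<epsilon> B" "p \<epsilon> prod U U" "\<not> p \<epsilon> prod A A" if "p \<epsilon> N" for p using that Q(2) N by blast+
    have "partial_injection m'"
      unfolding partial_injection_def
    proof (intro allI impI)
      fix p z p' z' assume h: "opair p z \<epsilon> m' \<and> opair p' z' \<epsilon> m'"
      then have "opair p z \<epsilon> m \<or> (p \<epsilon> N \<and> z = Q p)" "opair p' z' \<epsilon> m \<or> (p' \<epsilon> N \<and> z' = Q p')"
        using m' by blast+
      then consider "opair p z \<epsilon> m" "opair p' z' \<epsilon> m" | "opair p z \<epsilon> m" "p' \<epsilon> N" "z' = Q p'"
        | "p \<epsilon> N" "z = Q p" "opair p' z' \<epsilon> m" | "p \<epsilon> N" "z = Q p" "p' \<epsilon> N" "z' = Q p'" by blast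
      then show "p = p' \<longleftrightarrow> z = z'"
      proof cases
        case 1 then show ?thesis using pm unfolding partial_injection_def by blast
      next
        case 2 then show ?thesis using m_prod[OF 2(1)] QB[OF 2(2)] BD by metis
      next
        case 3 then show ?thesis using m_prod[OF 3(3)] QB[OF 3(1)] BD by metis
      next
        case 4 then show ?thesis using Q(3) QB(2)[OF 4(1)] QB(2)[OF 4(3)] by metis
      qed
    qed
    moreover have fld': "fld m' x \<longleftrightarrow> x \<epsilon> U" for x
    proof
      assume "fld m' x"
      then obtain z where "opair (opair x x) z \<epsilon> m'" unfolding fld_def by blast
      then have "opair x x \<epsilon> prod A A \<or> opair x x \<epsilon> prod U U" using m' m_prod QB by blast
      then show "x \<epsilon> U" by (auto simp: U_def)
    next
      assume x: "x \<epsilon> U"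
      show "fld m' x"
      proof (cases "x \<epsilon> A")
        case True
        then show ?thesis using m_dom m' unfolding fld_def by blast
      next
        case False
        then have "opair x x \<epsilon> N" using x N by simp
        then show ?thesis using m' unfolding fld_def by blast
      qed
    qed
    moreover have "\<exists>z. opair (opair x y) z \<epsilon> m'" if xy: "x \<epsilon> U" "y \<epsilon> U" for x y
    proof (cases "x \<epsilon> A \<and> y \<epsilon> A")
      case True
      then show ?thesis using m_dom m' by blast
    next
      case False
      then have "opair x y \<epsilon> N" using xy N by simp
      then show ?thesis using m' by blast
    qed
    moreover have "x \<epsilon> U \<and> y \<epsilon> U \<and> z \<epsilon> U" if h: "opair (opair x y) z \<epsilon> m'" for x y z
    proof -
      have "opair (opair x y) z \<epsilon> m \<or> (opair x y \<epsilon> N \<and> z = Q (opair x y))" using h m' by blast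
      then show ?thesis
      proof
        assume "opair (opair x y) z \<epsilon> m"
        then show ?thesis using m_in by (simp add: U_def)
      next
        assume "opair x y \<epsilon> N \<and> z = Q (opair x y)"
        then show ?thesis using QB[of "opair x y"] by (simp add: U_def)
      qed
    qed
    ultimately have "good m'" unfolding good_def by blast
    moreover have "p \<epsilon> prod (prod S S) S" if "p \<epsilon> m'" for p
    proof -
      have US: "x \<epsilon> S" if "x \<epsilon> U" for x using that AS BD unfolding U_def by auto
      have "p \<epsilon> m \<or> (\<exists>q. q \<epsilon> N \<and> p = opair q (Q q))" using that unfolding m'_def by (simp add: mem_lam[OF Q(1)])
      then show ?thesis
      proof
        assume "p \<epsilon> m" then show ?thesis using m(1) F by blast
      next
        assume "\<exists>q. q \<epsilon> N \<and> p = opair q (Q q)"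
        then obtain q where q: "q \<epsilon> N" "p = opair q (Q q)" by blast
        obtain x y where "x \<epsilon> U" "y \<epsilon> U" "q = opair x y" using QB(2)[OF q(1)] unfolding mem_prod by blast
        then show ?thesis using q US QB(1)[OF q(1)] BD by simp
      qed
    qed
    ultimately have "m' \<epsilon> F" unfolding F by blast
    then have "m' = m" using m(3) unfolding m'_def sub_def by simp
    moreover have "H a0 \<epsilon> B" using B a by blast
    then have "fld m' (H a0)" "\<not> fld m (H a0)" using fld' BD A unfolding U_def by auto
    ultimately show False by blast
  qed
  then have "lepoll D A" using lepoll_total[OF AC] by blast
  then have "lepoll S A" by (rule union_lepoll[OF A2 a, rotated]) (simp add: D)
  then show ?thesis using prod_lepoll_mono A2 lepoll_subset[OF AS] lepoll_trans by meson
qed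

section \<open>Lexicographic products and integers\<close>

definition lex :: "('a \<Rightarrow> 'a \<Rightarrow> bool) \<Rightarrow> ('a \<Rightarrow> 'a \<Rightarrow> bool) \<Rightarrow> 'a \<Rightarrow> 'a \<Rightarrow> bool" where
  "lex R Q p q \<longleftrightarrow> R (pfst p) (pfst q) \<or> pfst p = pfst q \<and> Q (psnd p) (psnd q)"

lemma strict_linear_lex:
  assumes A: "strict_linear A R" and B: "strict_linear B Q"
  shows "strict_linear (prod A B) (lex R Q)"
  unfolding strict_linear_def
proof (intro conjI allI impI)
  show "definable (\<lambda>w. lex R Q (w 0) (w (Suc 0)))"
    unfolding lex_def by (intro defin definable_comp2[OF strict_linearD(1)[OF A]] definable_comp2[OF strict_linearD(1)[OF B]])
  show "\<not> lex R Q p p" if "p \<epsilon> prod A B" for p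
    using that strict_linearD(2)[OF A] strict_linearD(2)[OF B] unfolding lex_def mem_prod by auto
  show "lex R Q p q \<or> p = q \<or> lex R Q q p" if pq: "p \<epsilon> prod A B \<and> q \<epsilon> prod A B" for p q
  proof -
    obtain x y x' y' where h: "x \<epsilon> A" "y \<epsilon> B" "p = opair x y" "x' \<epsilon> A" "y' \<epsilon> B" "q = opair x' y'"
      using pq unfolding mem_prod by blast
    show ?thesis using strict_linearD(4)[OF A h(1,4)] strict_linearD(4)[OF B h(2,5)] h(3,6) unfolding lex_def by auto
  qed
  show "lex R Q p r" if pqr: "p \<epsilon> prod A B \<and> q \<epsilon> prod A B \<and> r \<epsilon> prod A B \<and> lex R Q p q \<and> lex R Q q r" for p q r
  proof -
    obtain x y x' y' x'' y'' where h: "x \<epsilon> A" "y \<epsilon> B" "p = opair x y" "x' \<epsilon> A" "y' \<epsilon> B" "q = opair x' y'"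
      "x'' \<epsilon> A" "y'' \<epsilon> B" "r = opair x'' y''"
      using pqr unfolding mem_prod by blast
    have 1: "R x x' \<or> x = x' \<and> Q y y'" and 2: "R x' x'' \<or> x' = x'' \<and> Q y' y''"
      using pqr h unfolding lex_def by simp_all
    have "R x x'' \<or> x = x'' \<and> Q y y''"
      using 1 2 strict_linearD(3)[OF A h(1,4,7)] strict_linearD(3)[OF B h(2,5,8)] by metis
    then show ?thesis using h unfolding lex_def by simp
  qed
qed

lemma aut_lex:
  assumes \<sigma>: "aut A R \<sigma>"
  shows "aut (prod A B) (lex R Q) (\<lambda>p. opair (\<sigma> (pfst p)) (psnd p))"
  unfolding aut_def
proof (intro conjI allI impI)
  show "definable_fun (\<lambda>p. opair (\<sigma> (pfst p)) (psnd p))" by (intro defin definable_term_comp1[OF autD(1)[OF \<sigma>]])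
  show "opair (\<sigma> (pfst p)) (psnd p) \<epsilon> prod A B" if "p \<epsilon> prod A B" for p
    using that autD(2)[OF \<sigma>] unfolding mem_prod[of p] by auto
  show "\<exists>p. p \<epsilon> prod A B \<and> opair (\<sigma> (pfst p)) (psnd p) = q" if q: "q \<epsilon> prod A B" for q
  proof -
    obtain x y where h: "x \<epsilon> A" "y \<epsilon> B" "q = opair x y" using q unfolding mem_prod by blast
    obtain x' where "x' \<epsilon> A" "\<sigma> x' = x" using autD(3)[OF \<sigma> h(1)] by blast
    then show ?thesis using h by (intro exI[of _ "opair x' y"]) simp
  qed
  show "lex R Q (opair (\<sigma> (pfst p)) (psnd p)) (opair (\<sigma> (pfst q)) (psnd q))"
    if "p \<epsilon> prod A B" "q \<epsilon> prod A B" "lex R Q p q" for p q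
    using that autD(4)[OF \<sigma>] unfolding lex_def mem_prod by auto
qed

text \<open>Automorphisms that are elements of the model; quantifying over them is first-order, and
  choice applies to them.\<close>
definition aut_code :: "'a \<Rightarrow> ('a \<Rightarrow> 'a \<Rightarrow> bool) \<Rightarrow> 'a \<Rightarrow> bool" where
  "aut_code L R f \<longleftrightarrow> (\<forall>x. x \<epsilon> L \<longrightarrow> app f x \<epsilon> L) \<and> (\<forall>y. y \<epsilon> L \<longrightarrow> (\<exists>x. x \<epsilon> L \<and> app f x = y)) \<and>
    (\<forall>x y. x \<epsilon> L \<longrightarrow> y \<epsilon> L \<longrightarrow> R x y \<longrightarrow> R (app f x) (app f y))"

lemma aut_app: "aut_code L R f \<Longrightarrow> aut L R (app f)"
  unfolding aut_code_def aut_def by (intro conjI definable_app definable_param definable_var) blast+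

lemma aut_code_lam:
  assumes F: "aut L R F" shows "aut_code L R (lam L F)" "x \<epsilon> L \<Longrightarrow> app (lam L F) x = F x" "lam L F \<epsilon> pow (prod L L)"
proof -
  have A: "app (lam L F) x = F x" if "x \<epsilon> L" for x by (rule app_lam[OF autD(1)[OF F] that])
  then show "x \<epsilon> L \<Longrightarrow> app (lam L F) x = F x" .
  show "aut_code L R (lam L F)"
    unfolding aut_code_def
  proof (intro conjI allI impI)
    show "\<exists>x. x \<epsilon> L \<and> app (lam L F) x = y" if "y \<epsilon> L" for y using autD(3)[OF F that] A by metis
  qed (simp_all add: A autD[OF F])
  show "lam L F \<epsilon> pow (prod L L)"
    unfolding mem_pow mem_lam[OF autD(1)[OF F]] using autD(2)[OF F] by auto
qed

lemma definable_aut_code: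
  assumes "definable (\<lambda>w. R (w 0) (w (Suc 0)))" "definable_term f"
  shows "definable (\<lambda>v. aut_code L R (f v))"
  apply (rule definable_comp1[of "aut_code L R", OF _ assms(2)])
  unfolding aut_code_def by (intro defin definable_comp2[OF assms(1)])

definition one :: 'a where "one = succ emp"

text \<open>The pair \<open>(1,n)\<close> stands for \<open>n\<close> and \<open>(0,n)\<close> for \<open>-n-1\<close>.\<close>
definition integers :: 'a where "integers = prod (upair emp one) omega"

definition int_less :: "'a \<Rightarrow> 'a \<Rightarrow> bool" where
  "int_less p q \<longleftrightarrow> pfst p = emp \<and> pfst q = one \<or>
     pfst p = emp \<and> pfst q = emp \<and> psnd q \<epsilon> psnd p \<or> pfst p = one \<and> pfst q = one \<and> psnd p \<epsilon> psnd q"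

definition int_succ :: "'a \<Rightarrow> 'a" where
  "int_succ p = (if pfst p = one then opair one (succ (psnd p))
     else if psnd p = emp then opair one emp else opair emp (union (psnd p)))"

lemma one_not_emp [simp]: "one \<noteq> emp" "emp \<noteq> one"
  using succ_not_emp[of emp] unfolding one_def by metis+

lemma mem_integers: "p \<epsilon> integers \<longleftrightarrow> (\<exists>n. n \<epsilon> omega \<and> (p = opair emp n \<or> p = opair one n))"
  unfolding integers_def mem_prod by auto

lemma definable_int_less [defin]: "definable_term f \<Longrightarrow> definable_term g \<Longrightarrow> definable (\<lambda>v. int_less (f v) (g v))"
  apply (rule definable_comp2[of int_less])
  unfolding int_less_def by (intro defin)

lemma definable_int_succ [defin]: "definable_term f \<Longrightarrow> definable_term (\<lambda>v. int_succ (f v))"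
  apply (rule definable_term_comp1[of int_succ])
  unfolding int_succ_def by (intro defin)

lemma omega_linear: "m \<epsilon> omega \<Longrightarrow> n \<epsilon> omega \<Longrightarrow> m \<epsilon> n \<or> m = n \<or> n \<epsilon> m"
  using ordinal_linear omega_ordinal by blast

lemma strict_linear_integers: "strict_linear integers int_less"
  unfolding strict_linear_def
proof (intro conjI allI impI)
  show "definable (\<lambda>w. int_less (w 0) (w (Suc 0)))" by (intro defin)
  show "\<not> int_less p p" for p unfolding int_less_def using mem_irrefl by auto
  show "int_less p q \<or> p = q \<or> int_less q p" if pq: "p \<epsilon> integers \<and> q \<epsilon> integers" for p q
  proof -
    obtain m where m: "m \<epsilon> omega" "p = opair emp m \<or> p = opair one m" using pq unfolding mem_integers by blast
    obtain n where n: "n \<epsilon> omega" "q = opair emp n \<or> q = opair one n" using pq unfolding mem_integers by blast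
    show ?thesis using m(2) n(2) omega_linear[OF m(1) n(1)]
      by (elim disjE) (simp_all add: int_less_def)
  qed
  show "int_less p r" if h: "p \<epsilon> integers \<and> q \<epsilon> integers \<and> r \<epsilon> integers \<and> int_less p q \<and> int_less q r" for p q r
  proof -
    have o: "ordinal (psnd p)" "ordinal (psnd r)" using h omega_ordinal unfolding mem_integers by auto
    show ?thesis using h ordinal_trans[OF o(1)] ordinal_trans[OF o(2)] one_not_emp unfolding int_less_def by metis
  qed
qed

lemma int_succ_simps:
  "int_succ (opair one n) = opair one (succ n)"
  "int_succ (opair emp emp) = opair one emp"
  "n \<epsilon> omega \<Longrightarrow> int_succ (opair emp (succ n)) = opair emp n"
  unfolding int_succ_def using union_succ[OF omega_ordinal] succ_not_emp by auto

lemma succ_mem_succ_iff: "m \<epsilon> omega \<Longrightarrow> n \<epsilon> omega \<Longrightarrow> succ m \<epsilon> succ n \<longleftrightarrow> m \<epsilon> n"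
proof -
  assume mn: "m \<epsilon> omega" "n \<epsilon> omega"
  have 1: "succ m \<epsilon> succ n \<Longrightarrow> m \<epsilon> n"
    using succ_mem_succ[OF omega_ordinal[OF mn(2)], of m] by simp
  have "m \<epsilon> n \<Longrightarrow> \<not> succ n \<epsilon> succ m \<and> succ m \<noteq> succ n"
    using succ_mem_succ[OF omega_ordinal[OF mn(1)], of n] mem_asym[of m n] mem_irrefl succ_inject by (metis mem_succ)
  then show ?thesis using 1 omega_linear[OF succ_omega[OF mn(1)] succ_omega[OF mn(2)]] by blast
qed

lemma aut_int_succ: "aut integers int_less int_succ"
  unfolding aut_def
proof (intro conjI allI impI)
  show "definable_fun int_succ" by (intro defin)
  have cases: "(\<exists>n. n \<epsilon> omega \<and> p = opair one n) \<or> p = opair emp emp \<or> (\<exists>n. n \<epsilon> omega \<and> p = opair emp (succ n))"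
    if "p \<epsilon> integers" for p
    using that omega_cases unfolding mem_integers by blast
  show "int_succ p \<epsilon> integers" if "p \<epsilon> integers" for p
    using cases[OF that] by (auto simp: int_succ_simps mem_integers succ_omega)
  show "\<exists>p. p \<epsilon> integers \<and> int_succ p = q" if q: "q \<epsilon> integers" for q
  proof -
    obtain n where n: "n \<epsilon> omega" "q = opair emp n \<or> q = opair one n" using q unfolding mem_integers by blast
    consider "q = opair emp n" | "q = opair one emp" | m where "m \<epsilon> omega" "q = opair one (succ m)"
      using n omega_cases by blast
    then show ?thesis
    proof cases
      case 1
      then show ?thesis using n(1) succ_omega by (intro exI[of _ "opair emp (succ n)"]) (simp add: int_succ_simps mem_integers)
    next
      case 2
      then show ?thesis by (intro exI[of _ "opair emp emp"]) (simp add: int_succ_simps mem_integers)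
    next
      case 3
      then show ?thesis by (intro exI[of _ "opair one m"]) (simp add: int_succ_simps mem_integers)
    qed
  qed
  show "int_less (int_succ p) (int_succ q)" if pq: "p \<epsilon> integers" "q \<epsilon> integers" "int_less p q" for p q
  proof -
    have bottom: "emp \<epsilon> succ n" if "n \<epsilon> omega" for n
      using omega_linear[OF emp_omega that] by auto
    consider m where "m \<epsilon> omega" "p = opair one m" | "p = opair emp emp" | m where "m \<epsilon> omega" "p = opair emp (succ m)"
      using cases[OF pq(1)] by blast
    then show ?thesis
    proof cases
      case 1
      then have "pfst q = one" "m \<epsilon> psnd q" using pq(3) unfolding int_less_def by simp_all
      moreover from this obtain n where "n \<epsilon> omega" "q = opair one n" using pq(2) unfolding mem_integers by auto
      ultimately show ?thesis using 1 by (simp add: int_succ_simps int_less_def succ_mem_succ_iff del: mem_succ)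
    next
      case 2
      then have "pfst q = one" using pq(3) unfolding int_less_def by (simp del: mem_succ)
      then obtain n where "n \<epsilon> omega" "q = opair one n" using pq(2) unfolding mem_integers by auto
      then show ?thesis using 2 bottom by (simp add: int_succ_simps int_less_def del: mem_succ)
    next
      case 3
      consider n where "n \<epsilon> omega" "q = opair one n" | "q = opair emp emp" | n where "n \<epsilon> omega" "q = opair emp (succ n)"
        using cases[OF pq(2)] by blast
      then show ?thesis
      proof cases
        case 1
        then show ?thesis using 3 by (simp add: int_succ_simps int_less_def)
      next
        case 2
        then show ?thesis using 3 by (simp add: int_succ_simps int_less_def)
      next
        case (3 n)
        then have "succ n \<epsilon> succ m" using pq(3) \<open>p = opair emp (succ m)\<close> unfolding int_less_def by (simp del: mem_succ)
        then have "n \<epsilon> m" using succ_mem_succ_iff 3 \<open>m \<epsilon> omega\<close> by blast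
        then show ?thesis using 3 \<open>p = opair emp (succ m)\<close> \<open>m \<epsilon> omega\<close> by (simp add: int_succ_simps int_less_def)
      qed
    qed
  qed
qed

text \<open>The integers that are the image of \<open>0\<close> under some automorphism are closed under successor
  and predecessor. Induction on this property replaces the construction of addition.\<close>
lemma integers_transitive:
  assumes "a \<epsilon> integers" "b \<epsilon> integers"
  shows "\<exists>F. aut integers int_less F \<and> F a = b"
proof -
  define origin where "origin = opair one emp"
  have o: "origin \<epsilon> integers" unfolding origin_def mem_integers by auto
  define Q where "Q a \<longleftrightarrow> (\<exists>f. aut_code integers int_less f \<and> app f origin = a)" for a
  have Qi: "Q a \<longleftrightarrow> (\<exists>F. aut integers int_less F \<and> F origin = a)" for a
    unfolding Q_def using aut_app aut_code_lam[OF _] o by metis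
  have dQ: "definable (\<lambda>v. Q (t v))" if "definable_term t" for t
    apply (rule definable_comp1[of Q, OF _ that])
    unfolding Q_def by (intro defin definable_aut_code)
  obtain pred where pred: "aut integers int_less pred" "\<forall>x. x \<epsilon> integers \<longrightarrow> pred (int_succ x) = x"
    by (rule aut_inverse[OF strict_linear_integers aut_int_succ])
  have step: "Q (G x)" if "Q x" "aut integers int_less G" for x G
    using that aut_comp unfolding Qi by metis
  have "Q origin" unfolding Qi using aut_comp[OF aut_int_succ pred(1)] pred(2) o by blast
  have pos: "Q (opair one n)" if "n \<epsilon> omega" for n
    using that
  proof (induction rule: omega_induct)
    case definable show ?case by (intro dQ defin)
  next
    case emp show ?case using \<open>Q origin\<close> unfolding origin_def .
  next
    case (succ n) then show ?case using step[OF succ(2) aut_int_succ] by (simp add: int_succ_simps)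
  qed
  have neg: "Q (opair emp n)" if "n \<epsilon> omega" for n
    using that
  proof (induction rule: omega_induct)
    case definable show ?case by (intro dQ defin)
  next
    case emp
    have "pred origin = opair emp emp"
      using pred(2)[rule_format, of "opair emp emp"] by (simp add: int_succ_simps origin_def mem_integers)
    then show ?case using step[OF \<open>Q origin\<close> pred(1)] by simp
  next
    case (succ n)
    have "pred (opair emp n) = opair emp (succ n)"
      using pred(2)[rule_format, of "opair emp (succ n)"] succ(1) by (simp add: int_succ_simps mem_integers succ_omega)
    then show ?case using step[OF succ(2) pred(1)] by simp
  qed
  have Q: "Q a" if "a \<epsilon> integers" for a using that pos neg unfolding mem_integers by blast
  obtain F where F: "aut integers int_less F" "F origin = a" using Q[OF assms(1)] unfolding Qi by blast
  obtain G where G: "aut integers int_less G" "G origin = b" using Q[OF assms(2)] unfolding Qi by blast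
  obtain H where H: "aut integers int_less H" "\<forall>x. x \<epsilon> integers \<longrightarrow> H (F x) = x"
    by (rule aut_inverse[OF strict_linear_integers F(1)])
  have "aut integers int_less (\<lambda>x. G (H x))" by (rule aut_comp[OF H(1) G(1)])
  moreover have "G (H a) = b" using H(2) o F(2) G(2) by metis
  ultimately show ?thesis by blast
qed

text \<open>A bijection with \<open>M\<close> carries the order of \<open>M\<close> to \<open>S\<close>, and an isomorphism between an
  interval and \<open>M\<close> is conjugated to one between an interval and \<open>S\<close>. The hypothesis on intervals
  speaks of any set \<open>J\<close> with the right elements, so that it does not depend on how the interval is
  presented.\<close>
lemma homogeneous_transport:
  assumes lin: "strict_linear M R" and H: "definable_fun H" "bij_betw H (elts S) (elts M)"
    and below: "\<And>x. x \<epsilon> M \<Longrightarrow> \<exists>y. y \<epsilon> M \<and> R y x" and above: "\<And>x. x \<epsilon> M \<Longrightarrow> \<exists>y. y \<epsilon> M \<and> R x y"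
    and iso: "\<And>a b J. a \<epsilon> M \<Longrightarrow> b \<epsilon> M \<Longrightarrow> R a b \<Longrightarrow> \<forall>x. x \<epsilon> J \<longleftrightarrow> x \<epsilon> M \<and> R a x \<and> R x b \<Longrightarrow>
      \<exists>K. definable_fun K \<and> bij_betw K (elts J) (elts M) \<and> (\<forall>x y. x \<epsilon> J \<longrightarrow> y \<epsilon> J \<longrightarrow> R x y \<longrightarrow> R (K x) (K y))"
  shows "\<exists>r. globally_homogeneous E S r"
proof -
  note dH = definable_term_comp1[OF H(1)]
  note dR = definable_comp2[OF strict_linearD(1)[OF lin]]
  note irrefl = strict_linearD(2)[OF lin] and trans = strict_linearD(3)[OF lin] and total = strict_linearD(4)[OF lin]
  have HM: "H x \<epsilon> M" if "x \<epsilon> S" for x using H(2) that unfolding bij_betw_def by auto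
  have Hinj: "x = y" if "x \<epsilon> S" "y \<epsilon> S" "H x = H y" for x y
    using H(2) that unfolding bij_betw_def inj_on_def by simp
  have Honto: "\<exists>x. x \<epsilon> S \<and> H x = y" if "y \<epsilon> M" for y
  proof -
    have "y \<in> H ` elts S" using H(2) that unfolding bij_betw_def by simp
    then show ?thesis by auto
  qed
  define G where "G y = the_in S (\<lambda>x. H x = y)" for y
  have dG: "definable_fun G" unfolding G_def by (intro defin dH)
  have GH: "G (H x) = x" if "x \<epsilon> S" for x
    unfolding G_def
  proof (rule the_in_eq)
    show "definable (\<lambda>w. H (w 0) = H x)" by (intro defin dH)
    show "y = x" if "y \<epsilon> S" "H y = H x" for y by (rule Hinj[OF that(1) \<open>x \<epsilon> S\<close> that(2)])
  qed (use that in simp_all)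
  have HG: "H (G y) = y" "G y \<epsilon> S" if "y \<epsilon> M" for y using Honto[OF that] GH by metis+
  have bijG: "bij_betw G (elts M) (elts S)"
    by (rule bij_betw_byWitness[where f' = H]) (auto simp: GH HG HM)
  define r where "r = sep (prod S S) (\<lambda>p. pfst p = psnd p \<or> R (H (pfst p)) (H (psnd p)))"
  have mem_r: "p \<epsilon> r \<longleftrightarrow> p \<epsilon> prod S S \<and> (pfst p = psnd p \<or> R (H (pfst p)) (H (psnd p)))" for p
    unfolding r_def by (rule mem_sep) (intro defin dR dH)
  then have r: "opair x y \<epsilon> r \<longleftrightarrow> x \<epsilon> S \<and> y \<epsilon> S \<and> (x = y \<or> R (H x) (H y))" for x y
    by simp
  have r_prod: "p \<epsilon> prod S S" if "p \<epsilon> r" for p using that mem_r by blast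
  have s: "strictly_below E r x y \<longleftrightarrow> x \<epsilon> S \<and> y \<epsilon> S \<and> R (H x) (H y)" for x y
    unfolding strictly_below_iff r using irrefl HM by blast
  have "is_linear_order E S r"
    unfolding is_linear_order_def is_relation_def related_iff is_opair_iff
  proof (intro conjI allI impI)
    show "\<exists>x y. x \<epsilon> S \<and> y \<epsilon> S \<and> p = opair x y" if "p \<epsilon> r" for p using r_prod[OF that] unfolding mem_prod .
    show "opair x x \<epsilon> r" if "x \<epsilon> S" for x using that r by blast
    show "x = y" if h: "opair x y \<epsilon> r \<and> opair y x \<epsilon> r" for x y
      using h trans[of "H x" "H y" "H x"] irrefl[of "H x"] HM unfolding r by blast
    show "opair x z \<epsilon> r" if h: "opair x y \<epsilon> r \<and> opair y z \<epsilon> r" for x y z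
      using h trans[of "H x" "H y" "H z"] HM unfolding r by blast
    show "opair x y \<epsilon> r \<or> opair y x \<epsilon> r" if h: "x \<epsilon> S \<and> y \<epsilon> S" for x y
      using h total[of "H x" "H y"] HM Hinj unfolding r by blast
  qed
  moreover have "is_unbounded E S r"
  proof -
    have "\<exists>y. y \<epsilon> S \<and> strictly_below E r y x" if x: "x \<epsilon> S" for x
    proof -
      obtain y where "y \<epsilon> M" "R y (H x)" using below[OF HM[OF x]] by blast
      then show ?thesis using HG x unfolding s by (intro exI[of _ "G y"]) simp
    qed
    moreover have "\<exists>y. y \<epsilon> S \<and> strictly_below E r x y" if x: "x \<epsilon> S" for x
    proof -
      obtain y where "y \<epsilon> M" "R (H x) y" using above[OF HM[OF x]] by blast
      then show ?thesis using HG x unfolding s by (intro exI[of _ "G y"]) simp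
    qed
    ultimately show ?thesis unfolding is_unbounded_def by blast
  qed
  moreover have "\<exists>I. is_interval E I S r a b \<and> order_isomorphic E I r S r"
    if ab: "a \<epsilon> S \<and> b \<epsilon> S \<and> strictly_below E r a b" for a b
  proof -
    define I where "I = sep S (\<lambda>x. R (H a) (H x) \<and> R (H x) (H b))"
    have I: "x \<epsilon> I \<longleftrightarrow> x \<epsilon> S \<and> R (H a) (H x) \<and> R (H x) (H b)" for x
      unfolding I_def by (rule mem_sep) (intro defin dR dH)
    define J where "J = sep M (\<lambda>x. R (H a) x \<and> R x (H b))"
    have J: "x \<epsilon> J \<longleftrightarrow> x \<epsilon> M \<and> R (H a) x \<and> R x (H b)" for x
      unfolding J_def by (rule mem_sep) (intro defin dR)
    have "is_interval E I S r a b" unfolding is_interval_def I s using ab by blast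
    moreover obtain K where K: "definable_fun K" "bij_betw K (elts J) (elts M)"
      "\<forall>x y. x \<epsilon> J \<longrightarrow> y \<epsilon> J \<longrightarrow> R x y \<longrightarrow> R (K x) (K y)"
      using iso[of "H a" "H b" J] J HM ab s by blast
    have HJ: "H x \<epsilon> J" if "x \<epsilon> I" for x using that HM unfolding I J by blast
    have KM: "K x \<epsilon> M" if "x \<epsilon> J" for x using K(2) that unfolding bij_betw_def by auto
    define F where "F x = G (K (H x))" for x
    have dF: "definable_fun F" unfolding F_def by (intro definable_term_comp1[OF dG] definable_term_comp1[OF K(1)] dH defin)
    have "bij_betw H (elts I) (elts J)"
      by (rule bij_betw_byWitness[where f' = G]) (auto simp: I J GH HG HM)
    then have "bij_betw (G \<circ> (K \<circ> H)) (elts I) (elts S)"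
      by (intro bij_betw_trans[OF bij_betw_trans[OF _ K(2)] bijG])
    then have "is_bijection E (lam I F) I S"
      by (intro is_bijection_lam[OF dF]) (simp add: F_def comp_def)
    moreover have "opair x y \<epsilon> r \<longleftrightarrow> opair (F x) (F y) \<epsilon> r" if xy: "x \<epsilon> I" "y \<epsilon> I" for x y
    proof -
      have lJ: "strict_linear J R" by (rule strict_linear_subset[OF lin]) (simp add: J)
      have KJ: "\<forall>x. x \<epsilon> J \<longrightarrow> K x \<epsilon> M" using KM by blast
      note m = strict_mono_reflects[OF lJ lin KJ K(3) HJ[OF xy(1)] HJ[OF xy(2)]]
      have S: "x \<epsilon> S" "y \<epsilon> S" using xy I by blast+
      have HF: "H (F x) = K (H x)" "H (F y) = K (H y)" "F x \<epsilon> S" "F y \<epsilon> S"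
        unfolding F_def using HG KM HJ xy by blast+
      have "x = y \<longleftrightarrow> H x = H y" using Hinj S by blast
      also have "\<dots> \<longleftrightarrow> F x = F y" using m(2) HF(1,2) Hinj[OF HF(3,4)] by metis
      finally show ?thesis unfolding r using S HF m(1) by simp
    qed
    then have "\<forall>x y x' y'. related E (lam I F) x x' \<and> related E (lam I F) y y' \<longrightarrow> (related E r x y \<longleftrightarrow> related E r x' y')"
      by (auto simp: mem_lam[OF dF])
    ultimately show ?thesis unfolding order_isomorphic_def by blast
  qed
  ultimately show ?thesis unfolding globally_homogeneous_def by blast
qed

end

section \<open>Functions of finite support\<close>

text \<open>The functions from the index set \<open>\<Gamma>\<close> to \<open>Z\<close> that differ from the constant \<open>z0\<close> at finitely
  many indices. Two functions are compared at the least index at which they differ.\<close>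
locale finite_support = zf_model +
  fixes \<Gamma> Z z0 :: 'a and R\<Gamma> RZ :: "'a \<Rightarrow> 'a \<Rightarrow> bool"
  assumes lin_\<Gamma>: "strict_linear \<Gamma> R\<Gamma>" and lin_Z: "strict_linear Z RZ" and z0: "z0 \<epsilon> Z"
begin

lemma definable_R\<Gamma> [defin]: "definable_term f \<Longrightarrow> definable_term g \<Longrightarrow> definable (\<lambda>v. R\<Gamma> (f v) (g v))"
  by (rule definable_comp2[OF strict_linearD(1)[OF lin_\<Gamma>]])

lemma definable_RZ [defin]: "definable_term f \<Longrightarrow> definable_term g \<Longrightarrow> definable (\<lambda>v. RZ (f v) (g v))"
  by (rule definable_comp2[OF strict_linearD(1)[OF lin_Z]])

definition upd :: "'a \<Rightarrow> 'a \<Rightarrow> 'a \<Rightarrow> 'a" where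
  "upd \<gamma> z f = lam \<Gamma> (\<lambda>\<delta>. if \<delta> = \<gamma> then z else app f \<delta>)"

definition zero :: 'a where "zero = lam \<Gamma> (\<lambda>\<delta>. z0)"

definition funs :: 'a where
  "funs = sep (pow (prod \<Gamma> Z)) (\<lambda>f. is_function E f \<Gamma> Z)"

definition closed :: "'a \<Rightarrow> bool" where
  "closed M \<longleftrightarrow> zero \<epsilon> M \<and> (\<forall>f \<gamma> z. f \<epsilon> M \<and> \<gamma> \<epsilon> \<Gamma> \<and> z \<epsilon> Z \<longrightarrow> upd \<gamma> z f \<epsilon> M)"

text \<open>Finiteness of the support is replaced by an inductive description: \<open>L\<close> is the least set
  that contains the constant function and is closed under changing one value. All properties of
  \<open>L\<close> are proved by the resulting induction.\<close>
definition L :: 'a where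
  "L = sep funs (\<lambda>f. \<forall>M. closed M \<longrightarrow> f \<epsilon> M)"

definition lt :: "'a \<Rightarrow> 'a \<Rightarrow> bool" where
  "lt f g \<longleftrightarrow> (\<exists>\<gamma>. \<gamma> \<epsilon> \<Gamma> \<and> RZ (app f \<gamma>) (app g \<gamma>) \<and> (\<forall>\<delta>. \<delta> \<epsilon> \<Gamma> \<and> R\<Gamma> \<delta> \<gamma> \<longrightarrow> app f \<delta> = app g \<delta>))"

lemma definable_is_function [defin]:
  "definable_term f \<Longrightarrow> definable_term g \<Longrightarrow> definable_term h \<Longrightarrow> definable (\<lambda>v. is_function E (f v) (g v) (h v))"
  apply (rule definable_comp3[of "is_function E"])
  unfolding is_function_def is_relation_def is_opair_iff related_iff by (intro defin definable_ex1)

lemma definable_upd [defin]: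
  "definable_term f \<Longrightarrow> definable_term g \<Longrightarrow> definable_term h \<Longrightarrow> definable_term (\<lambda>v. upd (f v) (g v) (h v))"
  apply (rule definable_term_comp3[of upd])
  unfolding upd_def by (intro defin)

lemma definable_closed [defin]: "definable_term f \<Longrightarrow> definable (\<lambda>v. closed (f v))"
  apply (rule definable_comp1[of closed])
  unfolding closed_def by (intro defin)

lemma definable_lt [defin]: "definable_term f \<Longrightarrow> definable_term g \<Longrightarrow> definable (\<lambda>v. lt (f v) (g v))"
  apply (rule definable_comp2[of lt])
  unfolding lt_def by (intro defin)

lemma mem_funs: "f \<epsilon> funs \<longleftrightarrow> is_function E f \<Gamma> Z"
proof -
  have "f \<epsilon> funs \<longleftrightarrow> f \<epsilon> pow (prod \<Gamma> Z) \<and> is_function E f \<Gamma> Z"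
    unfolding funs_def by (rule mem_sep) (intro defin)
  moreover have "f \<epsilon> pow (prod \<Gamma> Z)" if "is_function E f \<Gamma> Z"
    using that unfolding is_function_def is_relation_def mem_pow mem_prod is_opair_iff by blast
  ultimately show ?thesis by blast
qed

lemma app_in: "f \<epsilon> funs \<Longrightarrow> \<gamma> \<epsilon> \<Gamma> \<Longrightarrow> app f \<gamma> \<epsilon> Z"
  unfolding mem_funs by (rule is_function_app)

lemma funs_ext:
  assumes fg: "f \<epsilon> funs" "g \<epsilon> funs" and eq: "\<And>\<gamma>. \<gamma> \<epsilon> \<Gamma> \<Longrightarrow> app f \<gamma> = app g \<gamma>"
  shows "f = g"
proof (rule ext)
  fix p
  have F: "is_function E f \<Gamma> Z" "is_function E g \<Gamma> Z" using fg mem_funs by blast+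
  have "opair x y \<epsilon> f \<longleftrightarrow> opair x y \<epsilon> g" for x y
    using opair_in_function[OF F(1)] opair_in_function[OF F(2)] eq by auto
  moreover have "\<exists>x y. p = opair x y" if "p \<epsilon> f \<or> p \<epsilon> g"
    using that F unfolding is_function_def is_relation_def is_opair_iff by blast
  ultimately show "p \<epsilon> f \<longleftrightarrow> p \<epsilon> g" by metis
qed

lemma lam_funs:
  "definable_fun F \<Longrightarrow> (\<And>\<gamma>. \<gamma> \<epsilon> \<Gamma> \<Longrightarrow> F \<gamma> \<epsilon> Z) \<Longrightarrow> lam \<Gamma> F \<epsilon> funs"
  unfolding mem_funs by (rule is_function_lam)

lemma app_zero: "\<gamma> \<epsilon> \<Gamma> \<Longrightarrow> app zero \<gamma> = z0"
  unfolding zero_def by (rule app_lam) (intro defin)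

lemma app_upd: "\<delta> \<epsilon> \<Gamma> \<Longrightarrow> app (upd \<gamma> z f) \<delta> = (if \<delta> = \<gamma> then z else app f \<delta>)"
  unfolding upd_def by (rule app_lam) (intro defin)

lemma zero_funs: "zero \<epsilon> funs"
  unfolding zero_def by (rule lam_funs) (intro defin, rule z0)

lemma upd_funs: "f \<epsilon> funs \<Longrightarrow> z \<epsilon> Z \<Longrightarrow> upd \<gamma> z f \<epsilon> funs"
  unfolding upd_def by (rule lam_funs) (intro defin, simp add: app_in)

lemma mem_L: "f \<epsilon> L \<longleftrightarrow> f \<epsilon> funs \<and> (\<forall>M. closed M \<longrightarrow> f \<epsilon> M)"
  unfolding L_def by (rule mem_sep) (intro defin)

lemma L_funs: "f \<epsilon> L \<Longrightarrow> f \<epsilon> funs"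
  unfolding mem_L by blast

lemma zero_L: "zero \<epsilon> L"
  unfolding mem_L closed_def using zero_funs by blast

lemma upd_L: "f \<epsilon> L \<Longrightarrow> \<gamma> \<epsilon> \<Gamma> \<Longrightarrow> z \<epsilon> Z \<Longrightarrow> upd \<gamma> z f \<epsilon> L"
  unfolding mem_L closed_def using upd_funs by blast

lemma L_induct [consumes 1, case_names definable zero upd]:
  assumes "f \<epsilon> L" "definable (\<lambda>w. P (w 0))" "P zero"
    "\<And>f \<gamma> z. f \<epsilon> L \<Longrightarrow> P f \<Longrightarrow> \<gamma> \<epsilon> \<Gamma> \<Longrightarrow> z \<epsilon> Z \<Longrightarrow> P (upd \<gamma> z f)"
  shows "P f"
proof -
  have s: "f \<epsilon> sep L P \<longleftrightarrow> f \<epsilon> L \<and> P f" for f by (rule mem_sep[OF assms(2)])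
  have "closed (sep L P)" unfolding closed_def s using zero_L upd_L assms(3,4) by blast
  then show ?thesis using assms(1) s unfolding mem_L by blast
qed

text \<open>In place of finiteness of the set of indices where two functions differ, it is enough to
  know that its nonempty subsets have least elements. This survives changing one value, hence
  holds throughout \<open>L\<close>.\<close>
definition well_founded_difference :: "'a \<Rightarrow> 'a \<Rightarrow> bool" where
  "well_founded_difference f g \<longleftrightarrow> (\<forall>Y. (\<exists>y. y \<epsilon> Y) \<and> (\<forall>y. y \<epsilon> Y \<longrightarrow> y \<epsilon> \<Gamma> \<and> app f y \<noteq> app g y) \<longrightarrow>
     (\<exists>y. y \<epsilon> Y \<and> (\<forall>x. x \<epsilon> Y \<longrightarrow> \<not> R\<Gamma> x y)))"

lemma well_founded_difference_commute:
  "well_founded_difference f g \<Longrightarrow> well_founded_difference g f"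
  unfolding well_founded_difference_def by metis

lemma well_founded_difference_upd:
  assumes w: "well_founded_difference f g" and \<gamma>: "\<gamma> \<epsilon> \<Gamma>"
  shows "well_founded_difference (upd \<gamma> z f) g"
  unfolding well_founded_difference_def
proof (intro allI impI)
  fix Y assume Y: "(\<exists>y. y \<epsilon> Y) \<and> (\<forall>y. y \<epsilon> Y \<longrightarrow> y \<epsilon> \<Gamma> \<and> app (upd \<gamma> z f) y \<noteq> app g y)"
  define Y' where "Y' = sep Y (\<lambda>y. y \<noteq> \<gamma>)"
  have Y': "y \<epsilon> Y' \<longleftrightarrow> y \<epsilon> Y \<and> y \<noteq> \<gamma>" for y unfolding Y'_def by (rule mem_sep) (intro defin)
  show "\<exists>y. y \<epsilon> Y \<and> (\<forall>x. x \<epsilon> Y \<longrightarrow> \<not> R\<Gamma> x y)"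
  proof (cases "\<exists>y. y \<epsilon> Y'")
    case False
    then have "\<gamma> \<epsilon> Y" "\<forall>y. y \<epsilon> Y \<longrightarrow> y = \<gamma>" using Y Y' by metis+
    then show ?thesis using strict_linearD(2)[OF lin_\<Gamma> \<gamma>] by metis
  next
    case True
    have "\<forall>y. y \<epsilon> Y' \<longrightarrow> y \<epsilon> \<Gamma> \<and> app f y \<noteq> app g y" using Y Y' app_upd by metis
    then obtain y where y: "y \<epsilon> Y'" "\<forall>x. x \<epsilon> Y' \<longrightarrow> \<not> R\<Gamma> x y"
      using w True unfolding well_founded_difference_def by blast
    have y\<Gamma>: "y \<epsilon> \<Gamma>" "y \<epsilon> Y" using y Y Y' by blast+
    show ?thesis
    proof (cases "\<gamma> \<epsilon> Y \<and> R\<Gamma> \<gamma> y")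
      case False
      then show ?thesis using y y\<Gamma> Y' by metis
    next
      case True
      have "\<not> R\<Gamma> x \<gamma>" if "x \<epsilon> Y" for x
      proof
        assume x: "R\<Gamma> x \<gamma>"
        have x\<Gamma>: "x \<epsilon> \<Gamma>" using that Y by blast
        have "R\<Gamma> x y" using strict_linearD(3)[OF lin_\<Gamma> x\<Gamma> \<gamma> y\<Gamma>(1) x] True by blast
        moreover have "x \<noteq> \<gamma>" using x strict_linearD(2)[OF lin_\<Gamma> \<gamma>] by blast
        ultimately show False using y Y' that by blast
      qed
      then show ?thesis using True by blast
    qed
  qed
qed

lemma well_founded_difference_L:
  assumes "f \<epsilon> L" "g \<epsilon> L"
  shows "well_founded_difference f g"
proof -
  have d: "definable (\<lambda>w. well_founded_difference (w 0) g)" for g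
    unfolding well_founded_difference_def by (intro defin)
  have "well_founded_difference zero zero" unfolding well_founded_difference_def by blast
  then have "well_founded_difference g zero"
    by (intro L_induct[OF assms(2) d]) (auto intro: well_founded_difference_upd)
  then show ?thesis
    by (intro L_induct[OF assms(1) d]) (auto intro: well_founded_difference_upd well_founded_difference_commute)
qed

lemma least_difference:
  assumes "f \<epsilon> L" "g \<epsilon> L" "f \<noteq> g"
  obtains \<gamma> where "\<gamma> \<epsilon> \<Gamma>" "app f \<gamma> \<noteq> app g \<gamma>" "\<forall>\<delta>. \<delta> \<epsilon> \<Gamma> \<and> R\<Gamma> \<delta> \<gamma> \<longrightarrow> app f \<delta> = app g \<delta>"
proof -
  define Y where "Y = sep \<Gamma> (\<lambda>y. app f y \<noteq> app g y)"
  have Y: "y \<epsilon> Y \<longleftrightarrow> y \<epsilon> \<Gamma> \<and> app f y \<noteq> app g y" for y unfolding Y_def by (rule mem_sep) (intro defin)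
  have "\<exists>y. y \<epsilon> Y" using funs_ext[OF L_funs L_funs] assms Y by blast
  then obtain y where "y \<epsilon> Y" "\<forall>x. x \<epsilon> Y \<longrightarrow> \<not> R\<Gamma> x y"
    using well_founded_difference_L[OF assms(1,2)] Y unfolding well_founded_difference_def by blast
  then show thesis using that Y by blast
qed

lemma strict_linear_L: "strict_linear L lt"
  unfolding strict_linear_def
proof (intro conjI allI impI)
  show "definable (\<lambda>w. lt (w 0) (w (Suc 0)))" by (intro defin)
  show "\<not> lt f f" if "f \<epsilon> L" for f
    unfolding lt_def using strict_linearD(2)[OF lin_Z] app_in[OF L_funs[OF that]] by blast
  show "lt f g \<or> f = g \<or> lt g f" if fg: "f \<epsilon> L \<and> g \<epsilon> L" for f g
  proof (cases "f = g")
    case False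
    then obtain \<gamma> where \<gamma>: "\<gamma> \<epsilon> \<Gamma>" "app f \<gamma> \<noteq> app g \<gamma>" "\<forall>\<delta>. \<delta> \<epsilon> \<Gamma> \<and> R\<Gamma> \<delta> \<gamma> \<longrightarrow> app f \<delta> = app g \<delta>"
      using least_difference fg by blast
    have "RZ (app f \<gamma>) (app g \<gamma>) \<or> RZ (app g \<gamma>) (app f \<gamma>)"
      using strict_linearD(4)[OF lin_Z, of "app f \<gamma>" "app g \<gamma>"] app_in L_funs fg \<gamma>(1,2) by blast
    then show ?thesis using \<gamma>(1,3) unfolding lt_def by metis
  qed blast
  show "lt f h" if h: "f \<epsilon> L \<and> g \<epsilon> L \<and> h \<epsilon> L \<and> lt f g \<and> lt g h" for f g h
  proof -
    obtain \<gamma> where \<gamma>: "\<gamma> \<epsilon> \<Gamma>" "RZ (app f \<gamma>) (app g \<gamma>)" "\<forall>\<delta>. \<delta> \<epsilon> \<Gamma> \<and> R\<Gamma> \<delta> \<gamma> \<longrightarrow> app f \<delta> = app g \<delta>"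
      using h unfolding lt_def by blast
    obtain \<beta> where \<beta>: "\<beta> \<epsilon> \<Gamma>" "RZ (app g \<beta>) (app h \<beta>)" "\<forall>\<delta>. \<delta> \<epsilon> \<Gamma> \<and> R\<Gamma> \<delta> \<beta> \<longrightarrow> app g \<delta> = app h \<delta>"
      using h unfolding lt_def by blast
    have Z: "app f \<delta> \<epsilon> Z" "app g \<delta> \<epsilon> Z" "app h \<delta> \<epsilon> Z" if "\<delta> \<epsilon> \<Gamma>" for \<delta>
      using app_in L_funs h that by blast+
    consider "R\<Gamma> \<gamma> \<beta>" | "\<gamma> = \<beta>" | "R\<Gamma> \<beta> \<gamma>" using strict_linearD(4)[OF lin_\<Gamma> \<gamma>(1) \<beta>(1)] by blast
    then show ?thesis
    proof cases
      case 1
      have "RZ (app f \<gamma>) (app h \<gamma>)" using \<gamma>(1,2) \<beta>(3) 1 by simp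
      moreover have "app f \<delta> = app h \<delta>" if "\<delta> \<epsilon> \<Gamma>" "R\<Gamma> \<delta> \<gamma>" for \<delta>
        using \<gamma>(3) \<beta>(3) that strict_linearD(3)[OF lin_\<Gamma> that(1) \<gamma>(1) \<beta>(1) that(2) 1] by simp
      ultimately show ?thesis unfolding lt_def using \<gamma>(1) by blast
    next
      case 2
      have "RZ (app f \<gamma>) (app h \<gamma>)" using strict_linearD(3)[OF lin_Z Z[OF \<gamma>(1)] \<gamma>(2)] \<beta>(2) 2 by simp
      moreover have "app f \<delta> = app h \<delta>" if "\<delta> \<epsilon> \<Gamma>" "R\<Gamma> \<delta> \<gamma>" for \<delta>
        using \<gamma>(3) \<beta>(3) that 2 by simp
      ultimately show ?thesis unfolding lt_def using \<gamma>(1) by blast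
    next
      case 3
      have "RZ (app f \<beta>) (app h \<beta>)" using \<beta>(1,2) \<gamma>(3) 3 by simp
      moreover have "app f \<delta> = app h \<delta>" if "\<delta> \<epsilon> \<Gamma>" "R\<Gamma> \<delta> \<beta>" for \<delta>
        using \<gamma>(3) \<beta>(3) that strict_linearD(3)[OF lin_\<Gamma> that(1) \<beta>(1) \<gamma>(1) that(2) 3] by simp
      ultimately show ?thesis unfolding lt_def using \<beta>(1) by blast
    qed
  qed
qed

text \<open>The support of the result lies in the union of the supports of \<open>c\<close> and \<open>f\<close>, since \<open>h z0\<close>
  is the identity. In the induction, changing \<open>c\<close> at \<open>\<gamma>\<close> changes the result at \<open>\<gamma>\<close> only.\<close>
lemma pointwise_L:
  assumes h: "definable_term (\<lambda>w. h (w 0) (w (Suc 0)))" "\<And>a x. a \<epsilon> Z \<Longrightarrow> x \<epsilon> Z \<Longrightarrow> h a x \<epsilon> Z" "\<And>x. x \<epsilon> Z \<Longrightarrow> h z0 x = x"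
    and c: "c \<epsilon> L" and f: "f \<epsilon> L"
  shows "lam \<Gamma> (\<lambda>\<gamma>. h (app c \<gamma>) (app f \<gamma>)) \<epsilon> L"
  using c
proof (induction rule: L_induct)
  have dh [defin]: "definable_term (\<lambda>v. h (t v) (s v))" if "definable_term t" "definable_term s" for t s
    by (rule definable_term_comp2[OF h(1) that])
  case definable
  show ?case by (intro defin dh)
  have F: "lam \<Gamma> (\<lambda>\<gamma>. h (app c \<gamma>) (app f \<gamma>)) \<epsilon> funs" if "c \<epsilon> L" for c
    by (rule lam_funs) (intro defin dh, intro h(2) app_in L_funs that f)
  have A: "app (lam \<Gamma> (\<lambda>\<gamma>. h (app c \<gamma>) (app f \<gamma>))) \<gamma> = h (app c \<gamma>) (app f \<gamma>)" if "\<gamma> \<epsilon> \<Gamma>" for c \<gamma>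
    by (rule app_lam[OF _ that]) (intro defin dh)
  {
    case zero
    have "lam \<Gamma> (\<lambda>\<gamma>. h (app zero \<gamma>) (app f \<gamma>)) = f"
      by (rule funs_ext[OF F[OF zero_L] L_funs[OF f]]) (simp add: A app_zero h(3) app_in L_funs f)
    then show ?case using f by simp
  next
    case (upd c \<gamma> z)
    have z: "h z (app f \<gamma>) \<epsilon> Z" using h(2) app_in[OF L_funs[OF f]] upd by blast
    have "lam \<Gamma> (\<lambda>\<delta>. h (app (upd \<gamma> z c) \<delta>) (app f \<delta>)) = upd \<gamma> (h z (app f \<gamma>)) (lam \<Gamma> (\<lambda>\<delta>. h (app c \<delta>) (app f \<delta>)))"
    proof (rule funs_ext)
      show "lam \<Gamma> (\<lambda>\<delta>. h (app (upd \<gamma> z c) \<delta>) (app f \<delta>)) \<epsilon> funs" by (intro F upd_L upd)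
      show "upd \<gamma> (h z (app f \<gamma>)) (lam \<Gamma> (\<lambda>\<delta>. h (app c \<delta>) (app f \<delta>))) \<epsilon> funs"
        by (intro upd_funs F upd z)
    qed (simp add: A app_upd)
    then show ?case using upd_L[OF upd.IH upd.hyps(2) z] by simp
  }
qed

text \<open>A uniform family of automorphisms \<open>h a\<close> of \<open>Z\<close>, each carrying \<open>z0\<close> to \<open>a\<close>, acts as a
  substitute for addition. Applying \<open>h (c \<gamma>)\<close> at each index \<open>\<gamma>\<close> is translation by \<open>c\<close>.\<close>
lemma pointwise_aut:
  assumes h: "definable_term (\<lambda>w. h (w 0) (w (Suc 0)))" and aut: "\<And>a. a \<epsilon> Z \<Longrightarrow> aut Z RZ (h a)"
    and h0: "\<And>x. x \<epsilon> Z \<Longrightarrow> h z0 x = x" and hz: "\<And>a. a \<epsilon> Z \<Longrightarrow> h a z0 = a" and c: "c \<epsilon> L"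
  shows "\<exists>F. aut L lt F \<and> F zero = c"
proof -
  have dh [defin]: "definable_term (\<lambda>v. h (t v) (s v))" if "definable_term t" "definable_term s" for t s
    by (rule definable_term_comp2[OF h that])
  define k where "k a y = the_in Z (\<lambda>x. h a x = y)" for a y
  have dk: "definable_term (\<lambda>w. k (w 0) (w (Suc 0)))" unfolding k_def by (intro defin dh)
  have dk' [defin]: "definable_term (\<lambda>v. k (t v) (s v))" if "definable_term t" "definable_term s" for t s
    by (rule definable_term_comp2[OF dk that])
  have hZ: "h a x \<epsilon> Z" if "a \<epsilon> Z" "x \<epsilon> Z" for a x using autD(2)[OF aut] that by blast
  have kh: "k a (h a x) = x" if "a \<epsilon> Z" "x \<epsilon> Z" for a x
    unfolding k_def
  proof (rule the_in_eq)
    show "definable (\<lambda>w. h a (w 0) = h a x)" by (intro defin dh)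
    show "y = x" if "y \<epsilon> Z" "h a y = h a x" for y
      using aut_iff(2)[OF lin_Z aut[OF \<open>a \<epsilon> Z\<close>] that(1) \<open>x \<epsilon> Z\<close>] that(2) by simp
  qed (use that in simp_all)
  have hk: "k a y \<epsilon> Z \<and> h a (k a y) = y" if ay: "a \<epsilon> Z" "y \<epsilon> Z" for a y
  proof -
    obtain x where "x \<epsilon> Z" "h a x = y" using autD(3)[OF aut[OF ay(1)] ay(2)] by blast
    then show ?thesis using kh[OF ay(1)] by auto
  qed
  have k0: "k z0 x = x" if "x \<epsilon> Z" for x using kh[OF z0 that] h0[OF that] by simp
  define F where "F f = lam \<Gamma> (\<lambda>\<gamma>. h (app c \<gamma>) (app f \<gamma>))" for f
  define G where "G f = lam \<Gamma> (\<lambda>\<gamma>. k (app c \<gamma>) (app f \<gamma>))" for f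
  have F: "F f \<epsilon> L" if "f \<epsilon> L" for f unfolding F_def by (rule pointwise_L[OF h hZ h0 c that])
  have G: "G f \<epsilon> L" if "f \<epsilon> L" for f unfolding G_def by (rule pointwise_L[OF dk _ k0 c that]) (use hk in blast)
  have appF: "app (F f) \<gamma> = h (app c \<gamma>) (app f \<gamma>)" if "\<gamma> \<epsilon> \<Gamma>" for f \<gamma>
    unfolding F_def by (rule app_lam[OF _ that]) (intro defin dh)
  have appG: "app (G f) \<gamma> = k (app c \<gamma>) (app f \<gamma>)" if "\<gamma> \<epsilon> \<Gamma>" for f \<gamma>
    unfolding G_def by (rule app_lam[OF _ that]) (intro defin dk')
  have LZ: "app f \<gamma> \<epsilon> Z" if "f \<epsilon> L" "\<gamma> \<epsilon> \<Gamma>" for f \<gamma> using app_in L_funs that by blast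
  have "aut L lt F"
    unfolding aut_def
  proof (intro conjI allI impI)
    show "definable_fun F" unfolding F_def by (intro defin dh)
    show "F f \<epsilon> L" if "f \<epsilon> L" for f by (rule F[OF that])
    show "\<exists>g. g \<epsilon> L \<and> F g = f" if f: "f \<epsilon> L" for f
    proof (intro exI conjI)
      show "F (G f) = f"
        by (rule funs_ext) (simp_all add: L_funs F G f appF appG hk LZ c)
    qed (rule G[OF f])
    show "lt (F f) (F g)" if fg: "f \<epsilon> L" "g \<epsilon> L" "lt f g" for f g
    proof -
      obtain \<gamma> where \<gamma>: "\<gamma> \<epsilon> \<Gamma>" "RZ (app f \<gamma>) (app g \<gamma>)" "\<forall>\<delta>. \<delta> \<epsilon> \<Gamma> \<and> R\<Gamma> \<delta> \<gamma> \<longrightarrow> app f \<delta> = app g \<delta>"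
        using fg(3) unfolding lt_def by blast
      have "RZ (app (F f) \<gamma>) (app (F g) \<gamma>)"
        using autD(4)[OF aut[OF LZ[OF c \<gamma>(1)]] LZ[OF fg(1) \<gamma>(1)] LZ[OF fg(2) \<gamma>(1)] \<gamma>(2)] appF \<gamma>(1) by simp
      then show ?thesis unfolding lt_def using \<gamma> appF by (intro exI[of _ \<gamma>]) simp
    qed
  qed
  moreover have "F zero = c"
    by (rule funs_ext) (simp_all add: L_funs F zero_L c appF app_zero hz LZ)
  ultimately show ?thesis by blast
qed

lemma shift_L:
  assumes \<sigma>: "aut \<Gamma> R\<Gamma> \<sigma>" and \<tau>: "aut \<Gamma> R\<Gamma> \<tau>" and st: "\<forall>x. x \<epsilon> \<Gamma> \<longrightarrow> \<sigma> (\<tau> x) = x" "\<forall>x. x \<epsilon> \<Gamma> \<longrightarrow> \<tau> (\<sigma> x) = x"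
    and f: "f \<epsilon> L"
  shows "lam \<Gamma> (\<lambda>\<gamma>. app f (\<tau> \<gamma>)) \<epsilon> L"
  using f
proof (induction rule: L_induct)
  note d = definable_term_comp1[OF autD(1)[OF \<tau>]]
  case definable
  show ?case by (intro defin d)
  have F: "lam \<Gamma> (\<lambda>\<gamma>. app f (\<tau> \<gamma>)) \<epsilon> funs" if "f \<epsilon> L" for f
    by (rule lam_funs) (intro defin d, intro app_in L_funs that autD(2)[OF \<tau>])
  have A: "app (lam \<Gamma> (\<lambda>\<gamma>. app f (\<tau> \<gamma>))) \<gamma> = app f (\<tau> \<gamma>)" if "\<gamma> \<epsilon> \<Gamma>" for f \<gamma>
    by (rule app_lam[OF _ that]) (intro defin d)
  {
    case zero
    have "lam \<Gamma> (\<lambda>\<gamma>. app zero (\<tau> \<gamma>)) = zero"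
      by (rule funs_ext[OF F[OF zero_L] zero_funs]) (simp add: A app_zero autD(2)[OF \<tau>])
    then show ?case using zero_L by simp
  next
    case (upd f \<gamma> z)
    have "lam \<Gamma> (\<lambda>\<delta>. app (upd \<gamma> z f) (\<tau> \<delta>)) = upd (\<sigma> \<gamma>) z (lam \<Gamma> (\<lambda>\<delta>. app f (\<tau> \<delta>)))"
    proof (rule funs_ext)
      show "lam \<Gamma> (\<lambda>\<delta>. app (upd \<gamma> z f) (\<tau> \<delta>)) \<epsilon> funs" by (intro F upd_L upd)
      show "upd (\<sigma> \<gamma>) z (lam \<Gamma> (\<lambda>\<delta>. app f (\<tau> \<delta>))) \<epsilon> funs"
        by (intro upd_funs F upd)
      fix \<delta> assume \<delta>: "\<delta> \<epsilon> \<Gamma>"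
      have "\<tau> \<delta> = \<gamma> \<longleftrightarrow> \<delta> = \<sigma> \<gamma>" using st \<delta> upd.hyps(2) by metis
      then show "app (lam \<Gamma> (\<lambda>\<delta>. app (upd \<gamma> z f) (\<tau> \<delta>))) \<delta> = app (upd (\<sigma> \<gamma>) z (lam \<Gamma> (\<lambda>\<delta>. app f (\<tau> \<delta>)))) \<delta>"
        using \<delta> by (simp add: A app_upd autD(2)[OF \<tau>])
    qed
    then show ?case using upd_L[OF upd.IH autD(2)[OF \<sigma> upd.hyps(2)] upd.hyps(3)] by simp
  }
qed

text \<open>An automorphism of the index set acts on functions by composition.\<close>
lemma shift_aut:
  assumes \<sigma>: "aut \<Gamma> R\<Gamma> \<sigma>"
  shows "\<exists>F. aut L lt F \<and> F zero = zero \<and> (\<forall>f \<gamma>. f \<epsilon> L \<longrightarrow> \<gamma> \<epsilon> \<Gamma> \<longrightarrow> app (F f) (\<sigma> \<gamma>) = app f \<gamma>)"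
proof -
  obtain \<tau> where \<tau>: "aut \<Gamma> R\<Gamma> \<tau>" "\<forall>x. x \<epsilon> \<Gamma> \<longrightarrow> \<tau> (\<sigma> x) = x" "\<forall>x. x \<epsilon> \<Gamma> \<longrightarrow> \<sigma> (\<tau> x) = x"
    by (rule aut_inverse[OF lin_\<Gamma> \<sigma>])
  define F where "F f = lam \<Gamma> (\<lambda>\<gamma>. app f (\<tau> \<gamma>))" for f
  define G where "G f = lam \<Gamma> (\<lambda>\<gamma>. app f (\<sigma> \<gamma>))" for f
  have F: "F f \<epsilon> L" if "f \<epsilon> L" for f unfolding F_def by (rule shift_L[OF \<sigma> \<tau>(1,3,2) that])
  have G: "G f \<epsilon> L" if "f \<epsilon> L" for f unfolding G_def by (rule shift_L[OF \<tau>(1) \<sigma> \<tau>(2,3) that])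
  have appF: "app (F f) \<gamma> = app f (\<tau> \<gamma>)" if "\<gamma> \<epsilon> \<Gamma>" for f \<gamma>
    unfolding F_def by (rule app_lam[OF _ that]) (intro defin definable_term_comp1[OF autD(1)[OF \<tau>(1)]])
  have appG: "app (G f) \<gamma> = app f (\<sigma> \<gamma>)" if "\<gamma> \<epsilon> \<Gamma>" for f \<gamma>
    unfolding G_def by (rule app_lam[OF _ that]) (intro defin definable_term_comp1[OF autD(1)[OF \<sigma>]])
  have "aut L lt F"
    unfolding aut_def
  proof (intro conjI allI impI)
    show "definable_fun F" unfolding F_def by (intro defin definable_term_comp1[OF autD(1)[OF \<tau>(1)]])
    show "F f \<epsilon> L" if "f \<epsilon> L" for f by (rule F[OF that])
    show "\<exists>g. g \<epsilon> L \<and> F g = f" if f: "f \<epsilon> L" for f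
    proof (intro exI conjI)
      show "F (G f) = f"
        by (rule funs_ext) (simp_all add: L_funs F G f appF appG autD(2)[OF \<tau>(1)] \<tau>)
    qed (rule G[OF f])
    show "lt (F f) (F g)" if fg: "f \<epsilon> L" "g \<epsilon> L" "lt f g" for f g
    proof -
      obtain \<gamma> where \<gamma>: "\<gamma> \<epsilon> \<Gamma>" "RZ (app f \<gamma>) (app g \<gamma>)" "\<forall>\<delta>. \<delta> \<epsilon> \<Gamma> \<and> R\<Gamma> \<delta> \<gamma> \<longrightarrow> app f \<delta> = app g \<delta>"
        using fg(3) unfolding lt_def by blast
      have s: "\<sigma> \<gamma> \<epsilon> \<Gamma>" by (rule autD(2)[OF \<sigma> \<gamma>(1)])
      have "RZ (app (F f) (\<sigma> \<gamma>)) (app (F g) (\<sigma> \<gamma>))" using appF[OF s] \<tau>(2) \<gamma> by simp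
      moreover have "app (F f) \<delta> = app (F g) \<delta>" if \<delta>: "\<delta> \<epsilon> \<Gamma>" "R\<Gamma> \<delta> (\<sigma> \<gamma>)" for \<delta>
      proof -
        have "R\<Gamma> (\<tau> \<delta>) \<gamma>" using autD(4)[OF \<tau>(1) \<delta>(1) s \<delta>(2)] \<tau>(2) \<gamma>(1) by simp
        then show ?thesis using appF[OF \<delta>(1)] \<gamma>(3) autD(2)[OF \<tau>(1) \<delta>(1)] by simp
      qed
      ultimately show ?thesis unfolding lt_def using s by blast
    qed
  qed
  moreover have "F zero = zero"
    by (rule funs_ext) (simp_all add: L_funs F zero_L zero_funs appF app_zero autD(2)[OF \<tau>(1)])
  moreover have "app (F f) (\<sigma> \<gamma>) = app f \<gamma>" if "\<gamma> \<epsilon> \<Gamma>" for f \<gamma>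
    using appF[OF autD(2)[OF \<sigma> that]] \<tau>(2) that by simp
  ultimately show ?thesis by blast
qed

definition interval :: "'a \<Rightarrow> 'a \<Rightarrow> 'a" where
  "interval a b = sep L (\<lambda>x. lt a x \<and> lt x b)"

lemma mem_interval: "x \<epsilon> interval a b \<longleftrightarrow> x \<epsilon> L \<and> lt a x \<and> lt x b"
  unfolding interval_def by (rule mem_sep) (intro defin)

text \<open>If all differences of \<open>d\<close> from zero occur at \<open>\<delta>\<close> or later, then shifting \<open>\<delta>\<close> beyond \<open>\<gamma>\<close>
  makes \<open>d\<close> vanish up to and including \<open>\<gamma>\<close>, so that it becomes negligible against any function
  whose first nonzero value is at \<open>\<gamma>\<close>.\<close>
lemma contract_far:
  assumes contr: "\<And>\<gamma> \<delta>. \<gamma> \<epsilon> \<Gamma> \<Longrightarrow> \<delta> \<epsilon> \<Gamma> \<Longrightarrow> \<exists>\<sigma>. aut \<Gamma> R\<Gamma> \<sigma> \<and> R\<Gamma> \<gamma> (\<sigma> \<delta>)"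
    and d: "d \<epsilon> L" and \<gamma>: "\<gamma> \<epsilon> \<Gamma>" and \<delta>: "\<delta> \<epsilon> \<Gamma>" "\<forall>\<beta>. \<beta> \<epsilon> \<Gamma> \<and> R\<Gamma> \<beta> \<delta> \<longrightarrow> app d \<beta> = z0"
  obtains F where "aut L lt F" "F zero = zero" "\<forall>\<beta>. \<beta> \<epsilon> \<Gamma> \<and> (\<beta> = \<gamma> \<or> R\<Gamma> \<beta> \<gamma>) \<longrightarrow> app (F d) \<beta> = z0"
proof -
  obtain \<sigma> where \<sigma>: "aut \<Gamma> R\<Gamma> \<sigma>" "R\<Gamma> \<gamma> (\<sigma> \<delta>)" using contr[OF \<gamma> \<delta>(1)] by blast
  obtain F where F: "aut L lt F" "F zero = zero" "\<forall>f \<gamma>. f \<epsilon> L \<longrightarrow> \<gamma> \<epsilon> \<Gamma> \<longrightarrow> app (F f) (\<sigma> \<gamma>) = app f \<gamma>"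
    using shift_aut[OF \<sigma>(1)] by blast
  have "app (F d) \<beta> = z0" if \<beta>: "\<beta> \<epsilon> \<Gamma>" "\<beta> = \<gamma> \<or> R\<Gamma> \<beta> \<gamma>" for \<beta>
  proof -
    have lt: "R\<Gamma> \<beta> (\<sigma> \<delta>)"
      using \<beta>(2) \<sigma>(2) strict_linearD(3)[OF lin_\<Gamma> \<beta>(1) \<gamma> autD(2)[OF \<sigma>(1) \<delta>(1)]] by blast
    obtain x where x: "x \<epsilon> \<Gamma>" "\<sigma> x = \<beta>" using autD(3)[OF \<sigma>(1) \<beta>(1)] by blast
    then have "R\<Gamma> x \<delta>" using aut_iff(1)[OF lin_\<Gamma> \<sigma>(1) x(1) \<delta>(1)] lt by simp
    then have "app d x = z0" using \<delta>(2) x(1) by blast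
    then show ?thesis using F(3) d x by auto
  qed
  then show thesis using that F by blast
qed

text \<open>An isomorphism of half-open intervals matches their least elements, so it restricts to the
  open intervals.\<close>
lemma intervals_isomorphic:
  assumes h: "definable_term (\<lambda>w. h (w 0) (w (Suc 0)))" "\<And>a. a \<epsilon> Z \<Longrightarrow> aut Z RZ (h a)"
     "\<And>x. x \<epsilon> Z \<Longrightarrow> h z0 x = x" "\<And>a. a \<epsilon> Z \<Longrightarrow> h a z0 = a"
    and contr: "\<And>\<gamma> \<delta>. \<gamma> \<epsilon> \<Gamma> \<Longrightarrow> \<delta> \<epsilon> \<Gamma> \<Longrightarrow> \<exists>\<sigma>. aut \<Gamma> R\<Gamma> \<sigma> \<and> R\<Gamma> \<gamma> (\<sigma> \<delta>)"
    and ab: "a \<epsilon> L" "b \<epsilon> L" "lt a b" and cd: "c \<epsilon> L" "d \<epsilon> L" "lt c d"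
  obtains K where "definable_fun K" "bij_betw K (elts (interval a b)) (elts (interval c d))"
    "\<forall>x y. x \<epsilon> interval a b \<longrightarrow> y \<epsilon> interval a b \<longrightarrow> lt x y \<longrightarrow> lt (K x) (K y)"
proof -
  note irrefl = strict_linearD(2)[OF strict_linear_L] and trans = strict_linearD(3)[OF strict_linear_L]
  define half where "half a b = sep L (\<lambda>x. (lt a x \<or> a = x) \<and> lt x b)" for a b
  have half: "x \<epsilon> half a b \<longleftrightarrow> x \<epsilon> L \<and> (lt a x \<or> a = x) \<and> lt x b" for x a b
    unfolding half_def by (rule mem_sep) (intro defin)
  have tr: "\<exists>F. aut L lt F \<and> F zero = a" if "a \<epsilon> L" for a by (rule pointwise_aut[OF h that])
  have up: "\<exists>F. aut L lt F \<and> F zero = zero \<and> lt (F d) b" if bd: "b \<epsilon> L" "d \<epsilon> L" "lt zero b" "lt zero d" for b d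
  proof -
    obtain \<gamma> where \<gamma>: "\<gamma> \<epsilon> \<Gamma>" "RZ (app zero \<gamma>) (app b \<gamma>)" "\<forall>\<delta>. \<delta> \<epsilon> \<Gamma> \<and> R\<Gamma> \<delta> \<gamma> \<longrightarrow> app zero \<delta> = app b \<delta>"
      using bd(3) unfolding lt_def by blast
    obtain \<delta> where \<delta>: "\<delta> \<epsilon> \<Gamma>" "\<forall>\<beta>. \<beta> \<epsilon> \<Gamma> \<and> R\<Gamma> \<beta> \<delta> \<longrightarrow> app zero \<beta> = app d \<beta>"
      using bd(4) unfolding lt_def by blast
    have "\<forall>\<beta>. \<beta> \<epsilon> \<Gamma> \<and> R\<Gamma> \<beta> \<delta> \<longrightarrow> app d \<beta> = z0" using \<delta>(2) app_zero by metis
    from contract_far[OF contr bd(2) \<gamma>(1) \<delta>(1) this] obtain F where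
      F: "aut L lt F" "F zero = zero" "\<forall>\<beta>. \<beta> \<epsilon> \<Gamma> \<and> (\<beta> = \<gamma> \<or> R\<Gamma> \<beta> \<gamma>) \<longrightarrow> app (F d) \<beta> = z0" by blast
    have "lt (F d) b" unfolding lt_def using \<gamma> F(3) app_zero by metis
    then show ?thesis using F by blast
  qed
  have down: "\<exists>F. aut L lt F \<and> F zero = zero \<and> lt b (F d)" if bd: "b \<epsilon> L" "d \<epsilon> L" "lt b zero" "lt d zero" for b d
  proof -
    obtain \<gamma> where \<gamma>: "\<gamma> \<epsilon> \<Gamma>" "RZ (app b \<gamma>) (app zero \<gamma>)" "\<forall>\<delta>. \<delta> \<epsilon> \<Gamma> \<and> R\<Gamma> \<delta> \<gamma> \<longrightarrow> app b \<delta> = app zero \<delta>"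
      using bd(3) unfolding lt_def by blast
    obtain \<delta> where \<delta>: "\<delta> \<epsilon> \<Gamma>" "\<forall>\<beta>. \<beta> \<epsilon> \<Gamma> \<and> R\<Gamma> \<beta> \<delta> \<longrightarrow> app d \<beta> = app zero \<beta>"
      using bd(4) unfolding lt_def by blast
    have "\<forall>\<beta>. \<beta> \<epsilon> \<Gamma> \<and> R\<Gamma> \<beta> \<delta> \<longrightarrow> app d \<beta> = z0" using \<delta>(2) app_zero by metis
    from contract_far[OF contr bd(2) \<gamma>(1) \<delta>(1) this] obtain F where
      F: "aut L lt F" "F zero = zero" "\<forall>\<beta>. \<beta> \<epsilon> \<Gamma> \<and> (\<beta> = \<gamma> \<or> R\<Gamma> \<beta> \<gamma>) \<longrightarrow> app (F d) \<beta> = z0" by blast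
    have "lt b (F d)" unfolding lt_def using \<gamma> F(3) app_zero by metis
    then show ?thesis using F by blast
  qed
  obtain K where K: "definable_fun K" "bij_betw K (elts (half a b)) (elts (half c d))"
    "\<forall>x y. x \<epsilon> half a b \<longrightarrow> y \<epsilon> half a b \<longrightarrow> lt x y \<longrightarrow> lt (K x) (K y)"
    by (rule half_open_isomorphic[OF strict_linear_L zero_L tr up down half ab half cd])
  have a: "a \<epsilon> half a b" and c: "c \<epsilon> half c d" using ab cd half by blast+
  have Kh: "K x \<epsilon> half c d" if "x \<epsilon> half a b" for x using K(2) that unfolding bij_betw_def by auto
  have "K a = c"
  proof (rule ccontr)
    assume n: "K a \<noteq> c"
    then have ca: "lt c (K a)" using Kh[OF a] half by metis
    have "c \<in> K ` elts (half a b)" using K(2) c unfolding bij_betw_def by simp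
    then obtain y where y: "y \<epsilon> half a b" "K y = c" by auto
    then have "lt a y" using n half by metis
    then have "lt (K a) c" using K(3) a y by blast
    then have "lt c c" using trans[OF cd(1) _ cd(1) ca] Kh[OF a] half by blast
    then show False using irrefl cd(1) by blast
  qed
  moreover have "elts (interval a b) = elts (half a b) - {a}" "elts (interval c d) = elts (half c d) - {c}"
    using irrefl ab(1) cd(1) by (auto simp: mem_interval half)
  ultimately have "bij_betw K (elts (interval a b)) (elts (interval c d))"
    using K(2) a unfolding bij_betw_def
    by (auto simp: inj_on_image_set_diff[of K "elts (half a b)"] intro: inj_on_diff)
  moreover have "x \<epsilon> half a b" if "x \<epsilon> interval a b" for x using that half mem_interval by blast
  ultimately show thesis using that K by blast
qed

end

section \<open>From choice to homogeneous orders\<close>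

context zf_model begin

lemma aut_id: "definable (\<lambda>w. R (w 0) (w (Suc 0))) \<Longrightarrow> aut L R (\<lambda>x. x)"
  unfolding aut_def by (auto intro: defin)

text \<open>The index set is \<open>Z \<times> S\<close> and the interval is \<open>(0,b)\<close>, where \<open>b\<close> has the value \<open>1\<close> at the
  index \<open>(0,a0)\<close> and vanishes elsewhere. Below \<open>b\<close> lie the functions with the value \<open>1\<close> at \<open>(1,s)\<close>
  only, one for each \<open>s\<close> in \<open>S\<close>; so \<open>S\<close> injects into the interval.\<close>
lemma homogeneous_of_infinite:
  assumes AC: "AC E" and inf: "\<not> finite_in E S"
  shows "\<exists>r. globally_homogeneous E S r"
proof -
  have \<omega>S: "lepoll omega S" by (rule omega_lepoll_infinite[OF AC inf])
  have SS: "lepoll (prod S S) S" by (rule square_lepoll[OF AC \<omega>S])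
  obtain W where W: "ordinal W" "lepoll S W" using well_orderable[OF AC] by blast
  obtain G where G: "definable_fun G" "\<forall>x. x \<epsilon> S \<longrightarrow> G x \<epsilon> W" "\<forall>x y. x \<epsilon> S \<longrightarrow> y \<epsilon> S \<longrightarrow> G x = G y \<longrightarrow> x = y"
    using W(2) by (rule lepollE)
  define RS where "RS x y \<longleftrightarrow> G x \<epsilon> G y" for x y
  have lin_S: "strict_linear S RS"
    unfolding strict_linear_def RS_def
  proof (intro conjI allI impI)
    have o: "ordinal (G x)" if "x \<epsilon> S" for x using G(2) W(1) ordinal_mem that by blast
    show "definable (\<lambda>w. G (w 0) \<epsilon> G (w (Suc 0)))" by (intro defin definable_term_comp1[OF G(1)])
    show "\<not> G x \<epsilon> G x" for x by (rule mem_irrefl)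
    show "G x \<epsilon> G z" if "x \<epsilon> S \<and> y \<epsilon> S \<and> z \<epsilon> S \<and> G x \<epsilon> G y \<and> G y \<epsilon> G z" for x y z
      using that ordinal_trans o by blast
    show "G x \<epsilon> G y \<or> x = y \<or> G y \<epsilon> G x" if "x \<epsilon> S \<and> y \<epsilon> S" for x y
      using that ordinal_linear[OF o o] G(3) by blast
  qed
  obtain e where e: "definable_fun e" "\<forall>x. x \<epsilon> omega \<longrightarrow> e x \<epsilon> S" "\<forall>x y. x \<epsilon> omega \<longrightarrow> y \<epsilon> omega \<longrightarrow> e x = e y \<longrightarrow> x = y"
    using \<omega>S by (rule lepollE)
  define a0 a1 where "a0 = e emp" and "a1 = e one"
  have one\<omega>: "one \<epsilon> omega" unfolding one_def by (rule succ_omega) simp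
  have a: "a0 \<epsilon> S" "a1 \<epsilon> S" "a0 \<noteq> a1"
    using e(2,3) one\<omega> emp_omega one_not_emp unfolding a0_def a1_def by metis+
  define z0 z1 where "z0 = opair one emp" and "z1 = opair one one"
  have z: "z0 \<epsilon> integers" "z1 \<epsilon> integers" "int_less z0 z1" "z0 \<noteq> z1"
  proof -
    show "z0 \<epsilon> integers" "z1 \<epsilon> integers" unfolding z0_def z1_def mem_integers using one\<omega> emp_omega by blast+
    have "emp \<epsilon> one" unfolding one_def by simp
    then show "int_less z0 z1" "z0 \<noteq> z1" unfolding z0_def z1_def int_less_def by simp_all
  qed
  define \<Gamma> where "\<Gamma> = prod integers S"
  interpret finite_support E \<Gamma> integers z0 "lex int_less RS" int_less
    by unfold_locales (simp_all add: \<Gamma>_def strict_linear_lex strict_linear_integers lin_S z)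
  have "\<exists>f. f \<epsilon> pow (prod integers integers) \<and> (aut_code integers int_less f \<and> app f z0 = a)" if a: "a \<epsilon> integers" for a
  proof -
    obtain F where F: "aut integers int_less F" "F z0 = a" using integers_transitive[OF z(1) a] by blast
    then show ?thesis using aut_code_lam[OF F(1)] z(1) by metis
  qed
  moreover have "definable (\<lambda>w. aut_code integers int_less (w (Suc 0)) \<and> app (w (Suc 0)) z0 = w 0)"
    by (intro definable_conj definable_aut_code) (intro defin)+
  ultimately obtain t where t: "\<forall>a. a \<epsilon> integers \<longrightarrow> app t a \<epsilon> pow (prod integers integers) \<and>
      aut_code integers int_less (app t a) \<and> app (app t a) z0 = a"
    using AC_select[OF AC, of "\<lambda>a f. aut_code integers int_less f \<and> app f z0 = a" integers "pow (prod integers integers)"] by blast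
  \<comment> \<open>The automorphism chosen for \<open>a = z0\<close> is replaced by the identity, so that
    translation by \<open>c\<close> changes a function only on the support of \<open>c\<close>.\<close>
  define h where "h a x = (if a = z0 then x else app (app t a) x)" for a x
  have h: "definable_term (\<lambda>w. h (w 0) (w (Suc 0)))" unfolding h_def by (intro defin)
  have h_aut: "aut integers int_less (h a)" if "a \<epsilon> integers" for a
  proof (cases "a = z0")
    case True
    then have "h a = (\<lambda>x. x)" unfolding h_def by simp
    then show ?thesis using aut_id[OF strict_linearD(1)[OF strict_linear_integers]] by simp
  next
    case False
    then have "h a = app (app t a)" unfolding h_def by simp
    then show ?thesis using aut_app t that by simp
  qed
  have h0: "h z0 x = x" for x unfolding h_def by simp
  have hz: "h a z0 = a" if "a \<epsilon> integers" for a using t that unfolding h_def by simp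
  \<comment> \<open>An automorphism of \<open>Z\<close> moves the first coordinate of \<open>\<delta>\<close> above that of \<open>\<gamma>\<close>.\<close>
  have contr: "\<exists>\<sigma>. aut \<Gamma> (lex int_less RS) \<sigma> \<and> lex int_less RS \<gamma> (\<sigma> \<delta>)" if gd: "\<gamma> \<epsilon> \<Gamma>" "\<delta> \<epsilon> \<Gamma>" for \<gamma> \<delta>
  proof -
    obtain m u where m: "m \<epsilon> integers" "\<gamma> = opair m u" using gd(1) unfolding \<Gamma>_def mem_prod by blast
    obtain n v where n: "n \<epsilon> integers" "\<delta> = opair n v" using gd(2) unfolding \<Gamma>_def mem_prod by blast
    obtain F where F: "aut integers int_less F" "F z0 = m" using integers_transitive[OF z(1) m(1)] by blast
    obtain \<sigma> where \<sigma>: "aut integers int_less \<sigma>" "\<sigma> n = F z1"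
      using integers_transitive[OF n(1) autD(2)[OF F(1) z(2)]] by blast
    have "int_less m (\<sigma> n)" using autD(4)[OF F(1) z(1,2,3)] F(2) \<sigma>(2) by simp
    then have "lex int_less RS \<gamma> (opair (\<sigma> (pfst \<delta>)) (psnd \<delta>))" unfolding lex_def m n by simp
    then show ?thesis using aut_lex[OF \<sigma>(1), of S RS] unfolding \<Gamma>_def by blast
  qed
  have iso: "\<exists>K. definable_fun K \<and> bij_betw K (elts (interval c d)) (elts (interval c' d')) \<and>
      (\<forall>x y. x \<epsilon> interval c d \<longrightarrow> y \<epsilon> interval c d \<longrightarrow> lt x y \<longrightarrow> lt (K x) (K y))"
    if cd: "c \<epsilon> L" "d \<epsilon> L" "lt c d" "c' \<epsilon> L" "d' \<epsilon> L" "lt c' d'" for c d c' d'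
    by (rule intervals_isomorphic[OF h h_aut h0 hz contr cd]) blast+
  define b where "b = upd (opair z0 a0) z1 zero"
  define M where "M = interval zero b"
  have \<Gamma>: "opair z0 a0 \<epsilon> \<Gamma>" using z a by (simp add: \<Gamma>_def)
  have bL: "b \<epsilon> L" unfolding b_def by (rule upd_L[OF zero_L \<Gamma> z(2)])
  have zb: "lt zero b"
    unfolding lt_def
  proof (intro exI[of _ "opair z0 a0"] conjI allI impI)
    show "int_less (app zero (opair z0 a0)) (app b (opair z0 a0))" using \<Gamma> z by (simp add: b_def app_zero app_upd)
    fix \<delta> assume "\<delta> \<epsilon> \<Gamma> \<and> lex int_less RS \<delta> (opair z0 a0)"
    then show "app zero \<delta> = app b \<delta>"
      using strict_linearD(2)[OF lin_\<Gamma> \<Gamma>] by (auto simp: b_def app_zero app_upd)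
  qed (rule \<Gamma>)
  have "lepoll S M"
  proof (rule lepollI[of "\<lambda>s. upd (opair z1 s) z1 zero"])
    show "definable_fun (\<lambda>s. upd (opair z1 s) z1 zero)" by (intro defin)
    show "upd (opair z1 s) z1 zero \<epsilon> M" if s: "s \<epsilon> S" for s
    proof -
      have g: "opair z1 s \<epsilon> \<Gamma>" using z s by (simp add: \<Gamma>_def)
      have "lt zero (upd (opair z1 s) z1 zero)"
        unfolding lt_def
      proof (intro exI[of _ "opair z1 s"] conjI allI impI)
        show "int_less (app zero (opair z1 s)) (app (upd (opair z1 s) z1 zero) (opair z1 s))" using g z by (simp add: app_zero app_upd)
        fix \<delta> assume "\<delta> \<epsilon> \<Gamma> \<and> lex int_less RS \<delta> (opair z1 s)"
        then show "app zero \<delta> = app (upd (opair z1 s) z1 zero) \<delta>"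
          using strict_linearD(2)[OF lin_\<Gamma> g] by (auto simp: app_zero app_upd)
      qed (rule g)
      moreover have "lt (upd (opair z1 s) z1 zero) b"
        unfolding lt_def
      proof (intro exI[of _ "opair z0 a0"] conjI allI impI)
        show "int_less (app (upd (opair z1 s) z1 zero) (opair z0 a0)) (app b (opair z0 a0))"
          using \<Gamma> z by (simp add: app_zero app_upd b_def)
        fix \<delta> assume d: "\<delta> \<epsilon> \<Gamma> \<and> lex int_less RS \<delta> (opair z0 a0)"
        then have "\<delta> \<noteq> opair z0 a0" using strict_linearD(2)[OF lin_\<Gamma> \<Gamma>] by blast
        moreover have "\<delta> \<noteq> opair z1 s"
          using d z strict_linearD(2)[OF strict_linear_integers z(1)] strict_linearD(3)[OF strict_linear_integers z(1,2,1) z(3)]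
          unfolding lex_def by auto
        ultimately show "app (upd (opair z1 s) z1 zero) \<delta> = app b \<delta>" using d by (simp add: app_zero app_upd b_def)
      qed (rule \<Gamma>)
      ultimately show ?thesis unfolding M_def mem_interval using upd_L[OF zero_L g z(2)] by blast
    qed
    show "s = s'" if s: "s \<epsilon> S" "s' \<epsilon> S" "upd (opair z1 s) z1 zero = upd (opair z1 s') z1 zero" for s s'
    proof (rule ccontr)
      assume "s \<noteq> s'"
      have g: "opair z1 s \<epsilon> \<Gamma>" using z s by (simp add: \<Gamma>_def)
      have "app (upd (opair z1 s) z1 zero) (opair z1 s) = z1" using g by (simp add: app_upd)
      moreover have "app (upd (opair z1 s') z1 zero) (opair z1 s) = z0" using g \<open>s \<noteq> s'\<close> by (simp add: app_upd app_zero)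
      ultimately show False using s(3) z(4) by metis
    qed
  qed
  moreover have "lepoll M S"
  proof -
    have "lepoll integers (prod omega omega)"
      by (rule lepoll_subset) (use one\<omega> in \<open>auto simp: mem_integers\<close>)
    then have ZS: "lepoll integers S" using omega_square_lepoll[OF AC] \<omega>S lepoll_trans by blast
    \<comment> \<open>\<open>J\<close> injects \<open>S \<times> S\<close> into \<open>S\<close>. The code of the zero function is \<open>J (a1, a0)\<close>; the
      code of the change \<open>p\<close>, a pair of an index and a value, applied to the function with code
      \<open>t\<close> is \<open>J (a0, J (q p, t))\<close>. The first components \<open>a0 \<noteq> a1\<close> keep them apart.\<close>
    have "lepoll (prod \<Gamma> integers) S"
      unfolding \<Gamma>_def using prod_lepoll_mono ZS SS lepoll_subset[of S S] lepoll_trans by meson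
    then obtain q where q: "definable_fun q" "\<forall>x. x \<epsilon> prod \<Gamma> integers \<longrightarrow> q x \<epsilon> S"
      "\<forall>x y. x \<epsilon> prod \<Gamma> integers \<longrightarrow> y \<epsilon> prod \<Gamma> integers \<longrightarrow> q x = q y \<longrightarrow> x = y"
      by (rule lepollE)
    obtain J where J: "definable_fun J" "\<forall>x. x \<epsilon> prod S S \<longrightarrow> J x \<epsilon> S"
      "\<forall>x y. x \<epsilon> prod S S \<longrightarrow> y \<epsilon> prod S S \<longrightarrow> J x = J y \<longrightarrow> x = y"
      using SS by (rule lepollE)
    have JS: "J (opair x y) \<epsilon> S" if "x \<epsilon> S" "y \<epsilon> S" for x y using J(2) that by simp
    have Ji: "x = x' \<and> y = y'" if "x \<epsilon> S" "y \<epsilon> S" "x' \<epsilon> S" "y' \<epsilon> S" "J (opair x y) = J (opair x' y')" for x y x' y'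
      using J(3) that opair_mem_prod opair_inject by metis
    have "lepoll L S"
    proof (rule generated_lepoll[OF AC, where c = "\<lambda>p t. J (opair a0 (J (opair (q p) t)))" and z = "J (opair a1 a0)"
          and P = "prod \<Gamma> integers" and ?x0.0 = zero and X = funs and F = "\<lambda>p f. upd (pfst p) (psnd p) f"])
      show "definable_term (\<lambda>w. J (opair a0 (J (opair (q (w 0)) (w (Suc 0))))))"
        by (intro defin definable_term_comp1[OF J(1)] definable_term_comp1[OF q(1)])
      show "definable_term (\<lambda>w. upd (pfst (w 0)) (psnd (w 0)) (w (Suc 0)))" by (intro defin)
      show "J (opair a1 a0) \<epsilon> S" using JS a by blast
      show "zero \<epsilon> funs" by (rule zero_funs)
      fix p assume p: "p \<epsilon> prod \<Gamma> integers"
      then obtain \<gamma> z where gz: "\<gamma> \<epsilon> \<Gamma>" "z \<epsilon> integers" "p = opair \<gamma> z" unfolding mem_prod by blast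
      have qp: "q p \<epsilon> S" using q(2) p by blast
      show "upd (pfst p) (psnd p) f \<epsilon> funs" if "f \<epsilon> funs" for f using upd_funs[OF that] gz by simp
      show "J (opair a0 (J (opair (q p) t))) \<epsilon> S \<and> J (opair a0 (J (opair (q p) t))) \<noteq> J (opair a1 a0)" if "t \<epsilon> S" for t
        using JS Ji a qp that by metis
      fix t p' t' assume t: "t \<epsilon> S" and p': "p' \<epsilon> prod \<Gamma> integers" and t': "t' \<epsilon> S"
        and eq: "J (opair a0 (J (opair (q p) t))) = J (opair a0 (J (opair (q p') t')))"
      have qp': "q p' \<epsilon> S" using q(2) p' by blast
      have "J (opair (q p) t) = J (opair (q p') t')"
        using Ji[OF a(1) JS[OF qp t] a(1) JS[OF qp' t'] eq] by blast
      then have "q p = q p' \<and> t = t'" by (rule Ji[OF qp t qp' t'])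
      then show "p = p' \<and> t = t'" using q(3) p p' by blast
    next
      fix N f assume N: "zero \<epsilon> N" "\<And>p x. p \<epsilon> prod \<Gamma> integers \<Longrightarrow> x \<epsilon> N \<Longrightarrow> upd (pfst p) (psnd p) x \<epsilon> N"
        and f: "f \<epsilon> L"
      have "upd \<gamma> z x \<epsilon> N" if "x \<epsilon> N" "\<gamma> \<epsilon> \<Gamma>" "z \<epsilon> integers" for \<gamma> z x
        using N(2)[of "opair \<gamma> z" x] that by simp
      then have "closed N" unfolding closed_def using N(1) by blast
      then show "f \<epsilon> N" using f mem_L by blast
    qed
    moreover have "lepoll M L" by (rule lepoll_subset) (simp add: M_def mem_interval)
    ultimately show ?thesis using lepoll_trans by blast
  qed
  ultimately obtain H where H: "definable_fun H" "bij_betw H (elts S) (elts M)"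
    by (rule schroeder_bernstein)
  have ne: "\<exists>y. y \<epsilon> interval c d" if cd: "c \<epsilon> L" "d \<epsilon> L" "lt c d" for c d
  proof -
    obtain K where "bij_betw K (elts M) (elts (interval c d))"
      unfolding M_def using iso[OF zero_L bL zb cd] by blast
    moreover have "H a0 \<in> elts M" using H(2) a(1) unfolding bij_betw_def by auto
    ultimately have "K (H a0) \<in> elts (interval c d)" unfolding bij_betw_def by blast
    then show ?thesis by auto
  qed
  note trans = strict_linearD(3)[OF strict_linear_L]
  show ?thesis
  proof (rule homogeneous_transport[OF _ H])
    show "strict_linear M lt" by (rule strict_linear_subset[OF strict_linear_L]) (simp add: M_def mem_interval)
    show "\<exists>y. y \<epsilon> M \<and> lt y x" if x: "x \<epsilon> M" for x
    proof -
      have x': "x \<epsilon> L" "lt zero x" "lt x b" using x unfolding M_def mem_interval by blast+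
      obtain y where "y \<epsilon> interval zero x" using ne[OF zero_L x'(1,2)] by blast
      then have y: "y \<epsilon> L" "lt zero y" "lt y x" unfolding mem_interval by blast+
      then have "lt y b" using trans[OF y(1) x'(1) bL] x' by blast
      then show ?thesis using y unfolding M_def mem_interval by blast
    qed
    show "\<exists>y. y \<epsilon> M \<and> lt x y" if x: "x \<epsilon> M" for x
    proof -
      have x': "x \<epsilon> L" "lt zero x" "lt x b" using x unfolding M_def mem_interval by blast+
      obtain y where "y \<epsilon> interval x b" using ne[OF x'(1) bL x'(3)] by blast
      then have y: "y \<epsilon> L" "lt x y" "lt y b" unfolding mem_interval by blast+
      then have "lt zero y" using trans[OF zero_L x'(1) y(1)] x' by blast
      then show ?thesis using y unfolding M_def mem_interval by blast
    qed
    fix c d J assume cd: "c \<epsilon> M" "d \<epsilon> M" "lt c d" and J: "\<forall>x. x \<epsilon> J \<longleftrightarrow> x \<epsilon> M \<and> lt c x \<and> lt x d"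
    have c: "c \<epsilon> L" "lt zero c" "d \<epsilon> L" "lt d b" using cd unfolding M_def mem_interval by blast+
    have "J = interval c d"
    proof (rule ext)
      fix x
      have "lt zero x \<and> lt x b" if "x \<epsilon> L" "lt c x" "lt x d"
        using trans[OF zero_L c(1) that(1) c(2) that(2)] trans[OF that(1) c(3) bL that(3) c(4)] by blast
      then show "x \<epsilon> J \<longleftrightarrow> x \<epsilon> interval c d" unfolding mem_interval J[rule_format] M_def by blast
    qed
    then show "\<exists>K. definable_fun K \<and> bij_betw K (elts J) (elts M) \<and> (\<forall>x y. x \<epsilon> J \<longrightarrow> y \<epsilon> J \<longrightarrow> lt x y \<longrightarrow> lt (K x) (K y))"
      unfolding M_def using iso[OF c(1,3) cd(3) zero_L bL zb] by simp
  qed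
qed

end

theorem theorem1p6:
  fixes E :: "'a \<Rightarrow> 'a \<Rightarrow> bool"
  assumes "ZF E"
  shows "(\<forall>S. \<not> finite_in E S \<longrightarrow> (\<exists>r. globally_homogeneous E S r)) \<longleftrightarrow> AC E"
proof -
  interpret zf_model E by unfold_locales (rule assms)
  show ?thesis
    using AC_of_lepoll_ordinal lepoll_ordinal_of_homogeneous homogeneous_of_infinite by blast
qed

end
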